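(* Let $(X,\Pi)$ be a $d$-dimensional weighted pure simplicial complex which is a two-sided $\gamma$-local-spectral expander with $\gamma<2^{-\Omega(k)}$, let $0\le i\le k\le d$, and let $f\in C_k$ be a boolean (i.e. $\{0,1\}$-valued) $(\varepsilon,i)$-pseudorandom function with Bottom-Up level functions $f_i$. Then \[ \langle f,f_i\rangle\le 2^{O(i)}\varepsilon^{1/3}\,\mathbb{E}[f]. \]
   Context: A $d$-dimensional pure simplicial complex $X$ on $[n]$ is given by a nonempty family $X(d)\subseteq\binom{[n]}{d}$ and its downward closure $X(i)=\{s\in\binom{[n]}{i}:\exists t\in X(d),\ s\subseteq t\}$ (an $i$-face has $i$ elements). A weighted complex carries a distribution $\pi_d=\Pi$ on $X(d)$, inducing $\pi_i(x)=\frac{1}{i+1}\sum_{y\in X(i+1),y\supset x}\pi_{i+1}(y)$. $C_i$: functions $X(i)\to\mathbb{R}$, $\langle f,g\rangle=\mathbb{E}_{\pi_i}[fg]$, $\|f\|_\infty=\max|f|$, $\mathbb{E}[f]=\mathbb{E}_{\pi_i}[f]$. Link of $s\in X(i)$: $X_s=\{t\setminus s:t\in X,t\supseteq s\}$, weighted by top-face distribution proportional to $\Pi(t)$. $U_i:C_i\to C_{i+1}$, $U_if(\tau)=\frac{1}{i+1}\sum_{\sigma\in X(i),\sigma\subset\tau}f(\sigma)$; $D_{i+1}:C_{i+1}\to C_i$, $D_{i+1}f(\tau)$ is the $\pi_{i+1}$-weighted average of $f$ over $(i+1)$-faces containing $\tau$. $U^i_j=U_{i-1}\circ\cdots\circ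 U_j$, $D^i_j=D_{j+1}\circ\cdots\circ D_i$ ($j\le i$). $\mathbb{E}_{X_\sigma}[f]=D^k_jf(\sigma)$ for $f\in C_k,\sigma\in X(j)$. Two-sided $\gamma$-local-spectral expander: for every $0\le i\le d-2$ and $s\in X(i)$, the weighted graph (vertices $X_s(1)$, edges $X_s(2)$, weighted by the link's level-2 distribution) has all nontrivial random-walk eigenvalues in $[-\gamma,\gamma]$. Bottom-Up Decomposition of $f\in C_k$: $g_i=D^k_if-\sum_{j<i}\binom{i}{j}U^i_jg_j$, $f_i=\binom{k}{i}U^k_ig_i$. $f|_\tau(\sigma)=f(\tau\cup\sigma)$ for $\tau\in X(j)$, a function on $X_\tau(k-j)$. $f$ is $(\varepsilon,i)$-pseudorandom if for all $\tau\in X(i)$: $|\mathbb{E}_{X_\tau}[f]|\le\varepsilon\|f\|_\infty$ and $\langle f|_\tau,f|_\tau\rangle\le\varepsilon\|f\|_\infty^2$ (inner product in the link). $O(\cdot),\Omega(\cdot)$ hide absolute constants. *)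

theory Defs
  imports Complex_Main
begin

text \<open>
  Faces are indexed by cardinality: an \<open>i\<close>-face has \<open>i\<close> elements. A complex is given by its
  dimension, its top faces and the weights \<open>\<Pi>\<close> of the top faces; the values of
  \<^term>\<open>top_weight\<close> off the top faces are irrelevant. Likewise a function in \<open>C\<^sub>i\<close> is a total
  function on sets of which only the values on \<open>X(i)\<close> matter. Top faces of weight 0 are allowed;
  averages conditioned on a face of weight 0 are then 0, by \<open>x / 0 = 0\<close>.
\<close>

record 'a weighted_complex =
  cdim :: nat
  top_faces :: "'a set set"
  top_weight :: "'a set \<Rightarrow> real"

definition weighted_pure_complex :: "nat \<Rightarrow> nat \<Rightarrow> nat weighted_complex \<Rightarrow> bool" where
  "weighted_pure_complex n d X \<longleftrightarrow>
     cdim X = d \<and>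
     top_faces X \<noteq> {} \<and>
     top_faces X \<subseteq> {t. t \<subseteq> {1..n} \<and> card t = d} \<and>
     (\<forall>t\<in>top_faces X. 0 \<le> top_weight X t) \<and>
     (\<Sum>t\<in>top_faces X. top_weight X t) = 1"

definition faces :: "('a, 'z) weighted_complex_scheme \<Rightarrow> nat \<Rightarrow> 'a set set" where
  "faces X i = {s. finite s \<and> card s = i \<and> (\<exists>t\<in>top_faces X. s \<subseteq> t)}"

text \<open>The distribution \<open>\<pi>\<^sub>i\<close> on \<open>X(i)\<close>; only levels \<open>i \<le> d\<close> are meaningful.\<close>

function level_weight :: "('a, 'z) weighted_complex_scheme \<Rightarrow> nat \<Rightarrow> 'a set \<Rightarrow> real" where
  "level_weight X i x =
     (if cdim X \<le> i then top_weight X x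
      else 1 / real (i + 1) * (\<Sum>y\<in>{y \<in> faces X (i + 1). x \<subset> y}. level_weight X (i + 1) y))"
  by pat_completeness auto
termination by (relation "measure (\<lambda>(X, i, x). cdim X - i)") auto
declare level_weight.simps [simp del]

definition inner_at :: "('a, 'z) weighted_complex_scheme \<Rightarrow> nat \<Rightarrow> ('a set \<Rightarrow> real) \<Rightarrow> ('a set \<Rightarrow> real) \<Rightarrow> real" where
  "inner_at X i f g = (\<Sum>x\<in>faces X i. level_weight X i x * (f x * g x))"

definition expect_at :: "('a, 'z) weighted_complex_scheme \<Rightarrow> nat \<Rightarrow> ('a set \<Rightarrow> real) \<Rightarrow> real" where
  "expect_at X i f = (\<Sum>x\<in>faces X i. level_weight X i x * f x)"

definition sup_norm_at :: "('a, 'z) weighted_complex_scheme \<Rightarrow> nat \<Rightarrow> ('a set \<Rightarrow> real) \<Rightarrow> real" where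
  "sup_norm_at X i f = Max ((\<lambda>x. \<bar>f x\<bar>) ` faces X i)"

definition link :: "'a weighted_complex \<Rightarrow> 'a set \<Rightarrow> 'a weighted_complex" where
  "link X s =
     \<lparr> cdim = cdim X - card s,
       top_faces = {t - s | t. t \<in> top_faces X \<and> s \<subseteq> t},
       top_weight = (\<lambda>u. top_weight X (u \<union> s) / (\<Sum>t\<in>{t \<in> top_faces X. s \<subseteq> t}. top_weight X t)) \<rparr>"

text \<open>\<open>U\<^sub>i : C\<^sub>i \<rightarrow> C\<^sub>i\<^sub>+\<^sub>1\<close> is \<open>up_op X i\<close> and \<open>D\<^sub>i : C\<^sub>i \<rightarrow> C\<^sub>i\<^sub>-\<^sub>1\<close> (for \<open>i \<ge> 1\<close>) is \<open>down_op X i\<close>.\<close>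

definition up_op :: "('a, 'z) weighted_complex_scheme \<Rightarrow> nat \<Rightarrow> ('a set \<Rightarrow> real) \<Rightarrow> 'a set \<Rightarrow> real" where
  "up_op X i f \<tau> = 1 / real (i + 1) * (\<Sum>\<sigma>\<in>{\<sigma> \<in> faces X i. \<sigma> \<subset> \<tau>}. f \<sigma>)"

definition down_op :: "('a, 'z) weighted_complex_scheme \<Rightarrow> nat \<Rightarrow> ('a set \<Rightarrow> real) \<Rightarrow> 'a set \<Rightarrow> real" where
  "down_op X i f \<tau> =
     (\<Sum>\<sigma>\<in>{\<sigma> \<in> faces X i. \<tau> \<subset> \<sigma>}. level_weight X i \<sigma> * f \<sigma>) /
     (\<Sum>\<sigma>\<in>{\<sigma> \<in> faces X i. \<tau> \<subset> \<sigma>}. level_weight X i \<sigma>)"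

text \<open>
  \<open>up_iter X i j\<close> is \<open>U\<^sub>i\<^sub>-\<^sub>1 \<circ> \<dots> \<circ> U\<^sub>j\<close> and \<open>down_iter X i j\<close> is \<open>D\<^sub>j\<^sub>+\<^sub>1 \<circ> \<dots> \<circ> D\<^sub>i\<close>, for \<open>j \<le> i\<close>.
\<close>

primrec up_iter :: "('a, 'z) weighted_complex_scheme \<Rightarrow> nat \<Rightarrow> nat \<Rightarrow> ('a set \<Rightarrow> real) \<Rightarrow> 'a set \<Rightarrow> real" where
  "up_iter X 0 j f = f"
| "up_iter X (Suc i) j f = (if Suc i \<le> j then f else up_op X i (up_iter X i j f))"

primrec down_iter :: "('a, 'z) weighted_complex_scheme \<Rightarrow> nat \<Rightarrow> nat \<Rightarrow> ('a set \<Rightarrow> real) \<Rightarrow> 'a set \<Rightarrow> real" where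
  "down_iter X 0 j f = f"
| "down_iter X (Suc i) j f = (if Suc i \<le> j then f else down_iter X i j (down_op X (Suc i) f))"

text \<open>
  The random walk on the weighted graph with vertices \<open>Y(1)\<close> and edges \<open>Y(2)\<close>. A vertex is a
  singleton \<open>u\<close>, so the other end of an edge \<open>e \<supset> u\<close> is the singleton \<open>e - u\<close>. Its stationary
  distribution is \<open>\<pi>\<^sub>1\<close>, and an eigenvalue is nontrivial if it has an eigenvector orthogonal to
  the constants; thus 1 is nontrivial exactly when the graph is disconnected.
\<close>

definition walk_op :: "('a, 'z) weighted_complex_scheme \<Rightarrow> ('a set \<Rightarrow> real) \<Rightarrow> 'a set \<Rightarrow> real" where
  "walk_op Y h u =
     (\<Sum>e\<in>{e \<in> faces Y 2. u \<subset> e}. level_weight Y 2 e * h (e - u)) /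
     (\<Sum>e\<in>{e \<in> faces Y 2. u \<subset> e}. level_weight Y 2 e)"

definition nontrivial_walk_eigenvalue :: "('a, 'z) weighted_complex_scheme \<Rightarrow> real \<Rightarrow> bool" where
  "nontrivial_walk_eigenvalue Y \<mu> \<longleftrightarrow>
     (\<exists>h. (\<exists>u\<in>faces Y 1. h u \<noteq> 0) \<and>
          inner_at Y 1 h (\<lambda>_. 1) = 0 \<and>
          (\<forall>u\<in>faces Y 1. walk_op Y h u = \<mu> * h u))"

definition two_sided_local_spectral_expander :: "'a weighted_complex \<Rightarrow> real \<Rightarrow> bool" where
  "two_sided_local_spectral_expander X \<gamma> \<longleftrightarrow>
     (\<forall>i s. i + 2 \<le> cdim X \<longrightarrow> s \<in> faces X i \<longrightarrow>
        (\<forall>\<mu>. nontrivial_walk_eigenvalue (link X s) \<mu> \<longrightarrow> \<mu> \<in> {-\<gamma>..\<gamma>}))"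

text \<open>
  The Bottom-Up Decomposition of \<open>f \<in> C\<^sub>k\<close>: \<open>bottom_up_g X k f i\<close> is \<open>g\<^sub>i \<in> C\<^sub>i\<close> and
  \<open>bottom_up_level X k f i\<close> is the level function \<open>f\<^sub>i \<in> C\<^sub>k\<close>.
\<close>

function bottom_up_g :: "('a, 'z) weighted_complex_scheme \<Rightarrow> nat \<Rightarrow> ('a set \<Rightarrow> real) \<Rightarrow> nat \<Rightarrow> 'a set \<Rightarrow> real" where
  "bottom_up_g X k f i =
     (\<lambda>\<sigma>. down_iter X k i f \<sigma> - (\<Sum>j<i. real (i choose j) * up_iter X i j (bottom_up_g X k f j) \<sigma>))"
  by pat_completeness auto
termination by (relation "measure (\<lambda>(X, k, f, i). i)") auto
declare bottom_up_g.simps [simp del]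

definition bottom_up_level :: "('a, 'z) weighted_complex_scheme \<Rightarrow> nat \<Rightarrow> ('a set \<Rightarrow> real) \<Rightarrow> nat \<Rightarrow> 'a set \<Rightarrow> real" where
  "bottom_up_level X k f i = (\<lambda>\<sigma>. real (k choose i) * up_iter X k i (bottom_up_g X k f i) \<sigma>)"

definition restrict_link :: "('a set \<Rightarrow> real) \<Rightarrow> 'a set \<Rightarrow> 'a set \<Rightarrow> real" where
  "restrict_link f \<tau> \<sigma> = f (\<tau> \<union> \<sigma>)"

text \<open>\<open>\<EE>\<^bsub>X\<^sub>\<tau>\<^esub>[f] = D\<^sup>k\<^sub>i f(\<tau>)\<close> for \<open>f \<in> C\<^sub>k\<close> and \<open>\<tau> \<in> X(i)\<close>.\<close>

definition pseudorandom :: "'a weighted_complex \<Rightarrow> nat \<Rightarrow> real \<Rightarrow> nat \<Rightarrow> ('a set \<Rightarrow> real) \<Rightarrow> bool" where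
  "pseudorandom X k \<epsilon> i f \<longleftrightarrow>
     (\<forall>\<tau>\<in>faces X i.
        \<bar>down_iter X k i f \<tau>\<bar> \<le> \<epsilon> * sup_norm_at X k f \<and>
        inner_at (link X \<tau>) (k - i) (restrict_link f \<tau>) (restrict_link f \<tau>)
          \<le> \<epsilon> * (sup_norm_at X k f)\<^sup>2)"

end

theory Submission
  imports Defs "HOL-Analysis.Analysis" "HOL-Combinatorics.Permutations"
begin

text \<open>
  Order the vertices \<open>y\<^sub>0, \<dots>, y\<^sub>d\<^sub>-\<^sub>1\<close> of a \<open>\<Pi>\<close>-random top face uniformly at random and put
  \<open>\<phi>(y) = f {y\<^sub>0, \<dots>, y\<^sub>k\<^sub>-\<^sub>1}\<close>. The coordinates behave almost like those of a product space: local
  spectral expansion says that \<open>\<EE>[h | y\<^sub>A, y\<^sub>b]\<close> is \<open>L\<^sup>2\<close>-close to \<open>\<EE>[h | y\<^sub>A]\<close> for \<open>h\<close> a function of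
  \<open>(y\<^sub>A, y\<^sub>a)\<close>, and telescoping yields \<open>\<EE>[h | y\<^sub>B] \<approx> \<EE>[h | y\<^sub>A\<^sub>\<inter>\<^sub>B]\<close> for functions \<open>h\<close> of \<open>y\<^sub>A\<close>.

  By Moebius inversion \<open>f\<^sub>i = \<Sum> g\<^sub>T\<close> over the \<open>i\<close>-subsets \<open>T\<close> of the positions, with
  \<open>g\<^sub>T = \<Sum>\<^sub>S\<^sub>\<subseteq>\<^sub>T (-1)\<^bsup>|T - S|\<^esup> \<EE>[\<phi> | y\<^sub>S]\<close>, and the \<open>g\<^sub>T\<close> are almost orthogonal. In
  \<open>\<EE>[f\<^sub>i\<^sup>4] = \<Sum> \<EE>[g\<^sub>T\<^sub>1 g\<^sub>T\<^sub>2 g\<^sub>T\<^sub>3 g\<^sub>T\<^sub>4]\<close> a quadruple in which some position is covered only once is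
  negligible; for the others Cauchy--Schwarz and the bound on \<open>\<EE>[g\<^sub>T\<^sup>2 | y\<^sub>J]\<close> that follows from
  pseudorandomness give at most \<open>2\<^bsup>O(i)\<^esup> \<epsilon> (i/k)\<^bsup>|T1 \<union> T2 \<union> T3 \<union> T4|\<^esup> \<parallel>f\<^sub>i\<parallel>\<^sup>2\<close>, which sums to
  \<open>2\<^bsup>O(i)\<^esup> \<epsilon> \<parallel>f\<^sub>i\<parallel>\<^sup>2\<close>. Hoelder's inequality \<open>\<langle>f, f\<^sub>i\<rangle>\<^sup>4 \<le> \<EE>[f]\<^sup>3 \<EE>[f\<^sub>i\<^sup>4]\<close> and \<open>\<parallel>f\<^sub>i\<parallel>\<^sup>2 \<approx> \<langle>f, f\<^sub>i\<rangle>\<close>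
  conclude. All errors are \<open>2\<^bsup>O(k)\<^esup> \<gamma> \<EE>[f]\<close>; they are harmless unless \<open>\<epsilon> < 8\<^bsup>-k\<^esup>\<close>, and then the
  pointwise bound \<open>|g\<^sub>T| \<le> 2\<^sup>i \<epsilon>\<close> suffices.
\<close>

section \<open>Contraction of a random walk from its eigenvalues\<close>

text \<open>First variation at an extremum: near t = 0 a nonzero linear term outgrows any multiple
  of t^2. It is applied to perturbations of the maximiser in the next lemma.\<close>

lemma linear_le_quadratic_imp_eq_0:
  fixes b c :: real
  assumes "\<And>t. 2 * t * b \<le> t\<^sup>2 * c"
  shows "b = 0"
proof (rule ccontr)
  assume "b \<noteq> 0"
  \<comment> \<open>The test value is t = b / m; any positive \<open>m\<close> larger than
    \<open>c\<close> gives 2 b^2 m < b^2 m.\<close>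
  define m where "m = \<bar>c\<bar> + 1"
  have m: "0 < m" "c < m" by (auto simp: m_def)
  have "2 * (b / m) * b * m\<^sup>2 \<le> (b / m)\<^sup>2 * c * m\<^sup>2"
    by (intro mult_right_mono assms) auto
  then have "2 * b\<^sup>2 * m \<le> b\<^sup>2 * c"
    using m by (simp add: power2_eq_square power_divide field_simps)
  also have "\<dots> < b\<^sup>2 * m" using \<open>b \<noteq> 0\<close> m by simp
  finally show False using \<open>b \<noteq> 0\<close> m by (simp add: mult_less_0_iff)
qed

text \<open>A maximiser \<open>e\<close> of \<open>\<parallel>T e\<parallel>\<close> on the unit sphere orthogonal to the constants satisfies
  \<open>T (T e) = \<lambda> e\<close>, so either \<open>e\<close> or \<open>T e + sqrt \<lambda> e\<close> is an eigenvector of \<open>T\<close> with eigenvalue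
  \<open>\<plusminus> sqrt \<lambda>\<close>.\<close>

lemma symmetric_walk_contraction:
  fixes V :: "'a set" and p :: "'a \<Rightarrow> real" and M :: "'a \<Rightarrow> 'a \<Rightarrow> real" and \<gamma> :: real
  defines "T \<equiv> \<lambda>h u. (\<Sum>v\<in>V. M u v * h v) / p u"
  assumes V: "finite V" and p: "\<And>u. u \<in> V \<Longrightarrow> 0 < p u"
    and sym: "\<And>u v. u \<in> V \<Longrightarrow> v \<in> V \<Longrightarrow> M u v = M v u"
    and rows: "\<And>u. u \<in> V \<Longrightarrow> (\<Sum>v\<in>V. M u v) = p u"
    and eig: "\<And>\<mu> h. \<exists>u\<in>V. h u \<noteq> 0 \<Longrightarrow> (\<Sum>u\<in>V. p u * h u) = 0 \<Longrightarrow> (\<And>u. u \<in> V \<Longrightarrow> T h u = \<mu> * h u) \<Longrightarrow> \<bar>\<mu>\<bar> \<le> \<gamma>"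
    and h: "(\<Sum>u\<in>V. p u * h u) = 0"
  shows "(\<Sum>u\<in>V. p u * (T h u)\<^sup>2) \<le> \<gamma>\<^sup>2 * (\<Sum>u\<in>V. p u * (h u)\<^sup>2)"
proof -
  define I where "I f g = (\<Sum>u\<in>V. p u * (f u * g u))" for f g :: "'a \<Rightarrow> real"
  have N: "I f f = (\<Sum>u\<in>V. p u * (f u)\<^sup>2)" for f by (simp add: I_def power2_eq_square)
  have I_nonneg: "0 \<le> I f f" for f unfolding N using p by (intro sum_nonneg mult_nonneg_nonneg) (auto intro: less_imp_le)
  have I_zero: "f u = 0" if "I f f = 0" "u \<in> V" for f u
  proof -
    have "p u * (f u)\<^sup>2 = 0"
      using that(1) sum_nonneg_eq_0_iff[OF V, of "\<lambda>u. p u * (f u)\<^sup>2"] p that(2) unfolding N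
      by (simp add: less_imp_le)
    then show ?thesis using p[OF that(2)] by simp
  qed
  have pT: "p u * T f u = (\<Sum>v\<in>V. M u v * f v)" if "u \<in> V" for f u
    using p[OF that] by (simp add: T_def)
  have selfadj: "I (T f) g = I f (T g)" for f g
  proof -
    have "I (T f) g = (\<Sum>u\<in>V. \<Sum>v\<in>V. M u v * f v * g u)"
      unfolding I_def by (intro sum.cong refl) (simp add: pT mult.assoc[symmetric] sum_distrib_right)
    also have "\<dots> = (\<Sum>v\<in>V. \<Sum>u\<in>V. M u v * f v * g u)" by (rule sum.swap)
    also have "\<dots> = (\<Sum>v\<in>V. f v * (p v * T g v))"
      by (intro sum.cong refl) (simp add: pT sum_distrib_left sym mult_ac)
    also have "\<dots> = I f (T g)" unfolding I_def by (simp add: mult_ac)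
    finally show ?thesis .
  qed
  have T1: "T (\<lambda>_. 1) u = 1" if "u \<in> V" for u using rows[OF that] p[OF that] by (simp add: T_def)
  have T_mean: "I (T f) (\<lambda>_. 1) = I f (\<lambda>_. 1)" for f
    unfolding selfadj by (simp add: I_def T1)
  have T_add: "T (\<lambda>u. f u + c * f' u) = (\<lambda>u. T f u + c * T f' u)" for f f' c
    by (simp add: T_def fun_eq_iff distrib_left sum.distrib add_divide_distrib sum_distrib_left mult_ac)
  have T_cong: "T f = T f'" if "\<And>u. u \<in> V \<Longrightarrow> f u = f' u" for f f'
    using that by (simp add: T_def)
  have I_cong: "I f f2 = I f' f2'" if "\<And>u. u \<in> V \<Longrightarrow> f u = f' u" "\<And>u. u \<in> V \<Longrightarrow> f2 u = f2' u" for f f' f2 f2'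
    using that by (simp add: I_def)
  have I_add: "I (\<lambda>u. f u + c * f' u) g = I f g + c * I f' g" for f f' g c
    by (simp add: I_def distrib_left distrib_right sum.distrib sum_distrib_left mult_ac)
  have I_comm: "I f g = I g f" for f g by (simp add: I_def mult_ac)
  have I_quad: "I (\<lambda>u. f u + c * f' u) (\<lambda>u. f u + c * f' u) = I f f + 2 * c * I f f' + c\<^sup>2 * I f' f'" for f f' c
  proof -
    have "I (\<lambda>u. f u + c * f' u) (\<lambda>u. f u + c * f' u)
        = (I f f + c * I f' f) + c * (I f f' + c * I f' f')"
      by (simp only: I_add I_comm[of _ "\<lambda>u. f u + c * f' u"])
    then show ?thesis by (simp add: I_comm[of f' f] power2_eq_square algebra_simps)
  qed
  have I_scale: "I (\<lambda>u. c * f u) (\<lambda>u. c * f u) = c\<^sup>2 * I f f" for c f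
    by (simp add: I_def sum_distrib_left power2_eq_square mult_ac)
  have T_scale: "T (\<lambda>u. c * f u) = (\<lambda>u. c * T f u)" for c f
    by (simp add: T_def fun_eq_iff sum_distrib_left mult_ac)
  have goal: ?thesis if "I (T h) (T h) \<le> \<gamma>\<^sup>2 * I h h" using that by (simp add: N)
  show ?thesis
  proof (cases "I h h = 0")
    case True
    have "T h = T (\<lambda>_. 0)" using I_zero[OF True] by (intro T_cong) auto
    then have "I (T h) (T h) = 0" by (simp add: T_def I_def)
    then show ?thesis using True by (intro goal) simp
  next
    case False
    \<comment> \<open>The index type may be infinite, so functions are pinned to 0 off
      \<open>V\<close> and the unit sphere is cut out of a product of compact intervals, compact by
      Tychonoff. The box costs nothing: norm 1 gives p(u) f(u)^2 \<le> 1, hence |f(u)| \<le> 1 +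
      f(u)^2 \<le> 1 + 1/p(u).\<close>
    define S where "S = (\<Pi>\<^sub>E u\<in>UNIV. if u \<in> V then {- (1 + 1 / p u)..1 + 1 / p u} else {0})
      \<inter> {f. I f (\<lambda>_. 1) = 0} \<inter> {f. I f f = 1}"
    have "compactin (product_topology (\<lambda>_::'a. euclideanreal) UNIV)
        (\<Pi>\<^sub>E u\<in>UNIV. if u \<in> V then {- (1 + 1 / p u)..1 + 1 / p u} else {0})"
      unfolding compactin_PiE by (auto simp: compactin_euclidean_iff)
    then have "compact (\<Pi>\<^sub>E u\<in>UNIV. if u \<in> V then {- (1 + 1 / p u)..1 + 1 / p u} else {0})"
      by (simp add: euclidean_product_topology compactin_euclidean_iff)
    moreover have "closed {f. I f (\<lambda>_. 1) = 0}" "closed {f. I f f = 1}"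
      unfolding I_def
      by (intro closed_Collect_eq continuous_intros continuous_on_product_coordinates)+
    ultimately have "compact S" unfolding S_def by (intro compact_Int_closed)
    have norm_S: "(\<lambda>u. if u \<in> V then c * f u else 0) \<in> S"
      if f: "I f (\<lambda>_. 1) = 0" and c: "c\<^sup>2 * I f f = 1" for f c
    proof -
      let ?f = "\<lambda>u. if u \<in> V then c * f u else 0"
      have "I ?f (\<lambda>_. 1) = I (\<lambda>u. c * f u) (\<lambda>_. 1)" by (rule I_cong) auto
      also have "\<dots> = c * I f (\<lambda>_. 1)" by (simp add: I_def sum_distrib_left mult_ac)
      finally have 1: "I ?f (\<lambda>_. 1) = 0" using f by simp
      have "I ?f ?f = I (\<lambda>u. c * f u) (\<lambda>u. c * f u)" by (rule I_cong) auto
      then have 2: "I ?f ?f = 1" using c by (simp add: I_scale)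
      have 3: "\<bar>?f u\<bar> \<le> 1 + 1 / p u" if u: "u \<in> V" for u
      proof -
        have "p u * (?f u)\<^sup>2 \<le> I ?f ?f"
          unfolding N using V u by (intro member_le_sum) (auto intro!: mult_nonneg_nonneg less_imp_le[OF p])
        then have "(?f u)\<^sup>2 \<le> 1 / p u" using 2 p[OF u] by (simp add: field_simps)
        moreover have "\<bar>?f u\<bar> \<le> 1 + (?f u)\<^sup>2"
          using sum_squares_bound[of "\<bar>?f u\<bar>" 1] by simp
        ultimately show ?thesis by linarith
      qed
      then have "?f u \<in> {- (1 + 1 / p u)..1 + 1 / p u}" if "u \<in> V" for u
        using that unfolding atLeastAtMost_iff abs_le_iff by (metis minus_le_iff)
      then show ?thesis unfolding S_def using 1 2 by (simp add: PiE_iff)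
    qed
    have hS: "(\<lambda>u. if u \<in> V then (1 / sqrt (I h h)) * h u else 0) \<in> S"
      using h False I_nonneg[of h] by (intro norm_S) (auto simp: I_def power_divide)
    have "continuous_on S (\<lambda>f. I (T f) (T f))"
      unfolding I_def T_def
      by (intro continuous_intros continuous_on_subset[OF continuous_on_product_coordinates]) (use p in force)+
    then obtain e where e: "e \<in> S" and max: "\<And>f. f \<in> S \<Longrightarrow> I (T f) (T f) \<le> I (T e) (T e)"
      using continuous_attains_sup[OF \<open>compact S\<close>] hS by blast
    define l where "l = I (T e) (T e)"
    have e1: "I e e = 1" "I e (\<lambda>_. 1) = 0" using e by (auto simp: S_def)
    have l: "0 \<le> l" unfolding l_def by (rule I_nonneg)
    have bound: "I (T f) (T f) \<le> l * I f f" if f: "I f (\<lambda>_. 1) = 0" for f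
    proof (cases "I f f = 0")
      case True
      have "T f = T (\<lambda>_. 0)" using I_zero[OF True] by (intro T_cong) auto
      then have "I (T f) (T f) = 0" by (simp add: T_def I_def)
      then show ?thesis using True by simp
    next
      case False
      let ?c = "1 / sqrt (I f f)" and ?f = "\<lambda>u. if u \<in> V then (1 / sqrt (I f f)) * f u else 0"
      have "T ?f = T (\<lambda>u. ?c * f u)" by (rule T_cong) auto
      then have "I (T ?f) (T ?f) = ?c\<^sup>2 * I (T f) (T f)" by (simp only: T_scale I_scale)
      moreover have "I (T ?f) (T ?f) \<le> l"
        unfolding l_def using f False I_nonneg[of f] by (intro max norm_S) (auto simp: power_divide)
      ultimately have "I (T f) (T f) / I f f \<le> l" using I_nonneg[of f] by (simp add: power_divide)
      then show ?thesis using False I_nonneg[of f] by (simp add: divide_le_eq)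
    qed
    \<comment> \<open>Compare \<open>e\<close> with e + t f: both sides of \<open>bound\<close>
      agree at t = 0, so the terms linear in t must agree as well.\<close>
    have orth: "I (T e) (T f) = l * I e f" if f: "I f (\<lambda>_. 1) = 0" for f
    proof -
      have "2 * t * (I (T e) (T f) - l * I e f) \<le> t\<^sup>2 * (l * I f f - I (T f) (T f))" for t
      proof -
        have "I (\<lambda>u. e u + t * f u) (\<lambda>_. 1) = 0" using e1 f by (simp add: I_add)
        from bound[OF this] have "l + 2 * t * I (T e) (T f) + t\<^sup>2 * I (T f) (T f)
            \<le> l * (1 + 2 * t * I e f + t\<^sup>2 * I f f)"
          by (simp only: T_add I_quad e1 l_def)
        then show ?thesis by (simp add: algebra_simps)
      qed
      then have "I (T e) (T f) - l * I e f = 0" by (rule linear_le_quadratic_imp_eq_0)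
      then show ?thesis by simp
    qed
    \<comment> \<open>\<open>q\<close> is itself orthogonal to the constants, so \<open>orth\<close>
      may be tested against it, and this forces its norm to be 0.\<close>
    define q where "q u = T (T e) u + (- l) * e u" for u
    have q1: "I q (\<lambda>_. 1) = 0" unfolding q_def I_add T_mean e1 by simp
    have "I q q = I (T (T e)) q + (- l) * I e q" unfolding q_def I_add ..
    also have "\<dots> = 0" using orth[OF q1] by (simp add: selfadj)
    finally have TT: "T (T e) u = l * e u" if "u \<in> V" for u
      using I_zero[OF _ that, of q] by (simp add: q_def)
    define s where "s = sqrt l"
    have s: "0 \<le> s" "s * s = l" using l by (auto simp: s_def)
    define k where "k u = T e u + s * e u" for u
    have "\<bar>s\<bar> \<le> \<gamma>"
    proof (cases "\<exists>u\<in>V. k u \<noteq> 0")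
      case True
      then show ?thesis
      proof (rule eig)
        have "I k (\<lambda>_. 1) = 0" unfolding k_def I_add T_mean e1 by simp
        then show "(\<Sum>u\<in>V. p u * k u) = 0" by (simp add: I_def)
        fix u assume "u \<in> V"
        then have "T k u = l * e u + s * T e u" unfolding k_def T_add by (simp add: TT)
        then show "T k u = s * k u" using s(2) by (simp add: k_def algebra_simps)
      qed
    next
      case False
      have "\<bar>- s\<bar> \<le> \<gamma>"
      proof (rule eig)
        show "\<exists>u\<in>V. e u \<noteq> 0"
        proof (rule ccontr)
          assume "\<not> ?thesis"
          then have "I e e = 0" by (simp add: I_def)
          then show False using e1 by simp
        qed
        show "(\<Sum>u\<in>V. p u * e u) = 0" using e1 by (simp add: I_def)
        show "T e u = - s * e u" if "u \<in> V" for u using False that by (auto simp: k_def eq_neg_iff_add_eq_0)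
      qed
      then show ?thesis by simp
    qed
    then have "l \<le> \<gamma>\<^sup>2" using s by (metis abs_of_nonneg power2_eq_square power_mono)
    have "I (T h) (T h) \<le> l * I h h" using h by (intro bound) (simp add: I_def)
    also have "\<dots> \<le> \<gamma>\<^sup>2 * I h h" using \<open>l \<le> \<gamma>\<^sup>2\<close> I_nonneg by (rule mult_right_mono)
    finally show ?thesis by (rule goal)
  qed
qed

section \<open>Conditional expectations on a finite probability space\<close>

locale finite_prob =
  fixes \<Omega> :: "('i \<Rightarrow> 'v) set" and w :: "('i \<Rightarrow> 'v) \<Rightarrow> real"
  assumes finite_\<Omega>: "finite \<Omega>"
    and w_pos: "x \<in> \<Omega> \<Longrightarrow> 0 < w x"
    and w_sum: "sum w \<Omega> = 1"
begin

definition fiber :: "'i set \<Rightarrow> ('i \<Rightarrow> 'v) \<Rightarrow> ('i \<Rightarrow> 'v) set" where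
  "fiber A x = {y \<in> \<Omega>. \<forall>a\<in>A. y a = x a}"

text \<open>For \<open>A\<close> = {} the fiber is the whole space, so \<open>cond {} h x\<close> is
  the plain expectation whatever the point x is. This is why later statements about global
  quantities carry some x in \<Omega>.\<close>

definition cond :: "'i set \<Rightarrow> (('i \<Rightarrow> 'v) \<Rightarrow> real) \<Rightarrow> ('i \<Rightarrow> 'v) \<Rightarrow> real" where
  "cond A h x = (\<Sum>y\<in>fiber A x. w y * h y) / (\<Sum>y\<in>fiber A x. w y)"

definition depends_on :: "'i set \<Rightarrow> (('i \<Rightarrow> 'v) \<Rightarrow> real) \<Rightarrow> bool" where
  "depends_on A h \<longleftrightarrow> (\<forall>x\<in>\<Omega>. \<forall>y\<in>\<Omega>. (\<forall>a\<in>A. x a = y a) \<longrightarrow> h x = h y)"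

definition cnorm :: "'i set \<Rightarrow> ('i \<Rightarrow> 'v) \<Rightarrow> (('i \<Rightarrow> 'v) \<Rightarrow> real) \<Rightarrow> real" where
  "cnorm Q x h = sqrt (cond Q (\<lambda>y. (h y)\<^sup>2) x)"

lemma finite_fiber [simp]: "finite (fiber A x)"
  using finite_\<Omega> by (simp add: fiber_def)

lemma fiber_self: "x \<in> \<Omega> \<Longrightarrow> x \<in> fiber A x"
  by (simp add: fiber_def)

lemma fiber_in: "y \<in> fiber A x \<Longrightarrow> y \<in> \<Omega>"
  by (simp add: fiber_def)

lemma fiber_eq: "y \<in> fiber A x \<Longrightarrow> fiber A y = fiber A x"
  by (auto simp: fiber_def)

lemma fiber_empty [simp]: "fiber {} x = \<Omega>"
  by (simp add: fiber_def)

lemma fiber_weight_pos: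
  assumes "x \<in> \<Omega>"
  shows "0 < (\<Sum>y\<in>fiber A x. w y)"
  using assms by (intro sum_pos2[of _ x]) (auto simp: fiber_self intro: less_imp_le w_pos fiber_in)

section \<open>Algebra of conditional expectation\<close>

lemma cond_cong:
  assumes "\<And>y. y \<in> fiber A x \<Longrightarrow> h y = h' y"
  shows "cond A h x = cond A h' x"
  unfolding cond_def using assms by (simp cong: sum.cong)

lemma cond_add: "cond A (\<lambda>y. h y + h' y) x = cond A h x + cond A h' x"
  by (simp add: cond_def algebra_simps sum.distrib add_divide_distrib)

lemma cond_diff: "cond A (\<lambda>y. h y - h' y) x = cond A h x - cond A h' x"
  by (simp add: cond_def algebra_simps sum_subtractf diff_divide_distrib)

lemma cond_cmult: "cond A (\<lambda>y. c * h y) x = c * cond A h x"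
  by (simp add: cond_def sum_distrib_left mult.left_commute)

lemma cond_sum: "cond A (\<lambda>y. \<Sum>j\<in>I. h j y) x = (\<Sum>j\<in>I. cond A (h j) x)"
  by (induction I rule: infinite_finite_induct) (simp_all add: cond_add cond_def)

lemma cond_mono:
  assumes "x \<in> \<Omega>" "\<And>y. y \<in> fiber A x \<Longrightarrow> h y \<le> h' y"
  shows "cond A h x \<le> cond A h' x"
  unfolding cond_def using assms fiber_weight_pos[of x A]
  by (intro divide_right_mono sum_mono mult_left_mono) (auto intro: less_imp_le w_pos fiber_in)

lemma cond_const: "x \<in> \<Omega> \<Longrightarrow> cond A (\<lambda>_. c) x = c"
  using fiber_weight_pos[of x A] by (simp add: cond_def sum_distrib_right[symmetric])

lemma cond_nonneg: "x \<in> \<Omega> \<Longrightarrow> (\<And>y. y \<in> \<Omega> \<Longrightarrow> 0 \<le> h y) \<Longrightarrow> 0 \<le> cond A h x"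
  using cond_mono[of x A "\<lambda>_. 0" h] by (simp add: cond_const fiber_in)

lemma cond_le: "x \<in> \<Omega> \<Longrightarrow> (\<And>y. y \<in> \<Omega> \<Longrightarrow> h y \<le> c) \<Longrightarrow> cond A h x \<le> c"
  using cond_mono[of x A h "\<lambda>_. c"] by (simp add: cond_const fiber_in)

lemma depends_onD:
  "depends_on A h \<Longrightarrow> x \<in> \<Omega> \<Longrightarrow> y \<in> fiber A x \<Longrightarrow> h y = h x"
  unfolding depends_on_def fiber_def by blast

lemma depends_on_mono: "depends_on A h \<Longrightarrow> A \<subseteq> B \<Longrightarrow> depends_on B h"
  unfolding depends_on_def by blast

lemma depends_on_cond: "depends_on A (cond A h)"
  unfolding depends_on_def
proof (intro ballI impI)
  fix x y assume "x \<in> \<Omega>" "y \<in> \<Omega>" "\<forall>a\<in>A. x a = y a"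
  then have "fiber A x = fiber A y" by (auto simp: fiber_def)
  then show "cond A h x = cond A h y" by (simp add: cond_def)
qed

lemma depends_on_mult:
  "depends_on A h \<Longrightarrow> depends_on A h' \<Longrightarrow> depends_on A (\<lambda>y. h y * h' y)"
  unfolding depends_on_def by (intro ballI impI arg_cong2[of _ _ _ _ "(*)"]) blast+

lemma depends_on_power: "depends_on A h \<Longrightarrow> depends_on A (\<lambda>y. h y ^ n)"
  unfolding depends_on_def by (intro ballI impI arg_cong[of _ _ "\<lambda>t. t ^ n"]) blast

lemma depends_on_cmult: "depends_on A h \<Longrightarrow> depends_on A (\<lambda>y. c * h y)"
  unfolding depends_on_def by (intro ballI impI arg_cong[of _ _ "(*) c"]) blast

lemma depends_on_sum:
  "(\<And>j. j \<in> I \<Longrightarrow> depends_on A (h j)) \<Longrightarrow> depends_on A (\<lambda>y. \<Sum>j\<in>I. h j y)"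
  unfolding depends_on_def by (intro ballI impI sum.cong refl) blast

lemma cond_pull_out:
  assumes "depends_on A h" "x \<in> \<Omega>"
  shows "cond A (\<lambda>y. h y * h' y) x = h x * cond A h' x"
proof -
  have "cond A (\<lambda>y. h y * h' y) x = cond A (\<lambda>y. h x * h' y) x"
    by (rule cond_cong) (simp only: depends_onD[OF assms])
  also have "\<dots> = h x * cond A h' x" by (rule cond_cmult)
  finally show ?thesis .
qed

lemma cond_id:
  assumes "depends_on A h" "x \<in> \<Omega>"
  shows "cond A h x = h x"
  using cond_pull_out[OF assms, of "\<lambda>_. 1"] by (simp only: cond_const[OF assms(2)] mult_1_right)

text \<open>The \<open>B\<close>-fibers partition the \<open>A\<close>-fiber. Summing over pairs (y,
  z) in a common \<open>B\<close>-fiber and exchanging the order, the weights of y add up to the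
  normalising constant and cancel it.\<close>

lemma cond_tower:
  assumes "A \<subseteq> B" "x \<in> \<Omega>"
  shows "cond A (cond B h) x = cond A h x"
proof -
  have sub: "z \<in> fiber A x" if "y \<in> fiber A x" "z \<in> fiber B y" for y z
    using that assms unfolding fiber_def by fastforce
  have sym: "y \<in> fiber B z \<longleftrightarrow> z \<in> fiber B y" if "y \<in> \<Omega>" "z \<in> \<Omega>" for y z
    using that unfolding fiber_def mem_Collect_eq by (metis (no_types, lifting))
  have "(\<Sum>y\<in>fiber A x. w y * cond B h y)
      = (\<Sum>y\<in>fiber A x. \<Sum>z\<in>{z \<in> fiber A x. z \<in> fiber B y}. w y * (w z * h z) / (\<Sum>u\<in>fiber B y. w u))"
  proof (intro sum.cong refl)
    fix y assume y: "y \<in> fiber A x"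
    have "{z \<in> fiber A x. z \<in> fiber B y} = fiber B y" using sub[OF y] by auto
    then show "w y * cond B h y
      = (\<Sum>z\<in>{z \<in> fiber A x. z \<in> fiber B y}. w y * (w z * h z) / (\<Sum>u\<in>fiber B y. w u))"
      by (simp add: cond_def sum_distrib_left sum_divide_distrib)
  qed
  also have "\<dots> = (\<Sum>z\<in>fiber A x. \<Sum>y\<in>{y \<in> fiber A x. z \<in> fiber B y}. w y * (w z * h z) / (\<Sum>u\<in>fiber B y. w u))"
    by (rule sum.swap_restrict) auto
  also have "\<dots> = (\<Sum>z\<in>fiber A x. w z * h z)"
  proof (intro sum.cong refl)
    fix z assume z: "z \<in> fiber A x"
    then have z\<Omega>: "z \<in> \<Omega>" by (rule fiber_in)
    have eq: "{y \<in> fiber A x. z \<in> fiber B y} = fiber B z"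
      using sub[OF z] sym[OF _ z\<Omega>] by (auto dest: fiber_in)
    have "(\<Sum>y\<in>fiber B z. w y * (w z * h z) / (\<Sum>u\<in>fiber B y. w u))
        = (\<Sum>y\<in>fiber B z. w y * (w z * h z) / (\<Sum>u\<in>fiber B z. w u))"
      by (intro sum.cong refl) (simp add: fiber_eq)
    also have "\<dots> = w z * h z"
      using fiber_weight_pos[OF z\<Omega>, of B]
      by (simp add: sum_divide_distrib[symmetric] sum_distrib_right[symmetric])
    finally show "(\<Sum>y\<in>{y \<in> fiber A x. z \<in> fiber B y}. w y * (w z * h z) / (\<Sum>u\<in>fiber B y. w u))
        = w z * h z" by (simp add: eq)
  qed
  finally show ?thesis by (simp add: cond_def[of A])
qed

text \<open>Conditional expectation is self-adjoint: next to a function of the coordinates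
  \<open>A\<close>, the other factor may be replaced by its projection. Nearly every decoupling step
  below starts with this.\<close>

lemma cond_mult_cond:
  assumes "depends_on A h" "Q \<subseteq> A" "x \<in> \<Omega>"
  shows "cond Q (\<lambda>y. h y * h' y) x = cond Q (\<lambda>y. h y * cond A h' y) x"
proof -
  have "cond Q (\<lambda>y. h y * h' y) x = cond Q (cond A (\<lambda>y. h y * h' y)) x"
    using assms by (simp add: cond_tower)
  also have "\<dots> = cond Q (\<lambda>y. h y * cond A h' y) x"
    using assms by (intro cond_cong) (auto intro!: cond_pull_out dest: fiber_in)
  finally show ?thesis .
qed

section \<open>Conditional L2 norms\<close>

lemma cnorm_nonneg [simp]: "x \<in> \<Omega> \<Longrightarrow> 0 \<le> cnorm Q x h"
  unfolding cnorm_def by (intro real_sqrt_ge_zero cond_nonneg) auto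

lemma cnorm_sq: "x \<in> \<Omega> \<Longrightarrow> (cnorm Q x h)\<^sup>2 = cond Q (\<lambda>y. (h y)\<^sup>2) x"
  unfolding cnorm_def by (intro real_sqrt_pow2 cond_nonneg) auto

text \<open>Absorbing the square root of the normalised weight into the function gives a Euclidean
  norm, so that Cauchy-Schwarz and the triangle inequality carry over.\<close>

lemma cnorm_L2_set:
  assumes "x \<in> \<Omega>"
  shows "cnorm Q x h = L2_set (\<lambda>y. sqrt (w y / (\<Sum>u\<in>fiber Q x. w u)) * h y) (fiber Q x)"
proof -
  have "w y * (h y)\<^sup>2 / W = (sqrt (w y / W) * h y)\<^sup>2" if "y \<in> fiber Q x" "W = (\<Sum>u\<in>fiber Q x. w u)" for y W
    using that fiber_weight_pos[OF assms, of Q] w_pos[OF fiber_in[OF that(1)]]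
    by (simp add: power_mult_distrib)
  then show ?thesis
    unfolding cnorm_def cond_def L2_set_def sum_divide_distrib by simp
qed

lemma cond_Cauchy_Schwarz:
  assumes "x \<in> \<Omega>"
  shows "\<bar>cond Q (\<lambda>y. h y * h' y) x\<bar> \<le> cnorm Q x h * cnorm Q x h'"
proof -
  define W where "W = (\<Sum>u\<in>fiber Q x. w u)"
  have W: "0 < W" using fiber_weight_pos[OF assms] by (simp add: W_def)
  have "\<bar>cond Q (\<lambda>y. h y * h' y) x\<bar> = \<bar>\<Sum>y\<in>fiber Q x. w y * (h y * h' y) / W\<bar>"
    unfolding cond_def W_def sum_divide_distrib ..
  also have "\<dots> \<le> (\<Sum>y\<in>fiber Q x. \<bar>w y * (h y * h' y) / W\<bar>)"
    by (rule sum_abs)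
  also have "\<dots> = (\<Sum>y\<in>fiber Q x. \<bar>sqrt (w y / W) * h y\<bar> * \<bar>sqrt (w y / W) * h' y\<bar>)"
  proof (intro sum.cong refl)
    fix y assume "y \<in> fiber Q x"
    then have p: "0 \<le> w y / W" using W w_pos[OF fiber_in, of y Q x] by simp
    have "\<bar>sqrt (w y / W) * h y\<bar> * \<bar>sqrt (w y / W) * h' y\<bar>
        = (sqrt (w y / W) * sqrt (w y / W)) * \<bar>h y * h' y\<bar>"
      using p by (simp only: abs_mult abs_of_nonneg[OF real_sqrt_ge_zero[OF p]] ac_simps)
    also have "\<dots> = (w y / W) * \<bar>h y * h' y\<bar>" 
      using real_sqrt_mult_self[of "w y / W"] p by (simp only: abs_of_nonneg)
    also have "\<dots> = \<bar>w y / W * (h y * h' y)\<bar>" using p by (simp only: abs_mult abs_of_nonneg)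
    also have "\<dots> = \<bar>w y * (h y * h' y) / W\<bar>" by simp
    finally show "\<bar>w y * (h y * h' y) / W\<bar> = \<bar>sqrt (w y / W) * h y\<bar> * \<bar>sqrt (w y / W) * h' y\<bar>" by simp
  qed
  also have "\<dots> \<le> cnorm Q x h * cnorm Q x h'"
    unfolding cnorm_L2_set[OF assms] W_def by (rule L2_set_mult_ineq)
  finally show ?thesis .
qed

lemma cond_mult_le:
  "x \<in> \<Omega> \<Longrightarrow> cond Q (\<lambda>y. h y * h' y) x \<le> cnorm Q x h * cnorm Q x h'"
  by (rule order_trans[OF abs_ge_self cond_Cauchy_Schwarz])

lemma cnorm_add_le:
  assumes "x \<in> \<Omega>"
  shows "cnorm Q x (\<lambda>y. h y + h' y) \<le> cnorm Q x h + cnorm Q x h'"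
  unfolding cnorm_L2_set[OF assms] distrib_left by (rule L2_set_triangle_ineq)

lemma cnorm_mono:
  assumes "x \<in> \<Omega>" "\<And>y. y \<in> \<Omega> \<Longrightarrow> \<bar>h y\<bar> \<le> \<bar>h' y\<bar>"
  shows "cnorm Q x h \<le> cnorm Q x h'"
  unfolding cnorm_def using assms
  by (intro real_sqrt_le_mono cond_mono) (auto simp: abs_le_square_iff fiber_in)

lemma cnorm_cong:
  assumes "\<And>y. y \<in> \<Omega> \<Longrightarrow> h y = h' y"
  shows "cnorm Q x h = cnorm Q x h'"
  unfolding cnorm_def using assms by (intro arg_cong[of _ _ sqrt] cond_cong) (auto dest: fiber_in)

lemma cnorm_cmult: "cnorm Q x (\<lambda>y. c * h y) = \<bar>c\<bar> * cnorm Q x h"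
  unfolding cnorm_def by (simp add: power_mult_distrib cond_cmult real_sqrt_mult)

lemma cnorm_sum_le:
  assumes "x \<in> \<Omega>"
  shows "cnorm Q x (\<lambda>y. \<Sum>j\<in>I. h j y) \<le> (\<Sum>j\<in>I. cnorm Q x (h j))"
proof (induction I rule: infinite_finite_induct)
  case (insert a I)
  then show ?case using cnorm_add_le[OF assms, of Q "h a" "\<lambda>y. \<Sum>j\<in>I. h j y"] by simp
qed (simp_all add: cnorm_def cond_def)

lemma cnorm_mult_bounded:
  assumes "x \<in> \<Omega>" "\<And>y. y \<in> \<Omega> \<Longrightarrow> \<bar>h y\<bar> \<le> c"
  shows "cnorm Q x (\<lambda>y. h y * h' y) \<le> c * cnorm Q x h'"
proof -
  have "0 \<le> c" using assms by (meson abs_ge_zero order_trans)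
  then have "cnorm Q x (\<lambda>y. h y * h' y) \<le> cnorm Q x (\<lambda>y. c * h' y)"
    using assms by (intro cnorm_mono) (auto simp: abs_mult intro!: mult_right_mono)
  then show ?thesis using \<open>0 \<le> c\<close> by (simp add: cnorm_cmult)
qed

text \<open>Jensen's inequality for the square, obtained as Cauchy-Schwarz against the constant
  1.\<close>

lemma cond_sq_le:
  assumes "x \<in> \<Omega>"
  shows "(cond A h x)\<^sup>2 \<le> cond A (\<lambda>y. (h y)\<^sup>2) x"
proof -
  have "\<bar>cond A h x\<bar> \<le> cnorm A x h"
    using cond_Cauchy_Schwarz[OF assms, of A h "\<lambda>_. 1"] assms by (simp add: cnorm_def cond_const)
  then have "\<bar>cond A h x\<bar>\<^sup>2 \<le> (cnorm A x h)\<^sup>2" by (intro power_mono) auto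
  then show ?thesis using assms by (simp add: cnorm_sq)
qed

lemma cnorm_cond_le:
  assumes "x \<in> \<Omega>" "Q \<subseteq> A"
  shows "cnorm Q x (cond A h) \<le> cnorm Q x h"
proof -
  have "cond Q (\<lambda>y. (cond A h y)\<^sup>2) x \<le> cond Q (cond A (\<lambda>y. (h y)\<^sup>2)) x"
    using assms by (intro cond_mono cond_sq_le) (auto dest: fiber_in)
  then show ?thesis using assms by (simp add: cnorm_def cond_tower)
qed

lemma cond_permute:
  assumes inv: "\<And>x. x \<in> \<Omega> \<Longrightarrow> x \<circ> p \<in> \<Omega> \<and> w (x \<circ> p) = w x"
    and inv': "\<And>x. x \<in> \<Omega> \<Longrightarrow> x \<circ> inv p \<in> \<Omega>" and p: "bij p" and x: "x \<in> \<Omega>"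
  shows "cond A h (x \<circ> p) = cond (p ` A) (\<lambda>z. h (z \<circ> p)) x"
proof -
  have bij: "bij_betw (\<lambda>z. z \<circ> p) (fiber (p ` A) x) (fiber A (x \<circ> p))"
  proof (rule bij_betw_byWitness[where f' = "\<lambda>z. z \<circ> inv p"])
    show "\<forall>a\<in>fiber (p ` A) x. (a \<circ> p) \<circ> inv p = a"
      using p by (auto simp: fun_eq_iff bij_is_surj surj_f_inv_f)
    show "\<forall>a\<in>fiber A (x \<circ> p). (a \<circ> inv p) \<circ> p = a"
      using p by (auto simp: fun_eq_iff bij_is_inj)
    show "(\<lambda>z. z \<circ> p) ` fiber (p ` A) x \<subseteq> fiber A (x \<circ> p)"
    proof (clarify)
      fix z assume z: "z \<in> fiber (p ` A) x"
      then have "z \<circ> p \<in> \<Omega>" using inv fiber_in by blast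
      then show "z \<circ> p \<in> fiber A (x \<circ> p)" using z by (simp add: fiber_def)
    qed
    show "(\<lambda>z. z \<circ> inv p) ` fiber A (x \<circ> p) \<subseteq> fiber (p ` A) x"
    proof (clarify)
      fix z assume z: "z \<in> fiber A (x \<circ> p)"
      then have "z \<circ> inv p \<in> \<Omega>" using inv' fiber_in by blast
      then show "z \<circ> inv p \<in> fiber (p ` A) x" using z p by (simp add: fiber_def bij_is_inj)
    qed
  qed
  have "(\<Sum>y\<in>fiber A (x \<circ> p). w y * h y) = (\<Sum>z\<in>fiber (p ` A) x. w (z \<circ> p) * h (z \<circ> p))"
    using sum.reindex_bij_betw[OF bij, of "\<lambda>y. w y * h y"] by simp
  moreover have "(\<Sum>y\<in>fiber A (x \<circ> p). w y) = (\<Sum>z\<in>fiber (p ` A) x. w (z \<circ> p))"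
    using sum.reindex_bij_betw[OF bij, of w] by simp
  moreover have "w (z \<circ> p) = w z" if "z \<in> fiber (p ` A) x" for z
    using that inv fiber_in by blast
  ultimately show ?thesis
    unfolding cond_def by simp
qed

end

section \<open>Almost independent exchangeable coordinates\<close>

text \<open>The assumption \<open>spectral\<close> is link expansion in probabilistic form: given
  the coordinates in \<open>A\<close>, averaging a function of coordinate a conditionally on
  coordinate b is one step of the random walk in a link, and this contracts the centred part by
  \<gamma>. The assumption \<open>permute\<close> is exchangeability of the first k
  coordinates.\<close>

locale quasi_product = finite_prob \<Omega> w
  for \<Omega> :: "(nat \<Rightarrow> 'v) set" and w :: "(nat \<Rightarrow> 'v) \<Rightarrow> real" +
  fixes k :: nat and \<gamma> :: real
  assumes gamma_nonneg: "0 \<le> \<gamma>"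
    and spectral: "\<lbrakk>A \<subseteq> {..<k}; a < k; b < k; a \<notin> A; b \<notin> A; a \<noteq> b; depends_on (insert a A) h; x \<in> \<Omega>\<rbrakk>
      \<Longrightarrow> cond A (\<lambda>y. (cond (insert b A) h y - cond A h y)\<^sup>2) x \<le> \<gamma>\<^sup>2 * cond A (\<lambda>y. (h y)\<^sup>2) x"
    and permute: "\<lbrakk>p permutes {..<k}; x \<in> \<Omega>\<rbrakk> \<Longrightarrow> x \<circ> p \<in> \<Omega> \<and> w (x \<circ> p) = w x"
begin

section \<open>Approximate independence of several coordinates\<close>

lemma cond_insert_close:
  assumes "A \<subseteq> {..<k}" "a < k" "b < k" "a \<notin> A" "b \<notin> A" "a \<noteq> b"
    and "depends_on (insert a A) h" "x \<in> \<Omega>" "Q \<subseteq> A"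
  shows "cnorm Q x (\<lambda>y. cond (insert b A) h y - cond A h y) \<le> \<gamma> * cnorm Q x h"
proof -
  let ?g = "\<lambda>y. cond (insert b A) h y - cond A h y"
  have "cond Q (\<lambda>y. (?g y)\<^sup>2) x = cond Q (cond A (\<lambda>y. (?g y)\<^sup>2)) x"
    using assms by (simp add: cond_tower)
  also have "\<dots> \<le> cond Q (\<lambda>y. \<gamma>\<^sup>2 * cond A (\<lambda>y. (h y)\<^sup>2) y) x"
    using assms by (intro cond_mono spectral) (auto dest: fiber_in)
  also have "\<dots> = \<gamma>\<^sup>2 * cond Q (\<lambda>y. (h y)\<^sup>2) x"
    using assms by (simp add: cond_cmult cond_tower)
  finally have "cnorm Q x ?g \<le> sqrt (\<gamma>\<^sup>2 * cond Q (\<lambda>y. (h y)\<^sup>2) x)"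
    unfolding cnorm_def by (rule real_sqrt_le_mono)
  then show ?thesis using gamma_nonneg by (simp add: cnorm_def real_sqrt_mult)
qed

text \<open>The coordinates of \<open>D\<close> are revealed one at a time. At each stage h still
  involves only the one coordinate a beyond those already fixed, so the one-step bound applies and
  the errors add up.\<close>

lemma cond_union_close:
  assumes "finite D" "D \<inter> insert a C = {}" "insert a (C \<union> D) \<subseteq> {..<k}" "a \<notin> C"
    and "depends_on (insert a C) h" "x \<in> \<Omega>" "Q \<subseteq> C"
  shows "cnorm Q x (\<lambda>y. cond (C \<union> D) h y - cond C h y) \<le> real (card D) * \<gamma> * cnorm Q x h"
  using assms(1-3)
proof (induction D rule: finite_induct)
  case empty
  then show ?case by (simp add: cnorm_def cond_def)
next
  case (insert b D)
  have dep: "depends_on (insert a (C \<union> D)) h"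
    using assms(5) by (rule depends_on_mono) auto
  have "cnorm Q x (\<lambda>y. cond (C \<union> insert b D) h y - cond C h y)
      = cnorm Q x (\<lambda>y. (cond (insert b (C \<union> D)) h y - cond (C \<union> D) h y) + (cond (C \<union> D) h y - cond C h y))"
    by simp
  also have "\<dots> \<le> cnorm Q x (\<lambda>y. cond (insert b (C \<union> D)) h y - cond (C \<union> D) h y)
      + cnorm Q x (\<lambda>y. cond (C \<union> D) h y - cond C h y)"
    by (rule cnorm_add_le) fact
  also have "\<dots> \<le> \<gamma> * cnorm Q x h + real (card D) * \<gamma> * cnorm Q x h"
    using insert assms dep by (intro add_mono cond_insert_close[of _ a]) auto
  also have "\<dots> = real (card (insert b D)) * \<gamma> * cnorm Q x h"
    using insert by (simp add: algebra_simps)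
  finally show ?case .
qed

text \<open>In a product space the left-hand side would vanish.\<close>

lemma cond_inter_close_card:
  assumes "A \<subseteq> {..<k}" "B \<subseteq> {..<k}" "Q \<subseteq> A \<inter> B" "depends_on A h" "x \<in> \<Omega>"
  shows "cnorm Q x (\<lambda>y. cond B h y - cond (A \<inter> B) h y) \<le> real (card (A - B)) * (real k * \<gamma>) * cnorm Q x h"
  using assms
proof (induction "card (A - B)" arbitrary: A h)
  case 0
  then have "A \<subseteq> B" using finite_subset[OF \<open>A \<subseteq> {..<k}\<close>] by auto
  then have "A \<inter> B = A" by auto
  have "cnorm Q x (\<lambda>y. cond B h y - cond (A \<inter> B) h y) = cnorm Q x (\<lambda>y. 0)"
    using 0 \<open>A \<subseteq> B\<close> \<open>A \<inter> B = A\<close> by (intro cnorm_cong) (simp add: cond_id depends_on_mono[of A h B])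
  also have "\<dots> = 0" by (simp add: cnorm_def cond_def)
  finally show ?case using 0(1) by simp
next
  case (Suc n)
  from Suc.hyps(2) have "A - B \<noteq> {}" by (metis card.empty nat.distinct(1))
  then obtain a where a: "a \<in> A" "a \<notin> B" by auto
  \<comment> \<open>One coordinate a outside \<open>B\<close> is removed from \<open>A\<close>: h is
    replaced by its projection \<open>cond C h\<close>, to which the induction hypothesis
    applies.\<close>
  define C where "C = A - {a}"
  have A: "A = insert a C" and aC: "a \<notin> C" and CB: "C \<inter> B = A \<inter> B"
    using a by (auto simp: C_def)
  have fin: "finite A" "finite B" using Suc.prems finite_subset by blast+
  have "C - B = (A - B) - {a}" by (auto simp: C_def)
  then have card: "card (C - B) = n" using Suc.hyps(2) a fin by simp
  let ?h = "cond C h"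
  have IH: "cnorm Q x (\<lambda>y. cond B ?h y - cond (C \<inter> B) ?h y) \<le> real n * (real k * \<gamma>) * cnorm Q x ?h"
  proof -
    have "n = card (C - B)" "C \<subseteq> {..<k}" "Q \<subseteq> C \<inter> B"
      using card Suc.prems CB by (auto simp: C_def)
    then show ?thesis
      using Suc.hyps(1)[of C ?h] Suc.prems depends_on_cond[of C h] card by metis
  qed
  have h: "cnorm Q x ?h \<le> cnorm Q x h"
    using Suc.prems CB by (intro cnorm_cond_le) auto
  have BC: "C \<union> (B - C) = B \<union> C" by auto
  have cardk: "card (B - C) \<le> k"
    using card_mono[of "{..<k}" "B - C"] Suc.prems by auto
  have "cnorm Q x (\<lambda>y. cond (B \<union> C) h y - ?h y) \<le> real (card (B - C)) * \<gamma> * cnorm Q x h"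
  proof -
    have "(B - C) \<inter> A = {}" "A \<union> (B - C) \<subseteq> {..<k}" "Q \<subseteq> C"
      using Suc.prems CB a by (auto simp: C_def)
    then show ?thesis
      using cond_union_close[of "B - C" a C h x Q] Suc.prems fin aC A BC by simp
  qed
  also have "\<dots> \<le> real k * \<gamma> * cnorm Q x h"
    using cardk gamma_nonneg Suc.prems by (intro mult_right_mono) auto
  finally have step: "cnorm Q x (\<lambda>y. cond (B \<union> C) h y - ?h y) \<le> real k * \<gamma> * cnorm Q x h" .
  \<comment> \<open>The first summand is the projection to \<open>B\<close> of the error made by
    dropping a, bounded by \<open>step\<close>; the second is the induction hypothesis for the
    projected function.\<close>
  have "cnorm Q x (\<lambda>y. cond B h y - cond (A \<inter> B) h y)
      = cnorm Q x (\<lambda>y. cond B (\<lambda>z. cond (B \<union> C) h z - ?h z) y + (cond B ?h y - cond (C \<inter> B) ?h y))"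
  proof (rule cnorm_cong)
    fix y assume "y \<in> \<Omega>"
    then have "cond B (cond (B \<union> C) h) y = cond B h y" "cond (C \<inter> B) ?h y = cond (C \<inter> B) h y"
      by (auto intro: cond_tower)
    then show "cond B h y - cond (A \<inter> B) h y
      = cond B (\<lambda>z. cond (B \<union> C) h z - ?h z) y + (cond B ?h y - cond (C \<inter> B) ?h y)"
      by (simp add: cond_diff CB)
  qed
  also have "\<dots> \<le> cnorm Q x (cond B (\<lambda>z. cond (B \<union> C) h z - ?h z))
      + cnorm Q x (\<lambda>y. cond B ?h y - cond (C \<inter> B) ?h y)"
    by (rule cnorm_add_le) fact
  also have "\<dots> \<le> real k * \<gamma> * cnorm Q x h + real n * (real k * \<gamma>) * cnorm Q x h"
  proof (rule add_mono)
    show "cnorm Q x (cond B (\<lambda>z. cond (B \<union> C) h z - ?h z)) \<le> real k * \<gamma> * cnorm Q x h"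
      using step Suc.prems by (intro order_trans[OF cnorm_cond_le]) auto
    show "cnorm Q x (\<lambda>y. cond B ?h y - cond (C \<inter> B) ?h y) \<le> real n * (real k * \<gamma>) * cnorm Q x h"
      using IH h gamma_nonneg by (meson mult_left_mono mult_nonneg_nonneg of_nat_0_le_iff order_trans)
  qed
  also have "\<dots> = real (card (A - B)) * (real k * \<gamma>) * cnorm Q x h"
    unfolding Suc.hyps(2)[symmetric] by (simp add: algebra_simps)
  finally show ?case .
qed

text \<open>At most k coordinates of \<open>A\<close> lie outside \<open>B\<close>, and removing
  each of them costs at most k \<gamma>; this explains the square.\<close>

definition \<kappa> :: real where "\<kappa> = (real k)\<^sup>2 * \<gamma>"

lemma kappa_nonneg: "0 \<le> \<kappa>"
  using gamma_nonneg by (simp add: \<kappa>_def)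

lemma cond_inter_close:
  assumes "A \<subseteq> {..<k}" "B \<subseteq> {..<k}" "Q \<subseteq> A \<inter> B" "depends_on A h" "x \<in> \<Omega>"
  shows "cnorm Q x (\<lambda>y. cond B h y - cond (A \<inter> B) h y) \<le> \<kappa> * cnorm Q x h"
proof -
  have "card (A - B) \<le> k"
    using card_mono[of "{..<k}" "A - B"] assms by auto
  then have "real (card (A - B)) * (real k * \<gamma>) \<le> \<kappa>"
    using gamma_nonneg by (simp add: \<kappa>_def power2_eq_square mult_right_mono mult.assoc)
  then show ?thesis
    using cond_inter_close_card[OF assms] assms(5) by (meson cnorm_nonneg mult_right_mono order_trans)
qed

lemma cond_perm:
  assumes "p permutes {..<k}" "x \<in> \<Omega>"
  shows "cond A h (x \<circ> p) = cond (p ` A) (\<lambda>z. h (z \<circ> p)) x"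
proof (rule cond_permute)
  show "x \<circ> p \<in> \<Omega> \<and> w (x \<circ> p) = w x" if "x \<in> \<Omega>" for x using permute assms that by blast
  show "x \<circ> inv p \<in> \<Omega>" if "x \<in> \<Omega>" for x
    using permute permutes_inv[OF assms(1)] that by blast
  show "bij p" using assms permutes_bij by blast
qed fact

end

section \<open>Level functions\<close>

text \<open>The sets R and R with v added carry opposite signs and equal values, so they cancel in
  pairs.\<close>

lemma alternating_sum_Pow_eq_0:
  fixes c :: "'a set \<Rightarrow> real"
  assumes "finite S" "v \<in> S" "\<And>R. R \<subseteq> S - {v} \<Longrightarrow> c (insert v R) = c R"
  shows "(\<Sum>R\<in>Pow S. (-1) ^ card (S - R) * c R) = 0"
proof -
  define T where "T = S - {v}"
  have S: "S = insert v T" "v \<notin> T" "finite T" using assms by (auto simp: T_def)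
  have inj: "inj_on (insert v) (Pow T)"
    using S(2) by (auto simp: inj_on_def)
  have "(\<Sum>R\<in>Pow S. (-1) ^ card (S - R) * c R)
      = (\<Sum>R\<in>Pow T. (-1) ^ card (S - R) * c R) + (\<Sum>R\<in>insert v ` Pow T. (-1) ^ card (S - R) * c R)"
    unfolding S(1) Pow_insert using S by (intro sum.union_disjoint) auto
  also have "(\<Sum>R\<in>insert v ` Pow T. (-1) ^ card (S - R) * c R)
      = (\<Sum>R\<in>Pow T. (-1) ^ card (S - insert v R) * c (insert v R))"
    using inj by (simp add: sum.reindex)
  also have "\<dots> = (\<Sum>R\<in>Pow T. - ((-1) ^ card (S - R) * c R))"
  proof (intro sum.cong refl)
    fix R assume R: "R \<in> Pow T"
    have "S - R = insert v (S - insert v R)" using R S by auto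
    then have "card (S - R) = Suc (card (S - insert v R))" using S by simp
    moreover have "c (insert v R) = c R" using R assms(3) by (auto simp: T_def)
    ultimately show "(-1) ^ card (S - insert v R) * c (insert v R) = - ((-1) ^ card (S - R) * c R)"
      by simp
  qed
  finally show ?thesis by (simp add: sum_negf)
qed

text \<open>Glue a bijection from \<open>S\<close> to \<open>S'\<close>, one between their
  complements in U - Q, and the identity elsewhere. This supplies the symmetries that fix the
  conditioned positions.\<close>

lemma ex_permutes_image_eq:
  assumes "finite U" "Q \<subseteq> U" "S \<subseteq> U - Q" "S' \<subseteq> U - Q" "card S = card S'"
  obtains p where "p permutes U" "\<And>a. a \<in> Q \<Longrightarrow> p a = a" "p ` S = S'"
proof -
  define V where "V = U - Q"
  have fin: "finite V" "finite S" "finite S'"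
    using assms finite_subset[of _ "U - Q"] by (auto simp: V_def)
  obtain f where f: "bij_betw f S S'"
    using finite_same_card_bij[OF fin(2,3) assms(5)] by blast
  have "card (V - S) = card (V - S')"
    using fin assms by (simp add: card_Diff_subset V_def)
  then obtain g where g: "bij_betw g (V - S) (V - S')"
    using finite_same_card_bij[of "V - S" "V - S'"] fin by blast
  define p where "p a = (if a \<in> S then f a else if a \<in> V then g a else a)" for a
  have "bij_betw p S S'" using f by (rule bij_betw_cong[THEN iffD1, rotated]) (simp add: p_def)
  moreover have "bij_betw p (V - S) (V - S')"
    using g by (rule bij_betw_cong[THEN iffD1, rotated]) (simp add: p_def)
  ultimately have "bij_betw p (S \<union> (V - S)) (S' \<union> (V - S'))"
    by (rule bij_betw_combine) auto
  moreover have "S \<union> (V - S) = V" "S' \<union> (V - S') = V" using assms by (auto simp: V_def)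
  ultimately have pV: "bij_betw p V V" by simp
  have "p permutes V"
    using pV by (rule bij_imp_permutes) (use assms(3) in \<open>auto simp: p_def V_def\<close>)
  then have "p permutes U" by (rule permutes_subset) (auto simp: V_def)
  moreover have "p a = a" if "a \<in> Q" for a using that assms by (auto simp: p_def V_def)
  moreover have "p ` S = S'" using \<open>bij_betw p S S'\<close> by (simp add: bij_betw_def)
  ultimately show ?thesis by (rule that)
qed

text \<open>The bound \<open>kappa_small\<close> is exactly what absorbs the accumulated error in
  the approximate Parseval inequality \<open>sum_cond_level_sq_le\<close>.\<close>

locale boolean_function = quasi_product \<Omega> w k \<gamma>
  for \<Omega> :: "(nat \<Rightarrow> 'v) set" and w k \<gamma> +
  fixes \<phi> :: "(nat \<Rightarrow> 'v) \<Rightarrow> real"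
  assumes phi_depends: "depends_on {..<k} \<phi>"
    and phi_boolean: "x \<in> \<Omega> \<Longrightarrow> \<phi> x \<in> {0, 1}"
    and phi_permute: "\<lbrakk>p permutes {..<k}; x \<in> \<Omega>\<rbrakk> \<Longrightarrow> \<phi> (x \<circ> p) = \<phi> x"
    and kappa_small: "16 ^ k * \<kappa> \<le> 1"
begin

text \<open>This is the \<open>S\<close>-component of \<phi> in its Moebius (Efron-Stein)
  decomposition once the coordinates in \<open>Q\<close> are held fixed. For \<open>Q\<close> = {}
  it is the component g_T of the overview; general \<open>Q\<close> is needed to control these
  components conditionally.\<close>

definition level :: "nat set \<Rightarrow> nat set \<Rightarrow> (nat \<Rightarrow> 'v) \<Rightarrow> real" where
  "level Q S x = (\<Sum>R\<in>Pow S. (-1) ^ card (S - R) * cond (Q \<union> R) \<phi> x)"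

lemma cond_phi_sq: "cond Q (\<lambda>y. (\<phi> y)\<^sup>2) x = cond Q \<phi> x"
proof (rule cond_cong)
  show "(\<phi> y)\<^sup>2 = \<phi> y" if "y \<in> fiber Q x" for y
    using phi_boolean[OF fiber_in[OF that]] by auto
qed

lemma cnorm_phi_sq: "x \<in> \<Omega> \<Longrightarrow> (cnorm Q x \<phi>)\<^sup>2 = cond Q \<phi> x"
  by (simp add: cnorm_sq cond_phi_sq)

lemma phi_nonneg: "x \<in> \<Omega> \<Longrightarrow> 0 \<le> \<phi> x" and phi_le_1: "x \<in> \<Omega> \<Longrightarrow> \<phi> x \<le> 1"
  using phi_boolean[of x] by auto

lemma cond_phi_nonneg: "x \<in> \<Omega> \<Longrightarrow> 0 \<le> cond Q \<phi> x"
  by (intro cond_nonneg phi_nonneg)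

lemma cond_phi_le_1: "x \<in> \<Omega> \<Longrightarrow> cond Q \<phi> x \<le> 1"
  by (intro cond_le phi_le_1)

lemma depends_on_level: "depends_on (Q \<union> S) (level Q S)"
  unfolding level_def
  by (intro depends_on_sum depends_on_cmult depends_on_mono[OF depends_on_cond]) auto

lemma level_permute:
  assumes p: "p permutes {..<k}" and x: "x \<in> \<Omega>"
  shows "level Q S (x \<circ> p) = level (p ` Q) (p ` S) x"
proof -
  have inj: "inj p" using p permutes_inj by blast
  have bij: "bij_betw ((`) p) (Pow S) (Pow (p ` S))"
    using inj by (intro bij_betw_Pow inj_on_imp_bij_betw) (rule inj_on_subset, auto)
  have "level Q S (x \<circ> p) = (\<Sum>R\<in>Pow S. (-1) ^ card (p ` S - p ` R) * cond (p ` Q \<union> p ` R) \<phi> x)"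
    unfolding level_def
  proof (intro sum.cong refl)
    fix R assume "R \<in> Pow S"
    have "card (p ` S - p ` R) = card (S - R)"
      using inj by (simp add: image_set_diff[symmetric] card_image inj_on_subset)
    moreover have "cond (Q \<union> R) \<phi> (x \<circ> p) = cond (p ` Q \<union> p ` R) \<phi> x"
      unfolding cond_perm[OF assms] image_Un
      by (rule cond_cong) (use phi_permute[OF p] fiber_in in blast)
    ultimately show "(-1) ^ card (S - R) * cond (Q \<union> R) \<phi> (x \<circ> p)
        = (-1) ^ card (p ` S - p ` R) * cond (p ` Q \<union> p ` R) \<phi> x" by simp
  qed
  also have "\<dots> = level (p ` Q) (p ` S) x"
    unfolding level_def
    using sum.reindex_bij_betw[OF bij, of "\<lambda>R. (-1) ^ card (p ` S - R) * cond (p ` Q \<union> R) \<phi> x"] by simp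
  finally show ?thesis .
qed

lemma abs_level_le:
  assumes "finite S" "\<And>R. R \<subseteq> S \<Longrightarrow> cond (Q \<union> R) \<phi> x \<le> c" "x \<in> \<Omega>"
  shows "\<bar>level Q S x\<bar> \<le> 2 ^ card S * c"
proof -
  have "\<bar>level Q S x\<bar> \<le> (\<Sum>R\<in>Pow S. \<bar>(-1) ^ card (S - R) * cond (Q \<union> R) \<phi> x\<bar>)"
    unfolding level_def by (rule sum_abs)
  also have "\<dots> \<le> (\<Sum>R\<in>Pow S. c)"
    using assms cond_phi_nonneg by (intro sum_mono) (auto simp: abs_mult power_abs)
  also have "\<dots> = 2 ^ card S * c" using assms by (simp add: card_Pow)
  finally show ?thesis .
qed

lemma abs_level_le_pow: "\<lbrakk>finite S; x \<in> \<Omega>\<rbrakk> \<Longrightarrow> \<bar>level Q S x\<bar> \<le> 2 ^ card S"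
  using abs_level_le[of S Q x 1] cond_phi_le_1 by simp

lemma cnorm_level_le:
  assumes "finite S" "Q0 \<subseteq> Q" "x \<in> \<Omega>"
  shows "cnorm Q0 x (level Q S) \<le> 2 ^ card S * cnorm Q0 x \<phi>"
proof -
  have "cnorm Q0 x (level Q S) \<le> (\<Sum>R\<in>Pow S. cnorm Q0 x (\<lambda>y. (-1) ^ card (S - R) * cond (Q \<union> R) \<phi> y))"
    unfolding level_def using assms(3) by (rule cnorm_sum_le)
  also have "\<dots> \<le> (\<Sum>R\<in>Pow S. cnorm Q0 x \<phi>)"
    using assms by (intro sum_mono) (auto simp: cnorm_cmult power_abs intro!: cnorm_cond_le)
  finally show ?thesis using assms by (simp add: card_Pow)
qed

section \<open>Almost orthogonality and an approximate Parseval inequality\<close>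

text \<open>With exact independence the projection to \<open>B\<close> would turn each summand into
  an average given B \<inter> (Q \<union> R). Since v is not in \<open>B\<close>, this does not
  notice whether v is in R, so the alternating sum vanishes. Each of the 2^|S| replacements costs
  \<kappa>.\<close>

lemma cnorm_cond_level_le:
  assumes "S \<subseteq> {..<k}" "B \<subseteq> {..<k}" "Q \<subseteq> B" "v \<in> S" "v \<notin> B" "x \<in> \<Omega>"
  shows "cnorm Q x (cond B (level Q S)) \<le> 2 ^ card S * \<kappa> * cnorm Q x \<phi>"
proof -
  have fin: "finite S" using assms finite_subset by blast
  let ?c = "\<lambda>R y. cond (B \<inter> (Q \<union> R)) \<phi> y"
  have eq: "cond B (level Q S) y
      = (\<Sum>R\<in>Pow S. (-1) ^ card (S - R) * (cond B (cond (Q \<union> R) \<phi>) y - ?c R y))" if "y \<in> \<Omega>" for y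
  proof -
    have "(\<Sum>R\<in>Pow S. (-1) ^ card (S - R) * ?c R y) = 0"
      using fin assms(4,5) by (intro alternating_sum_Pow_eq_0[of S v]) (auto intro!: arg_cong[of _ _ "\<lambda>A. cond A \<phi> y"])
    moreover have "cond B (level Q S) y = (\<Sum>R\<in>Pow S. (-1) ^ card (S - R) * cond B (cond (Q \<union> R) \<phi>) y)"
      unfolding level_def by (simp add: cond_sum cond_cmult)
    ultimately show ?thesis by (simp add: right_diff_distrib sum_subtractf)
  qed
  have "cnorm Q x (cond B (level Q S))
      = cnorm Q x (\<lambda>y. \<Sum>R\<in>Pow S. (-1) ^ card (S - R) * (cond B (cond (Q \<union> R) \<phi>) y - ?c R y))"
    using eq by (rule cnorm_cong)
  also have "\<dots> \<le> (\<Sum>R\<in>Pow S. cnorm Q x (\<lambda>y. (-1) ^ card (S - R) * (cond B (cond (Q \<union> R) \<phi>) y - ?c R y)))"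
    using assms by (intro cnorm_sum_le)
  also have "\<dots> \<le> (\<Sum>R\<in>Pow S. \<kappa> * cnorm Q x \<phi>)"
  proof (rule sum_mono)
    fix R assume "R \<in> Pow S"
    let ?h = "cond (Q \<union> R) \<phi>"
    have "cnorm Q x (\<lambda>y. (-1) ^ card (S - R) * (cond B ?h y - ?c R y))
        = cnorm Q x (\<lambda>y. cond B ?h y - cond ((Q \<union> R) \<inter> B) ?h y)"
      unfolding cnorm_cmult power_abs
      by (auto simp: Int_commute[of "Q \<union> R" B] intro!: cnorm_cong) (simp add: cond_tower)
    also have "\<dots> \<le> \<kappa> * cnorm Q x ?h"
      using assms \<open>R \<in> Pow S\<close> by (intro cond_inter_close depends_on_cond) auto
    also have "\<dots> \<le> \<kappa> * cnorm Q x \<phi>"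
      using assms kappa_nonneg by (intro mult_left_mono cnorm_cond_le) auto
    finally show "cnorm Q x (\<lambda>y. (-1) ^ card (S - R) * (cond B ?h y - ?c R y)) \<le> \<kappa> * cnorm Q x \<phi>" .
  qed
  finally show ?thesis using fin by (simp add: card_Pow)
qed

text \<open>Project the component of \<open>S\<close> to the coordinates Q \<union> S' of the other
  factor: v is missing there, so almost nothing is left.\<close>

lemma level_almost_orthogonal:
  assumes "Q \<subseteq> {..<k}" "S \<subseteq> {..<k} - Q" "S' \<subseteq> {..<k} - Q" "v \<in> S" "v \<notin> S'" "x \<in> \<Omega>"
  shows "\<bar>cond Q (\<lambda>y. level Q S y * level Q S' y) x\<bar> \<le> 4 ^ k * \<kappa> * cond Q \<phi> x"
proof -
  have fin: "finite S" "finite S'" using assms finite_subset by blast+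
  have card: "card S \<le> k" "card S' \<le> k"
    using card_mono[of "{..<k}" S] card_mono[of "{..<k}" S'] assms by auto
  have "cond Q (\<lambda>y. level Q S y * level Q S' y) x = cond Q (\<lambda>y. level Q S' y * level Q S y) x"
    by (simp add: mult.commute)
  also have "\<dots> = cond Q (\<lambda>y. level Q S' y * cond (Q \<union> S') (level Q S) y) x"
    using assms by (intro cond_mult_cond depends_on_level) auto
  also have "\<bar>\<dots>\<bar> \<le> cnorm Q x (level Q S') * cnorm Q x (cond (Q \<union> S') (level Q S))"
    using assms by (intro cond_Cauchy_Schwarz)
  also have "\<dots> \<le> (2 ^ card S' * cnorm Q x \<phi>) * (2 ^ card S * \<kappa> * cnorm Q x \<phi>)"
    using assms fin by (intro mult_mono cnorm_level_le cnorm_cond_level_le[of _ _ _ v]) auto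
  also have "\<dots> = 2 ^ (card S' + card S) * (\<kappa> * cond Q \<phi> x)"
    using assms by (simp add: cnorm_phi_sq[symmetric] power2_eq_square power_add)
  also have "\<dots> \<le> 2 ^ (2 * k) * (\<kappa> * cond Q \<phi> x)"
    using card kappa_nonneg cond_phi_nonneg assms by (intro mult_right_mono power_increasing) auto
  finally show ?thesis by (simp add: power_mult mult.assoc)
qed

text \<open>Moebius inversion on the subset lattice. The extra signs (-1)^|T| only bring it into the
  symmetric form of inclusion-exclusion.\<close>

lemma cond_eq_sum_level:
  assumes "finite S"
  shows "cond (Q \<union> S) \<phi> x = (\<Sum>T\<in>Pow S. level Q T x)"
proof -
  have "cond (Q \<union> S) \<phi> x = (\<Sum>T\<in>Pow S. (-1) ^ card T * ((-1) ^ card T * level Q T x))"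
  proof (rule inclusion_exclusion_symmetric[OF _ assms])
    fix S :: "nat set" assume S: "finite S"
    have "(-1) ^ card S * (-1) ^ card (S - R) = ((-1) ^ card R :: real)" if "R \<in> Pow S" for R
    proof -
      have "card S = card R + card (S - R)"
        using that S by (metis PowD card_Diff_subset card_mono finite_subset le_add_diff_inverse)
      then have "(-1) ^ card S * (-1) ^ card (S - R) = ((-1) ^ card R * ((-1) ^ card (S - R) * (-1) ^ card (S - R)) :: real)"
        by (simp add: power_add)
      then show ?thesis by (simp add: power_mult_distrib[symmetric])
    qed
    then show "(-1) ^ card S * level Q S x = (\<Sum>T\<in>Pow S. (-1) ^ card T * cond (Q \<union> T) \<phi> x)"
      unfolding level_def sum_distrib_left by (simp add: mult.assoc[symmetric])
  qed
  then show ?thesis by (simp add: mult.assoc[symmetric] power_mult_distrib[symmetric])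
qed

lemma sum_level:
  assumes "Q \<subseteq> {..<k}" "x \<in> \<Omega>"
  shows "(\<Sum>S\<in>Pow ({..<k} - Q). level Q S x) = \<phi> x"
  using cond_eq_sum_level[of "{..<k} - Q" Q x] phi_depends assms by (simp add: cond_id Un_absorb1)

text \<open>Expand \<phi> into its components. Only the diagonal term survives; there are at most
  2^k off-diagonal ones, each at most 4^k \<kappa> times the density, whence 8^k.\<close>

lemma cond_phi_level_close:
  assumes "Q \<subseteq> {..<k}" "S \<subseteq> {..<k} - Q" "x \<in> \<Omega>"
  shows "\<bar>cond Q (\<lambda>y. \<phi> y * level Q S y) x - cond Q (\<lambda>y. (level Q S y)\<^sup>2) x\<bar> \<le> 8 ^ k * \<kappa> * cond Q \<phi> x"
proof -
  let ?P = "Pow ({..<k} - Q)"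
  let ?c = "\<lambda>S'. cond Q (\<lambda>y. level Q S' y * level Q S y) x"
  have "cond Q (\<lambda>y. \<phi> y * level Q S y) x = cond Q (\<lambda>y. \<Sum>S'\<in>?P. level Q S' y * level Q S y) x"
    using sum_level assms by (intro cond_cong) (simp add: sum_distrib_right[symmetric] fiber_in)
  also have "\<dots> = (\<Sum>S'\<in>?P. ?c S')"
    by (rule cond_sum)
  also have "\<dots> = ?c S + (\<Sum>S'\<in>?P - {S}. ?c S')"
    using assms by (intro sum.remove) auto
  finally have "cond Q (\<lambda>y. \<phi> y * level Q S y) x - cond Q (\<lambda>y. (level Q S y)\<^sup>2) x
      = (\<Sum>S'\<in>?P - {S}. ?c S')"
    by (simp add: power2_eq_square)
  also have "\<bar>\<dots>\<bar> \<le> (\<Sum>S'\<in>?P - {S}. \<bar>?c S'\<bar>)"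
    by (rule sum_abs)
  also have "\<dots> \<le> (\<Sum>S'\<in>?P - {S}. 4 ^ k * \<kappa> * cond Q \<phi> x)"
  proof (rule sum_mono)
    fix S' assume S': "S' \<in> ?P - {S}"
    then consider v where "v \<in> S'" "v \<notin> S" | v where "v \<in> S" "v \<notin> S'" by blast
    then show "\<bar>?c S'\<bar> \<le> 4 ^ k * \<kappa> * cond Q \<phi> x"
    proof cases
      case 1
      then show ?thesis using level_almost_orthogonal[of Q S' S] assms S' by auto
    next
      case 2
      then show ?thesis using level_almost_orthogonal[of Q S S'] assms S' by (auto simp: mult.commute)
    qed
  qed
  also have "\<dots> \<le> 2 ^ k * (4 ^ k * \<kappa> * cond Q \<phi> x)"
  proof -
    have "card (?P - {S}) \<le> card (Pow {..<k})" by (intro card_mono) auto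
    also have "\<dots> = 2 ^ k" by (simp add: card_Pow)
    finally have "real (card (?P - {S})) \<le> 2 ^ k" by (metis of_nat_le_iff of_nat_numeral of_nat_power)
    then show ?thesis using kappa_nonneg cond_phi_nonneg assms by (simp add: mult_right_mono)
  qed
  also have "\<dots> = 8 ^ k * \<kappa> * cond Q \<phi> x"
    by (simp add: power_mult_distrib[symmetric])
  finally show ?thesis .
qed

text \<open>Summing the previous estimate over all \<open>S\<close> rebuilds \<phi> * \<phi> =
  \<phi>. The total error is 2^k * 8^k \<kappa> times the density and is at most one more copy of
  it, hence the factor 2.\<close>

lemma sum_cond_level_sq_le:
  assumes "Q \<subseteq> {..<k}" "x \<in> \<Omega>"
  shows "(\<Sum>S\<in>Pow ({..<k} - Q). cond Q (\<lambda>y. (level Q S y)\<^sup>2) x) \<le> 2 * cond Q \<phi> x"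
proof -
  let ?P = "Pow ({..<k} - Q)"
  have card: "real (card ?P) \<le> 2 ^ k"
  proof -
    have "card ?P \<le> card (Pow {..<k})" by (intro card_mono) auto
    also have "\<dots> = 2 ^ k" by (simp add: card_Pow)
    finally show ?thesis by (metis of_nat_le_iff of_nat_numeral of_nat_power)
  qed
  have "(\<Sum>S\<in>?P. cond Q (\<lambda>y. (level Q S y)\<^sup>2) x)
      \<le> (\<Sum>S\<in>?P. cond Q (\<lambda>y. \<phi> y * level Q S y) x + 8 ^ k * \<kappa> * cond Q \<phi> x)"
  proof (rule sum_mono)
    fix S assume "S \<in> ?P"
    then show "cond Q (\<lambda>y. (level Q S y)\<^sup>2) x
        \<le> cond Q (\<lambda>y. \<phi> y * level Q S y) x + 8 ^ k * \<kappa> * cond Q \<phi> x"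
      using cond_phi_level_close[of Q S x] assms unfolding abs_le_iff by simp
  qed
  also have "\<dots> = cond Q (\<lambda>y. \<Sum>S\<in>?P. \<phi> y * level Q S y) x + card ?P * (8 ^ k * \<kappa> * cond Q \<phi> x)"
    by (simp add: sum.distrib cond_sum)
  also have "cond Q (\<lambda>y. \<Sum>S\<in>?P. \<phi> y * level Q S y) x = cond Q (\<lambda>y. (\<phi> y)\<^sup>2) x"
    using sum_level assms
    by (intro cond_cong) (simp add: sum_distrib_left[symmetric] fiber_in power2_eq_square)
  also have "\<dots> = cond Q \<phi> x" by (rule cond_phi_sq)
  also have "card ?P * (8 ^ k * \<kappa> * cond Q \<phi> x) \<le> 2 ^ k * (8 ^ k * \<kappa> * cond Q \<phi> x)"
    using card kappa_nonneg cond_phi_nonneg assms by (intro mult_right_mono) auto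
  also have "\<dots> = (16 ^ k * \<kappa>) * cond Q \<phi> x"
    by (simp add: power_mult_distrib[symmetric])
  also have "\<dots> \<le> 1 * cond Q \<phi> x"
    using kappa_small cond_phi_nonneg assms by (intro mult_right_mono) auto
  finally show ?thesis by simp
qed

lemma cond_level_sq_eq:
  assumes "Q \<subseteq> {..<k}" "S \<subseteq> {..<k} - Q" "S' \<subseteq> {..<k} - Q" "card S = card S'" "x \<in> \<Omega>"
  shows "cond Q (\<lambda>y. (level Q S y)\<^sup>2) x = cond Q (\<lambda>y. (level Q S' y)\<^sup>2) x"
proof -
  obtain p where p: "p permutes {..<k}" "\<And>a. a \<in> Q \<Longrightarrow> p a = a" "p ` S = S'"
    using ex_permutes_image_eq[of "{..<k}" Q S S'] assms by blast
  have Q: "p ` Q = Q" using p(2) by force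
  have "x \<circ> p \<in> fiber Q x"
    using permute[OF p(1) assms(5)] p(2) by (simp add: fiber_def)
  then have "cond Q (\<lambda>y. (level Q S y)\<^sup>2) x = cond Q (\<lambda>y. (level Q S y)\<^sup>2) (x \<circ> p)"
    by (simp add: cond_def fiber_eq)
  also have "\<dots> = cond Q (\<lambda>y. (level Q S (y \<circ> p))\<^sup>2) x"
    using cond_perm[OF p(1) assms(5), of Q] by (simp add: Q)
  also have "\<dots> = cond Q (\<lambda>y. (level Q S' y)\<^sup>2) x"
    using level_permute[OF p(1)] by (intro cond_cong) (simp add: fiber_in Q p(3))
  finally show ?thesis .
qed

text \<open>By exchangeability all sets of the size of \<open>S\<close> have the same conditional
  mass, so each gets an equal share of the Parseval bound. The binomial coefficient is the source of
  all later powers of i/k.\<close>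

lemma cond_level_sq_le:
  assumes "Q \<subseteq> {..<k}" "S \<subseteq> {..<k} - Q" "x \<in> \<Omega>"
  shows "real ((k - card Q) choose card S) * cond Q (\<lambda>y. (level Q S y)\<^sup>2) x \<le> 2 * cond Q \<phi> x"
proof -
  let ?N = "{S'. S' \<subseteq> {..<k} - Q \<and> card S' = card S}"
  have "card ?N = (k - card Q) choose card S"
    using n_subsets[of "{..<k} - Q" "card S"] assms(1)
    by (simp add: card_Diff_subset finite_subset)
  then have "real ((k - card Q) choose card S) * cond Q (\<lambda>y. (level Q S y)\<^sup>2) x
      = (\<Sum>S'\<in>?N. cond Q (\<lambda>y. (level Q S y)\<^sup>2) x)" by simp
  also have "\<dots> = (\<Sum>S'\<in>?N. cond Q (\<lambda>y. (level Q S' y)\<^sup>2) x)"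
    using assms by (intro sum.cong refl cond_level_sq_eq) auto
  also have "\<dots> \<le> (\<Sum>S'\<in>Pow ({..<k} - Q). cond Q (\<lambda>y. (level Q S' y)\<^sup>2) x)"
    using assms by (intro sum_mono2) (auto intro!: cond_nonneg)
  also have "\<dots> \<le> 2 * cond Q \<phi> x"
    using assms by (intro sum_cond_level_sq_le)
  finally show ?thesis .
qed

end

section \<open>The fourth moment of a level function\<close>

lemma sum_power_card_Pow:
  fixes x :: real
  assumes "finite V"
  shows "(\<Sum>U\<in>Pow V. x ^ card U) = (1 + x) ^ card V"
  using assms
proof (induction V rule: finite_induct)
  case (insert v V)
  have inj: "inj_on (insert v) (Pow V)" using insert.hyps by (auto simp: inj_on_def)
  have "(\<Sum>U\<in>Pow (insert v V). x ^ card U) = (\<Sum>U\<in>Pow V. x ^ card U) + (\<Sum>U\<in>insert v ` Pow V. x ^ card U)"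
    unfolding Pow_insert using insert.hyps by (intro sum.union_disjoint) auto
  also have "(\<Sum>U\<in>insert v ` Pow V. x ^ card U) = (\<Sum>U\<in>Pow V. x * x ^ card U)"
  proof -
    have "card (insert v U) = Suc (card U)" if "U \<subseteq> V" for U
      using that insert.hyps by (intro card_insert_disjoint) (auto dest: finite_subset)
    then show ?thesis using inj by (simp add: sum.reindex)
  qed
  finally show ?case using insert by (simp add: sum_distrib_left[symmetric] algebra_simps)
qed simp

lemma card_eq_sum_of_bool:
  assumes "finite U" "A \<subseteq> U"
  shows "card A = (\<Sum>a\<in>U. of_bool (a \<in> A))"
  using assms by (simp add: Int_absorb1 sum_of_bool_eq Collect_mem_eq Int_def[symmetric])

text \<open>Count point by point. A point in exactly two of the sets contributes 2 to each side; a
  point in three lies in exactly one of the two triple-type intersections; a point in all four lies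
  in both.\<close>

lemma doubly_covered_card_le:
  assumes fin: "finite T1" "finite T2" "finite T3" "finite T4"
    and cover: "T1 \<subseteq> T2 \<union> T3 \<union> T4" "T2 \<subseteq> T1 \<union> T3 \<union> T4" "T3 \<subseteq> T1 \<union> T2 \<union> T4" "T4 \<subseteq> T1 \<union> T2 \<union> T3"
  shows "2 * card (T1 \<union> T2 \<union> T3 \<union> T4) + card (T1 \<inter> T2 \<inter> (T3 \<union> T4)) + card (T3 \<inter> T4 \<inter> (T1 \<union> T2))
    \<le> card T1 + card T2 + card T3 + card T4"
proof -
  let ?U = "T1 \<union> T2 \<union> T3 \<union> T4"
  have c: "card A = (\<Sum>a\<in>?U. of_bool (a \<in> A))" if "A \<subseteq> ?U" for A
    using fin that by (intro card_eq_sum_of_bool) auto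
  have "(\<Sum>a\<in>?U. 2 * of_bool (a \<in> ?U) + of_bool (a \<in> T1 \<inter> T2 \<inter> (T3 \<union> T4)) + of_bool (a \<in> T3 \<inter> T4 \<inter> (T1 \<union> T2)))
      \<le> (\<Sum>a\<in>?U. of_bool (a \<in> T1) + of_bool (a \<in> T2) + of_bool (a \<in> T3) + (of_bool (a \<in> T4) :: nat))"
    using cover by (intro sum_mono) (auto simp: of_bool_def)
  moreover have "card ?U = (\<Sum>a\<in>?U. of_bool (a \<in> ?U))" by (rule c) simp
  moreover have "card (T1 \<inter> T2 \<inter> (T3 \<union> T4)) = (\<Sum>a\<in>?U. of_bool (a \<in> T1 \<inter> T2 \<inter> (T3 \<union> T4)))" by (rule c) auto
  moreover have "card (T3 \<inter> T4 \<inter> (T1 \<union> T2)) = (\<Sum>a\<in>?U. of_bool (a \<in> T3 \<inter> T4 \<inter> (T1 \<union> T2)))" by (rule c) auto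
  moreover have "card T1 = (\<Sum>a\<in>?U. of_bool (a \<in> T1))" by (rule c) auto
  moreover have "card T2 = (\<Sum>a\<in>?U. of_bool (a \<in> T2))" by (rule c) auto
  moreover have "card T3 = (\<Sum>a\<in>?U. of_bool (a \<in> T3))" by (rule c) auto
  moreover have "card T4 = (\<Sum>a\<in>?U. of_bool (a \<in> T4))" by (rule c) auto
  ultimately show ?thesis
    unfolding sum.distrib sum_distrib_left[symmetric] by linarith
qed

text \<open>Group the quadruples by their union U; at most (2^|U|)^4 of them have a given union.
  With r = i/k on k positions the bound becomes exp(16 i), free of k.\<close>

lemma sum_quadruples_power_card_Union_le:
  fixes r :: real
  assumes "finite V" "N \<subseteq> Pow V" "0 \<le> r"
  shows "(\<Sum>(T1, T2, T3, T4)\<in>N \<times> N \<times> N \<times> N. r ^ card (T1 \<union> T2 \<union> T3 \<union> T4)) \<le> exp (16 * r * card V)"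
proof -
  let ?u = "\<lambda>(T1, T2, T3, T4). T1 \<union> T2 \<union> T3 \<union> T4"
  let ?N = "N \<times> N \<times> N \<times> N"
  have finN: "finite N" using assms finite_subset by blast
  have "(\<Sum>(T1, T2, T3, T4)\<in>?N. r ^ card (T1 \<union> T2 \<union> T3 \<union> T4)) = (\<Sum>q\<in>?N. r ^ card (?u q))"
    by (intro sum.cong) auto
  also have "\<dots> = (\<Sum>U\<in>Pow V. \<Sum>q\<in>{q \<in> ?N. ?u q = U}. r ^ card (?u q))"
    using assms finN by (intro sum.group[symmetric]) auto
  also have "\<dots> \<le> (\<Sum>U\<in>Pow V. (16 * r) ^ card U)"
  proof (rule sum_mono)
    fix U assume "U \<in> Pow V"
    then have U: "finite U" using assms(1) by (simp add: finite_subset)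
    let ?Q = "{q \<in> ?N. ?u q = U}"
    have "?Q \<subseteq> Pow U \<times> Pow U \<times> Pow U \<times> Pow U" by auto
    then have "card ?Q \<le> card (Pow U \<times> Pow U \<times> Pow U \<times> Pow U)"
      using U by (intro card_mono) auto
    also have "\<dots> = 16 ^ card U"
      using U by (simp add: card_cartesian_product card_Pow power_mult_distrib[symmetric])
    finally have "real (card ?Q) \<le> 16 ^ card U" by (simp only: numeral_power_le_of_nat_cancel_iff of_nat_le_numeral_power_cancel_iff)
    then have "real (card ?Q) * r ^ card U \<le> 16 ^ card U * r ^ card U"
      using assms by (intro mult_right_mono) auto
    moreover have "(\<Sum>q\<in>?Q. r ^ card (?u q)) = (\<Sum>q\<in>?Q. r ^ card U)"
      by (rule sum.cong) (simp_all only: mem_Collect_eq)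
    ultimately show "(\<Sum>q\<in>?Q. r ^ card (?u q)) \<le> (16 * r) ^ card U"
      by (simp only: sum_constant power_mult_distrib)
  qed
  also have "\<dots> = (1 + 16 * r) ^ card V" using assms(1) by (rule sum_power_card_Pow)
  also have "\<dots> \<le> exp (16 * r) ^ card V"
    using assms by (intro power_mono exp_ge_add_one_self) auto
  also have "\<dots> = exp (16 * r * card V)" by (simp add: exp_of_nat_mult[symmetric] mult.commute)
  finally show ?thesis .
qed

locale global_function = boolean_function \<Omega> w k \<gamma> \<phi>
  for \<Omega> :: "(nat \<Rightarrow> 'v) set" and w k \<gamma> \<phi> +
  fixes i :: nat and \<epsilon> :: real
  assumes i_le: "i \<le> k"
    and eps_nonneg: "0 \<le> \<epsilon>" and eps_le_1: "\<epsilon> \<le> 1"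
    and global: "\<lbrakk>A \<subseteq> {..<k}; card A = i; x \<in> \<Omega>\<rbrakk> \<Longrightarrow> cond A \<phi> x \<le> \<epsilon>"
begin

abbreviation g :: "nat set \<Rightarrow> (nat \<Rightarrow> 'v) \<Rightarrow> real" where "g \<equiv> level {}"

definition index_sets :: "nat set set" where
  "index_sets = {T. T \<subseteq> {..<k} \<and> card T = i}"

text \<open>The level function f_i read on orderings. The identification with
  \<open>bottom_up_level\<close> is made in \<open>inner_bottom_up_level_le\<close>.\<close>

definition F :: "(nat \<Rightarrow> 'v) \<Rightarrow> real" where
  "F y = (\<Sum>T\<in>index_sets. g T y)"

lemma card_index_sets: "card index_sets = k choose i"
  unfolding index_sets_def using n_subsets[of "{..<k}" i] by simp

lemma index_setsD: "T \<in> index_sets \<Longrightarrow> T \<subseteq> {..<k}" "T \<in> index_sets \<Longrightarrow> card T = i"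
  "T \<in> index_sets \<Longrightarrow> finite T"
  unfolding index_sets_def using finite_subset by auto

section \<open>Bounds on single components\<close>

lemma cond_phi_le_eps:
  assumes "Q \<subseteq> {..<k}" "card Q \<le> i" "x \<in> \<Omega>"
  shows "cond Q \<phi> x \<le> \<epsilon>"
proof -
  obtain A where A: "Q \<subseteq> A" "A \<subseteq> {..<k}" "card A = i"
    using exists_subset_between[of Q i "{..<k}"] assms i_le by auto
  have "cond Q \<phi> x = cond Q (cond A \<phi>) x" using A assms by (simp add: cond_tower)
  also have "\<dots> \<le> \<epsilon>" using A assms by (intro cond_le global) auto
  finally show ?thesis .
qed

lemma abs_g_le:
  assumes "T \<in> index_sets" "y \<in> \<Omega>"
  shows "\<bar>g T y\<bar> \<le> 2 ^ k"
proof -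
  have "\<bar>g T y\<bar> \<le> 2 ^ card T" using assms by (intro abs_level_le_pow index_setsD)
  also have "\<dots> \<le> (2 :: real) ^ k" using i_le index_setsD(2)[OF assms(1)] by (intro power_increasing) auto
  finally show ?thesis .
qed

lemma depends_on_g: "depends_on T (g T)"
  using depends_on_level[of "{}" T] by simp

text \<open>A crude pointwise bound on the components. Its dependence on the binomial coefficient is
  affordable only when \<epsilon> is very small compared with k.\<close>

lemma cond_phi_F_small:
  assumes "x \<in> \<Omega>"
  shows "cond {} (\<lambda>y. \<phi> y * F y) x \<le> (k choose i) * 2 ^ i * \<epsilon> * cond {} \<phi> x"
proof -
  have "cond {} (\<lambda>y. \<phi> y * F y) x \<le> cond {} (\<lambda>y. ((k choose i) * 2 ^ i * \<epsilon>) * \<phi> y) x"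
  proof (rule cond_mono[OF assms])
    fix y assume "y \<in> fiber {} x"
    then have y: "y \<in> \<Omega>" by (rule fiber_in)
    have "F y \<le> (\<Sum>T\<in>index_sets. 2 ^ i * \<epsilon>)"
      unfolding F_def
    proof (rule sum_mono)
      fix T assume T: "T \<in> index_sets"
      have "\<bar>g T y\<bar> \<le> 2 ^ card T * \<epsilon>"
      proof (rule abs_level_le)
        fix R assume "R \<subseteq> T"
        then have "R \<subseteq> {..<k}" "card R \<le> i"
          using index_setsD[OF T] card_mono[of T R] by auto
        then show "cond ({} \<union> R) \<phi> y \<le> \<epsilon>" using cond_phi_le_eps y by simp
      qed (use T y index_setsD in auto)
      then show "g T y \<le> 2 ^ i * \<epsilon>" using index_setsD[OF T] by simp
    qed
    also have "\<dots> = (k choose i) * 2 ^ i * \<epsilon>" by (simp add: card_index_sets)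
    finally show "\<phi> y * F y \<le> ((k choose i) * 2 ^ i * \<epsilon>) * \<phi> y"
      using phi_nonneg[OF y] by (simp add: mult.commute mult_left_mono)
  qed
  then show ?thesis by (simp add: cond_cmult)
qed

lemma cnorm_g_le:
  assumes "T \<in> index_sets" "x \<in> \<Omega>"
  shows "cnorm {} x (g T) \<le> 2 ^ k * cnorm {} x \<phi>"
proof -
  have "cnorm {} x (g T) \<le> 2 ^ card T * cnorm {} x \<phi>"
    using assms index_setsD by (intro cnorm_level_le) auto
  also have "\<dots> \<le> 2 ^ k * cnorm {} x \<phi>"
    using assms index_setsD i_le by (intro mult_right_mono power_increasing) auto
  finally show ?thesis .
qed

lemma cnorm_mult_g_le:
  assumes "T1 \<in> index_sets" "T2 \<in> index_sets" "x \<in> \<Omega>"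
  shows "cnorm {} x (\<lambda>y. g T1 y * g T2 y) \<le> 4 ^ k * cnorm {} x \<phi>"
proof -
  have "cnorm {} x (\<lambda>y. g T1 y * g T2 y) \<le> 2 ^ k * cnorm {} x (g T2)"
    using assms abs_g_le by (intro cnorm_mult_bounded) auto
  also have "\<dots> \<le> 2 ^ k * (2 ^ k * cnorm {} x \<phi>)"
    using assms by (intro mult_left_mono cnorm_g_le) auto
  finally show ?thesis by (simp add: mult.assoc[symmetric] power_mult_distrib[symmetric])
qed

lemma cnorm_g_sq_le:
  "\<lbrakk>T \<in> index_sets; x \<in> \<Omega>\<rbrakk> \<Longrightarrow> cnorm {} x (\<lambda>y. (g T y)\<^sup>2) \<le> 4 ^ k * cnorm {} x \<phi>"
  using cnorm_mult_g_le[of T T x] by (simp add: power2_eq_square)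

section \<open>Conditional second moments of the components\<close>

text \<open>Subsets of J \<union> S split into a part in \<open>J\<close> and a part in
  \<open>S\<close>. Doing the \<open>S\<close>-sum first shows each component as an alternating sum
  of conditional components, whose masses are already under control.\<close>

lemma level_union:
  assumes "finite J" "finite S" "J \<inter> S = {}"
  shows "g (J \<union> S) y = (\<Sum>Q\<in>Pow J. (-1) ^ card (J - Q) * level Q S y)"
proof -
  have bij: "bij_betw (\<lambda>(Q, R). Q \<union> R) (Pow J \<times> Pow S) (Pow (J \<union> S))"
    by (rule bij_betw_byWitness[where f' = "\<lambda>T. (T \<inter> J, T \<inter> S)"]) (use assms in auto)
  have "g (J \<union> S) y = (\<Sum>(Q, R)\<in>Pow J \<times> Pow S. (-1) ^ card ((J \<union> S) - (Q \<union> R)) * cond (Q \<union> R) \<phi> y)"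
    unfolding level_def using sum.reindex_bij_betw[OF bij, symmetric,
      of "\<lambda>T. (-1) ^ card ((J \<union> S) - T) * cond ({} \<union> T) \<phi> y"] by (simp add: case_prod_unfold)
  also have "\<dots> = (\<Sum>(Q, R)\<in>Pow J \<times> Pow S. (-1) ^ card (J - Q) * ((-1) ^ card (S - R) * cond (Q \<union> R) \<phi> y))"
  proof (intro sum.cong refl, clarify)
    fix Q R assume "Q \<subseteq> J" "R \<subseteq> S"
    then have "(J \<union> S) - (Q \<union> R) = (J - Q) \<union> (S - R)" using assms by auto
    moreover have "card ((J - Q) \<union> (S - R)) = card (J - Q) + card (S - R)"
      using assms by (intro card_Un_disjoint) auto
    ultimately show "(-1) ^ card ((J \<union> S) - (Q \<union> R)) * cond (Q \<union> R) \<phi> y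
        = (-1) ^ card (J - Q) * ((-1) ^ card (S - R) * cond (Q \<union> R) \<phi> y)"
      by (simp add: power_add)
  qed
  also have "\<dots> = (\<Sum>Q\<in>Pow J. (-1) ^ card (J - Q) * level Q S y)"
    unfolding level_def by (simp add: sum.cartesian_product[symmetric] sum_distrib_left)
  finally show ?thesis .
qed

text \<open>The density of an index set among the positions. Since (k choose i) is at least (k/i)^i,
  a share of one over the binomial coefficient is at most r^i.\<close>

definition r :: real where "r = real i / real k"

lemma r_nonneg: "0 \<le> r" and r_le_1: "r \<le> 1"
  using i_le by (auto simp: r_def divide_le_eq_1)

text \<open>The equal-share bound gives 2 \<epsilon> over (k - |Q| choose |S|). With s = |S| and n =
  k - |Q| this coefficient is at least (n/s)^s, and n/s \<ge> k/i because removing the same number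
  from i and from k, where i \<le> k, cannot decrease the ratio of k to i.\<close>

lemma cond_level_sq_le_eps:
  assumes "1 \<le> i" "Q \<subseteq> J" "J \<union> S \<subseteq> {..<k}" "J \<inter> S = {}" "card J + card S = i" "y \<in> \<Omega>"
  shows "cond Q (\<lambda>z. (level Q S z)\<^sup>2) y \<le> 2 * \<epsilon> * r ^ card S"
proof -
  have finJ: "finite J" using assms finite_subset[of J "{..<k}"] by auto
  have q: "card Q \<le> card J" using assms finJ card_mono by blast
  let ?n = "k - card Q"
  have s: "card S \<le> ?n" using assms q i_le by linarith
  have n: "real i * real ?n \<ge> real k * real (card S)"
  proof -
    have "k * card S \<le> i * ?n"
    proof -
      have "card S = i - card J" using assms(5) by simp
      then have "k * card S = k * (i - card J)" by simp
      also have "\<dots> \<le> i * (k - card J)"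
        using i_le by (simp add: diff_mult_distrib2 mult.commute diff_le_mono2)
      also have "\<dots> \<le> i * ?n" using q by (intro mult_left_mono) auto
      finally show ?thesis .
    qed
    then show ?thesis by (metis of_nat_le_iff of_nat_mult)
  qed
  let ?c = "cond Q (\<lambda>z. (level Q S z)\<^sup>2) y"
  have c0: "0 \<le> ?c" using assms by (intro cond_nonneg) auto
  have "(1 / r) ^ card S \<le> (real ?n / real (card S)) ^ card S"
  proof (cases "card S = 0")
    case False
    then have "1 / r \<le> real ?n / real (card S)"
      using n assms(1) i_le by (simp add: r_def field_simps)
    then show ?thesis using r_nonneg by (intro power_mono) auto
  qed simp
  also have "\<dots> \<le> real (?n choose card S)"
    using binomial_ge_n_over_k_pow_k[OF s, where ?'a = real] by simp
  finally have "(1 / r) ^ card S * ?c \<le> real (?n choose card S) * ?c"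
    using c0 by (rule mult_right_mono)
  also have "\<dots> \<le> 2 * cond Q \<phi> y"
    using assms by (intro cond_level_sq_le) auto
  also have "\<dots> \<le> 2 * \<epsilon>"
    using assms q by (intro mult_left_mono cond_phi_le_eps) auto
  finally have "(1 / r) ^ card S * ?c \<le> 2 * \<epsilon>" .
  moreover have "0 < r" using assms(1) i_le by (simp add: r_def)
  ultimately show ?thesis by (simp add: power_one_over field_simps)
qed

text \<open>Split the component over the subsets \<open>Q\<close> of \<open>J\<close> by
  \<open>level_union\<close>. Since (Q \<union> S) \<inter> J = Q, conditioning on \<open>J\<close>
  acts like conditioning on \<open>Q\<close>, where the pointwise bound holds. The discrepancy is
  small only in L2, which is why the estimate is stated against a nonnegative weight h.\<close>

lemma cond_sq_g_mult_le:
  assumes "1 \<le> i" "T \<in> index_sets" "J \<subseteq> T" "x \<in> \<Omega>" and h: "\<And>y. y \<in> \<Omega> \<Longrightarrow> 0 \<le> h y"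
  shows "cond {} (\<lambda>y. cond J (\<lambda>z. (g T z)\<^sup>2) y * h y) x
    \<le> 2 * 4 ^ i * \<epsilon> * r ^ (i - card J) * cond {} h x + 16 ^ k * \<kappa> * cnorm {} x \<phi> * cnorm {} x h"
proof -
  define S where "S = T - J"
  have T: "T \<subseteq> {..<k}" "card T = i" "finite T" using assms index_setsD by auto
  have fin: "finite J" "finite S" using T assms finite_subset by (auto simp: S_def)
  have TJS: "T = J \<union> S" "J \<inter> S = {}" using assms by (auto simp: S_def)
  have card: "card J + card S = i" using TJS T fin by (simp add: card_Un_disjoint)
  let ?l = "\<lambda>Q z. (level Q S z)\<^sup>2"
  let ?D = "\<lambda>Q y. cond J (?l Q) y - cond Q (?l Q) y"
  have pt: "cond J (\<lambda>z. (g T z)\<^sup>2) y \<le> 2 ^ card J * (\<Sum>Q\<in>Pow J. 2 * \<epsilon> * r ^ card S + ?D Q y)" if y: "y \<in> \<Omega>" for y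
  proof -
    have "cond J (\<lambda>z. (g T z)\<^sup>2) y \<le> cond J (\<lambda>z. 2 ^ card J * (\<Sum>Q\<in>Pow J. ?l Q z)) y"
    proof (rule cond_mono[OF y])
      fix z
      have "(g T z)\<^sup>2 \<le> (\<Sum>Q\<in>Pow J. ((-1) ^ card (J - Q) * level Q S z)\<^sup>2) * card (Pow J)"
        unfolding TJS(1) level_union[OF fin TJS(2)] by (rule sum_squared_le_sum_of_squares)
      then show "(g T z)\<^sup>2 \<le> 2 ^ card J * (\<Sum>Q\<in>Pow J. ?l Q z)"
        using fin by (simp add: card_Pow power_mult_distrib mult.commute power_mult[symmetric])
    qed
    also have "\<dots> = 2 ^ card J * (\<Sum>Q\<in>Pow J. cond Q (?l Q) y + ?D Q y)"
      by (simp add: cond_cmult cond_sum)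
    also have "\<dots> \<le> 2 ^ card J * (\<Sum>Q\<in>Pow J. 2 * \<epsilon> * r ^ card S + ?D Q y)"
      using assms(1) T card TJS y
      by (intro mult_left_mono sum_mono add_right_mono cond_level_sq_le_eps[of _ J]) auto
    finally show ?thesis .
  qed
  have D: "cond {} (\<lambda>y. ?D Q y * h y) x \<le> 4 ^ k * \<kappa> * cnorm {} x \<phi> * cnorm {} x h" if Q: "Q \<in> Pow J" for Q
  proof -
    have int: "(Q \<union> S) \<inter> J = Q" using Q TJS by auto
    have s: "card S \<le> k" using card i_le by linarith
    have bd: "\<bar>level Q S y\<bar> \<le> 2 ^ k" if "y \<in> \<Omega>" for y
    proof -
      have "\<bar>level Q S y\<bar> \<le> 2 ^ card S" using fin that by (rule_tac abs_level_le_pow)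
      also have "\<dots> \<le> (2 :: real) ^ k" using s by (intro power_increasing) auto
      finally show ?thesis .
    qed
    have "cond {} (\<lambda>y. ?D Q y * h y) x \<le> cnorm {} x (?D Q) * cnorm {} x h"
      using cond_Cauchy_Schwarz[OF assms(4), of "{}" "?D Q" h] by (simp add: abs_le_iff)
    also have "\<dots> \<le> (\<kappa> * cnorm {} x (?l Q)) * cnorm {} x h"
    proof (rule mult_right_mono)
      have "cnorm {} x (\<lambda>y. cond J (?l Q) y - cond ((Q \<union> S) \<inter> J) (?l Q) y) \<le> \<kappa> * cnorm {} x (?l Q)"
        using assms Q T TJS
        by (intro cond_inter_close depends_on_power depends_on_level) auto
      then show "cnorm {} x (?D Q) \<le> \<kappa> * cnorm {} x (?l Q)" by (simp only: int)
    qed (use assms in auto)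
    also have "\<dots> \<le> (\<kappa> * (2 ^ k * (2 ^ k * cnorm {} x \<phi>))) * cnorm {} x h"
    proof (intro mult_right_mono mult_left_mono)
      have "cnorm {} x (?l Q) \<le> 2 ^ k * cnorm {} x (level Q S)"
        unfolding power2_eq_square using bd assms by (intro cnorm_mult_bounded) auto
      also have "\<dots> \<le> 2 ^ k * (2 ^ card S * cnorm {} x \<phi>)"
        using fin assms by (intro mult_left_mono cnorm_level_le) auto
      also have "\<dots> \<le> 2 ^ k * (2 ^ k * cnorm {} x \<phi>)"
        using s assms by (intro mult_left_mono mult_right_mono power_increasing) auto
      finally show "cnorm {} x (?l Q) \<le> 2 ^ k * (2 ^ k * cnorm {} x \<phi>)" .
    qed (use assms kappa_nonneg in auto)
    also have "\<dots> = 4 ^ k * \<kappa> * cnorm {} x \<phi> * cnorm {} x h"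
    proof -
      have "(4 :: real) ^ k = 2 ^ k * 2 ^ k" by (simp add: power_mult_distrib[symmetric])
      then show ?thesis by simp
    qed
    finally show ?thesis .
  qed
  have "cond {} (\<lambda>y. cond J (\<lambda>z. (g T z)\<^sup>2) y * h y) x
      \<le> cond {} (\<lambda>y. 2 ^ card J * (\<Sum>Q\<in>Pow J. 2 * \<epsilon> * r ^ card S * h y + ?D Q y * h y)) x"
    using mult_right_mono[OF pt h]
    by (intro cond_mono assms) (auto simp: distrib_right sum_distrib_right mult.assoc dest!: fiber_in)
  also have "\<dots> = 2 ^ card J * (\<Sum>Q\<in>Pow J. 2 * \<epsilon> * r ^ card S * cond {} h x + cond {} (\<lambda>y. ?D Q y * h y) x)"
    by (simp add: cond_cmult cond_sum cond_add)
  also have "\<dots> \<le> 2 ^ card J * (\<Sum>Q\<in>Pow J. 2 * \<epsilon> * r ^ card S * cond {} h x + 4 ^ k * \<kappa> * cnorm {} x \<phi> * cnorm {} x h)"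
    using D by (intro mult_left_mono sum_mono add_left_mono) auto
  \<comment> \<open>One factor 2^|J| comes from squaring a sum of 2^|J| terms, the other from adding
    equal bounds over all \<open>Q\<close>.\<close>
  also have "\<dots> = 4 ^ card J * (2 * \<epsilon> * r ^ card S * cond {} h x + 4 ^ k * \<kappa> * cnorm {} x \<phi> * cnorm {} x h)"
    using fin by (simp add: card_Pow mult.assoc[symmetric] power_mult_distrib[symmetric])
  also have "\<dots> = 4 ^ card J * (2 * \<epsilon> * r ^ card S * cond {} h x) + 4 ^ card J * (4 ^ k * \<kappa> * cnorm {} x \<phi> * cnorm {} x h)"
    by (rule distrib_left)
  also have "\<dots> \<le> 4 ^ i * (2 * \<epsilon> * r ^ card S * cond {} h x) + 4 ^ k * (4 ^ k * \<kappa> * cnorm {} x \<phi> * cnorm {} x h)"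
    using card i_le eps_nonneg r_nonneg kappa_nonneg assms
    by (intro add_mono mult_right_mono power_increasing mult_nonneg_nonneg cond_nonneg) auto
  also have "\<dots> = 2 * 4 ^ i * \<epsilon> * r ^ (i - card J) * cond {} h x + 16 ^ k * \<kappa> * cnorm {} x \<phi> * cnorm {} x h"
  proof -
    have "(16 :: real) ^ k = 4 ^ k * 4 ^ k" by (simp add: power_mult_distrib[symmetric])
    moreover have "i - card J = card S" using card by simp
    ultimately show ?thesis by simp
  qed
  finally show ?thesis .
qed

end

section \<open>Correlations of two and of four components\<close>

context global_function
begin

text \<open>Cauchy-Schwarz inside the conditional expectation leaves a product of two conditional
  second moments. Self-adjointness removes the conditioning from the second; then the first is moved
  from \<open>Z\<close> to T1 \<inter> Z and, after projecting to \<open>T2\<close>, to T1 \<inter>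
  T2 \<inter> Z. Each of the two moves costs one error term.\<close>

lemma cond_pair_sq_le:
  assumes T: "T1 \<in> index_sets" "T2 \<in> index_sets" and Z: "Z \<subseteq> {..<k}" and x: "x \<in> \<Omega>"
  shows "cond {} (\<lambda>y. (cond Z (\<lambda>z. g T1 z * g T2 z) y)\<^sup>2) x
    \<le> cond {} (\<lambda>y. cond (T1 \<inter> T2 \<inter> Z) (\<lambda>z. (g T1 z)\<^sup>2) y * (g T2 y)\<^sup>2) x + 2 * 16 ^ k * \<kappa> * cond {} \<phi> x"
proof -
  let ?s1 = "\<lambda>z. (g T1 z)\<^sup>2" and ?s2 = "\<lambda>z. (g T2 z)\<^sup>2"
  let ?u = "cond (T1 \<inter> Z) ?s1" and ?J = "T1 \<inter> T2 \<inter> Z"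
  have Tk: "T1 \<subseteq> {..<k}" "T2 \<subseteq> {..<k}" using T index_setsD by auto
  have sq: "cnorm {} x \<phi> * cnorm {} x \<phi> = cond {} \<phi> x"
    using cnorm_phi_sq[OF x, of "{}"] by (simp add: power2_eq_square)
  have prod: "\<kappa> * cnorm {} x ?s1 * cnorm {} x ?s2 \<le> 16 ^ k * \<kappa> * cond {} \<phi> x"
  proof -
    have "\<kappa> * cnorm {} x ?s1 * cnorm {} x ?s2 \<le> \<kappa> * (4 ^ k * cnorm {} x \<phi>) * (4 ^ k * cnorm {} x \<phi>)"
      using T x kappa_nonneg by (intro mult_mono cnorm_g_sq_le mult_nonneg_nonneg order_refl) auto
    also have "\<dots> = (4 ^ k * 4 ^ k) * \<kappa> * (cnorm {} x \<phi> * cnorm {} x \<phi>)" by simp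
    also have "\<dots> = 16 ^ k * \<kappa> * cond {} \<phi> x"
      unfolding sq by (simp add: power_mult_distrib[symmetric])
    finally show ?thesis .
  qed
  have err: "cond {} (\<lambda>y. D y * ?s2 y) x \<le> 16 ^ k * \<kappa> * cond {} \<phi> x"
    if "cnorm {} x D \<le> \<kappa> * cnorm {} x ?s1" for D
  proof -
    have "cond {} (\<lambda>y. D y * ?s2 y) x \<le> cnorm {} x D * cnorm {} x ?s2"
      using x by (rule cond_mult_le)
    also have "\<dots> \<le> \<kappa> * cnorm {} x ?s1 * cnorm {} x ?s2"
      using that x by (intro mult_right_mono) auto
    finally show ?thesis using prod by simp
  qed
  have "cond {} (\<lambda>y. (cond Z (\<lambda>z. g T1 z * g T2 z) y)\<^sup>2) x
      \<le> cond {} (\<lambda>y. cond Z ?s1 y * cond Z ?s2 y) x"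
  proof (rule cond_mono[OF x])
    fix y assume "y \<in> fiber {} x"
    then have y: "y \<in> \<Omega>" by (rule fiber_in)
    have "\<bar>cond Z (\<lambda>z. g T1 z * g T2 z) y\<bar>\<^sup>2 \<le> (cnorm Z y (g T1) * cnorm Z y (g T2))\<^sup>2"
      using cond_Cauchy_Schwarz[OF y] by (intro power_mono) auto
    then show "(cond Z (\<lambda>z. g T1 z * g T2 z) y)\<^sup>2 \<le> cond Z ?s1 y * cond Z ?s2 y"
      using y by (simp add: power_mult_distrib cnorm_sq)
  qed
  also have "\<dots> = cond {} (\<lambda>y. cond Z ?s1 y * ?s2 y) x"
    using x by (intro cond_mult_cond[symmetric] depends_on_cond) auto
  also have "\<dots> = cond {} (\<lambda>y. (cond Z ?s1 y - ?u y) * ?s2 y) x + cond {} (\<lambda>y. ?u y * ?s2 y) x"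
    unfolding cond_add[symmetric] by (simp add: algebra_simps)
  also have "cond {} (\<lambda>y. ?u y * ?s2 y) x = cond {} (\<lambda>y. ?s2 y * cond T2 ?u y) x"
    using x by (subst mult.commute) (intro cond_mult_cond depends_on_power depends_on_g, auto)
  also have "\<dots> = cond {} (\<lambda>y. (cond T2 ?u y - cond ?J ?s1 y) * ?s2 y) x + cond {} (\<lambda>y. cond ?J ?s1 y * ?s2 y) x"
    unfolding cond_add[symmetric] by (simp add: algebra_simps)
  also have "cond {} (\<lambda>y. (cond Z ?s1 y - ?u y) * ?s2 y) x \<le> 16 ^ k * \<kappa> * cond {} \<phi> x"
    using x Tk Z by (intro err cond_inter_close depends_on_power depends_on_g) auto
  also have "cond {} (\<lambda>y. (cond T2 ?u y - cond ?J ?s1 y) * ?s2 y) x \<le> 16 ^ k * \<kappa> * cond {} \<phi> x"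
  proof (rule err)
    have "cnorm {} x (\<lambda>y. cond T2 ?u y - cond ?J ?s1 y) = cnorm {} x (\<lambda>y. cond T2 ?u y - cond ((T1 \<inter> Z) \<inter> T2) ?u y)"
    proof (rule cnorm_cong)
      fix y assume "y \<in> \<Omega>"
      then have "cond ((T1 \<inter> Z) \<inter> T2) ?u y = cond ((T1 \<inter> Z) \<inter> T2) ?s1 y" by (intro cond_tower) auto
      moreover have "(T1 \<inter> Z) \<inter> T2 = ?J" by auto
      ultimately show "cond T2 ?u y - cond ?J ?s1 y = cond T2 ?u y - cond ((T1 \<inter> Z) \<inter> T2) ?u y" by simp
    qed
    also have "\<dots> \<le> \<kappa> * cnorm {} x ?u"
      using x Tk by (intro cond_inter_close depends_on_cond) auto
    also have "\<dots> \<le> \<kappa> * cnorm {} x ?s1"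
      using x kappa_nonneg by (intro mult_left_mono cnorm_cond_le) auto
    finally show "cnorm {} x (\<lambda>y. cond T2 ?u y - cond ?J ?s1 y) \<le> \<kappa> * cnorm {} x ?s1" .
  qed
  finally show ?thesis by linarith
qed

text \<open>The other three factors depend only on coordinates without v, and projecting
  \<open>g T1\<close> to those coordinates almost kills it.\<close>

lemma cond_uncovered_le:
  assumes T: "T1 \<in> index_sets" "T2 \<in> index_sets" "T3 \<in> index_sets" "T4 \<in> index_sets"
    and v: "v \<in> T1" "v \<notin> T2 \<union> T3 \<union> T4" and x: "x \<in> \<Omega>"
  shows "cond {} (\<lambda>y. g T1 y * (g T2 y * (g T3 y * g T4 y))) x \<le> 16 ^ k * \<kappa> * cond {} \<phi> x"
proof -
  let ?B = "T2 \<union> T3 \<union> T4" and ?h = "\<lambda>y. g T2 y * (g T3 y * g T4 y)"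
  have B: "?B \<subseteq> {..<k}" using T index_setsD by auto
  have dep: "depends_on ?B ?h"
    by (intro depends_on_mult depends_on_mono[OF depends_on_g]) auto
  have "cond {} (\<lambda>y. g T1 y * ?h y) x = cond {} (\<lambda>y. ?h y * cond ?B (g T1) y) x"
    using cond_mult_cond[OF dep _ x, of "{}" "g T1"] by (simp add: mult.commute)
  also have "\<dots> \<le> cnorm {} x ?h * cnorm {} x (cond ?B (g T1))"
    using x by (rule cond_mult_le)
  also have "\<dots> \<le> (2 ^ k * (4 ^ k * cnorm {} x \<phi>)) * (2 ^ k * \<kappa> * cnorm {} x \<phi>)"
  proof (rule mult_mono)
    have "cnorm {} x ?h \<le> 2 ^ k * cnorm {} x (\<lambda>y. g T3 y * g T4 y)"
      using T x abs_g_le by (intro cnorm_mult_bounded) auto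
    also have "\<dots> \<le> 2 ^ k * (4 ^ k * cnorm {} x \<phi>)"
      using T x by (intro mult_left_mono cnorm_mult_g_le) auto
    finally show "cnorm {} x ?h \<le> 2 ^ k * (4 ^ k * cnorm {} x \<phi>)" .
    have "cnorm {} x (cond ?B (g T1)) \<le> 2 ^ card T1 * \<kappa> * cnorm {} x \<phi>"
      using T v B x index_setsD by (intro cnorm_cond_level_le[of _ _ _ v]) auto
    also have "\<dots> \<le> 2 ^ k * \<kappa> * cnorm {} x \<phi>"
      using T x index_setsD i_le kappa_nonneg by (intro mult_right_mono power_increasing) auto
    finally show "cnorm {} x (cond ?B (g T1)) \<le> 2 ^ k * \<kappa> * cnorm {} x \<phi>" .
  qed (use x in auto)
  also have "\<dots> = (2 ^ k * 4 ^ k * 2 ^ k) * \<kappa> * (cnorm {} x \<phi>)\<^sup>2" by (simp add: power2_eq_square)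
  also have "\<dots> = 16 ^ k * \<kappa> * cond {} \<phi> x"
    by (simp add: cnorm_phi_sq[OF x] power_mult_distrib[symmetric])
  finally show ?thesis .
qed

text \<open>By almost orthogonality this stands in for the squared norm of \<open>F\<close>, and it
  splits into exactly equal shares.\<close>

definition level_mass :: "(nat \<Rightarrow> 'v) \<Rightarrow> real" where
  "level_mass x = (\<Sum>T\<in>index_sets. cond {} (\<lambda>y. (g T y)\<^sup>2) x)"

text \<open>Errors of size \<open>16\<^sup>k \<kappa> \<EE>[\<phi>]\<close> are to be charged to terms carrying the factor \<open>\<epsilon> r\<^sup>u\<close>, which is
  at least \<open>8\<^bsup>-k\<^esup> \<cdot> 16\<^bsup>-k\<^esup>\<close> when \<open>u \<le> 4 i\<close>; hence the exponent 11.\<close>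

definition \<delta> :: real where "\<delta> = 2 * 2 ^ (11 * k) * \<kappa>"

lemma delta_nonneg: "0 \<le> \<delta>"
  using kappa_nonneg by (simp add: \<delta>_def)

lemma level_mass_nonneg: "x \<in> \<Omega> \<Longrightarrow> 0 \<le> level_mass x"
  unfolding level_mass_def by (intro sum_nonneg cond_nonneg) auto

text \<open>The product K r^u is the budget of a quadruple whose union has u elements: the mass pays
  for its main term and the \<delta> summand for the spectral errors.\<close>

definition K :: "(nat \<Rightarrow> 'v) \<Rightarrow> real" where
  "K x = 2 * 4 ^ i * \<epsilon> * (level_mass x + \<delta> * cond {} \<phi> x)"

lemma K_nonneg: "x \<in> \<Omega> \<Longrightarrow> 0 \<le> K x"
  unfolding K_def using eps_nonneg delta_nonneg level_mass_nonneg cond_phi_nonneg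
  by (intro mult_nonneg_nonneg add_nonneg_nonneg) auto

text \<open>Both follow from (k/i)^i \<le> (k choose i) \<le> 2^k.\<close>

lemma one_le_pow_r:
  assumes "1 \<le> i"
  shows "1 \<le> 2 ^ k * r ^ i" "1 \<le> real (k choose i) * r ^ i"
proof -
  have r: "0 < r" using assms i_le by (simp add: r_def)
  have "(1 / r) ^ i \<le> real (k choose i)"
    using binomial_ge_n_over_k_pow_k[OF i_le, where ?'a = real] by (simp add: r_def)
  then show 1: "1 \<le> real (k choose i) * r ^ i"
    using r by (simp add: power_one_over field_simps)
  have "real (k choose i) \<le> 2 ^ k"
    using binomial_le_pow2[of k i] by (metis of_nat_le_iff of_nat_numeral of_nat_power)
  then have "real (k choose i) * r ^ i \<le> 2 ^ k * r ^ i" using r by (intro mult_right_mono) auto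
  then show "1 \<le> 2 ^ k * r ^ i" using 1 by simp
qed

lemma cond_g_sq_le:
  assumes "1 \<le> i" "T \<in> index_sets" "x \<in> \<Omega>"
  shows "cond {} (\<lambda>y. (g T y)\<^sup>2) x \<le> r ^ i * level_mass x"
proof -
  let ?m = "cond {} (\<lambda>y. (g T y)\<^sup>2) x"
  have "level_mass x = (\<Sum>T'\<in>index_sets. ?m)"
    unfolding level_mass_def
    using assms index_setsD by (intro sum.cong refl cond_level_sq_eq) auto
  then have "level_mass x = real (k choose i) * ?m"
    by (simp only: sum_constant card_index_sets)
  then have "r ^ i * level_mass x = (real (k choose i) * r ^ i) * ?m"
    by (simp add: mult_ac)
  moreover have "1 * ?m \<le> (real (k choose i) * r ^ i) * ?m"
    using one_le_pow_r[OF assms(1)] assms by (intro mult_right_mono cond_nonneg) auto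
  ultimately show ?thesis by linarith
qed

text \<open>The factor 8^k pays for a small \<epsilon> and 2^(s k) for the power of r;
  \<open>B\<close> is what remains of 2^(11 k). The two uses are \<open>B\<close> = 16^k with s = 4
  and \<open>B\<close> = 64^k with s = 2.\<close>

lemma error_le_K:
  assumes "1 \<le> i" "1 \<le> 8 ^ k * \<epsilon>" "x \<in> \<Omega>" "u \<le> s * i" "B * 2 ^ (3 * k) * 2 ^ (s * k) = 2 ^ (11 * k)" "0 \<le> B"
  shows "4 * B * \<kappa> * cond {} \<phi> x \<le> 2 * 4 ^ i * \<epsilon> * (\<delta> * cond {} \<phi> x) * r ^ u"
proof -
  let ?c = "cond {} \<phi> x"
  have "1 \<le> (2 ^ k * r ^ i) ^ s" using one_le_pow_r(1)[OF assms(1)] by (rule one_le_power)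
  also have "\<dots> = 2 ^ (s * k) * r ^ (s * i)"
    by (simp add: power_mult_distrib power_mult[symmetric] mult.commute)
  also have "\<dots> \<le> 2 ^ (s * k) * r ^ u"
    using assms r_nonneg r_le_1 by (intro mult_left_mono power_decreasing) auto
  finally have a: "1 \<le> 2 ^ (s * k) * r ^ u" .
  have b: "1 \<le> 2 ^ (3 * k) * \<epsilon>" using assms(2) by (simp add: power_mult)
  have nn: "0 \<le> 4 * B * \<kappa> * ?c" using assms kappa_nonneg cond_phi_nonneg by auto
  have "1 \<le> (4 :: real) ^ i" by simp
  then have "1 \<le> 4 ^ i * ((2 ^ (3 * k) * \<epsilon>) * (2 ^ (s * k) * r ^ u))"
    using a b by (metis mult_mono mult_1 order_trans zero_le_one mult_ge1_I)
  then have "1 * (4 * B * \<kappa> * ?c) \<le> (4 ^ i * ((2 ^ (3 * k) * \<epsilon>) * (2 ^ (s * k) * r ^ u))) * (4 * B * \<kappa> * ?c)"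
    using nn by (rule mult_right_mono)
  also have "\<dots> = 2 * 4 ^ i * \<epsilon> * (2 * (B * 2 ^ (3 * k) * 2 ^ (s * k)) * \<kappa> * ?c) * r ^ u" by (simp add: mult_ac)
  also have "\<dots> = 2 * 4 ^ i * \<epsilon> * (\<delta> * ?c) * r ^ u" unfolding assms(5) \<delta>_def ..
  finally show ?thesis by simp
qed

lemma error16_le_K:
  assumes "1 \<le> i" "1 \<le> 8 ^ k * \<epsilon>" "x \<in> \<Omega>" "u \<le> 4 * i"
  shows "16 ^ k * \<kappa> * cond {} \<phi> x \<le> K x * r ^ u"
proof -
  have "(16 :: real) ^ k * 2 ^ (3 * k) * 2 ^ (4 * k) = 2 ^ (11 * k)"
    by (simp add: power_mult power_mult_distrib[symmetric])
  then have "4 * 16 ^ k * \<kappa> * cond {} \<phi> x \<le> 2 * 4 ^ i * \<epsilon> * (\<delta> * cond {} \<phi> x) * r ^ u"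
    using assms by (intro error_le_K[where s = 4]) auto
  also have "\<dots> \<le> K x * r ^ u"
    unfolding K_def using assms eps_nonneg r_nonneg level_mass_nonneg
    by (intro mult_right_mono mult_left_mono) auto
  finally have "4 * 16 ^ k * \<kappa> * cond {} \<phi> x \<le> K x * r ^ u" .
  moreover have "0 \<le> 16 ^ k * \<kappa> * cond {} \<phi> x" using kappa_nonneg cond_phi_nonneg assms by auto
  ultimately show ?thesis by linarith
qed

text \<open>With j = |T1 \<inter> T2 \<inter> Z|, the conditional second moment of
  \<open>g T1\<close> contributes r^(i - j) and the plain second moment of \<open>g T2\<close>
  contributes r^i.\<close>

lemma cnorm_cond_pair_sq_le_K:
  assumes "1 \<le> i" "1 \<le> 8 ^ k * \<epsilon>" and T: "T1 \<in> index_sets" "T2 \<in> index_sets"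
    and Z: "Z \<subseteq> {..<k}" and x: "x \<in> \<Omega>"
  shows "(cnorm {} x (cond Z (\<lambda>z. g T1 z * g T2 z)))\<^sup>2 \<le> K x * r ^ (2 * i - card (T1 \<inter> T2 \<inter> Z))"
proof -
  let ?J = "T1 \<inter> T2 \<inter> Z" and ?c = "cond {} \<phi> x" and ?s2 = "\<lambda>y. (g T2 y)\<^sup>2"
  let ?j = "card ?J"
  have j: "?j \<le> i" using T index_setsD card_mono[of T1 ?J] by auto
  have "(cnorm {} x (cond Z (\<lambda>z. g T1 z * g T2 z)))\<^sup>2
      \<le> cond {} (\<lambda>y. cond ?J (\<lambda>z. (g T1 z)\<^sup>2) y * ?s2 y) x + 2 * 16 ^ k * \<kappa> * ?c"
    using cond_pair_sq_le[OF T Z x] x by (simp add: cnorm_sq)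
  also have "cond {} (\<lambda>y. cond ?J (\<lambda>z. (g T1 z)\<^sup>2) y * ?s2 y) x
      \<le> 2 * 4 ^ i * \<epsilon> * r ^ (i - ?j) * cond {} ?s2 x + 16 ^ k * \<kappa> * cnorm {} x \<phi> * cnorm {} x ?s2"
    using assms by (intro cond_sq_g_mult_le) auto
  also have "2 * 4 ^ i * \<epsilon> * r ^ (i - ?j) * cond {} ?s2 x \<le> 2 * 4 ^ i * \<epsilon> * r ^ (i - ?j) * (r ^ i * level_mass x)"
    using assms eps_nonneg r_nonneg by (intro mult_left_mono cond_g_sq_le) auto
  also have "\<dots> = 2 * 4 ^ i * \<epsilon> * level_mass x * r ^ (2 * i - ?j)"
  proof -
    have "2 * i - ?j = (i - ?j) + i" using j by simp
    then show ?thesis by (simp add: power_add mult_ac)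
  qed
  also have "16 ^ k * \<kappa> * cnorm {} x \<phi> * cnorm {} x ?s2 \<le> 16 ^ k * \<kappa> * cnorm {} x \<phi> * (4 ^ k * cnorm {} x \<phi>)"
    using assms kappa_nonneg by (intro mult_left_mono cnorm_g_sq_le mult_nonneg_nonneg) auto
  also have "\<dots> = (16 ^ k * 4 ^ k) * \<kappa> * (cnorm {} x \<phi>)\<^sup>2" by (simp add: power2_eq_square)
  also have "\<dots> = 64 ^ k * \<kappa> * ?c" by (simp add: cnorm_phi_sq[OF x] power_mult_distrib[symmetric])
  finally have "(cnorm {} x (cond Z (\<lambda>z. g T1 z * g T2 z)))\<^sup>2
      \<le> 2 * 4 ^ i * \<epsilon> * level_mass x * r ^ (2 * i - ?j) + (64 ^ k * \<kappa> * ?c + 2 * 16 ^ k * \<kappa> * ?c)" by simp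
  also have "64 ^ k * \<kappa> * ?c + 2 * 16 ^ k * \<kappa> * ?c \<le> 4 * 64 ^ k * \<kappa> * ?c"
  proof -
    have "16 ^ k * (\<kappa> * ?c) \<le> 64 ^ k * (\<kappa> * ?c)"
      using kappa_nonneg cond_phi_nonneg x by (intro mult_right_mono power_mono) auto
    moreover have "0 \<le> 64 ^ k * (\<kappa> * ?c)" using kappa_nonneg cond_phi_nonneg x by auto
    ultimately show ?thesis unfolding mult.assoc by linarith
  qed
  also have "4 * 64 ^ k * \<kappa> * ?c \<le> 2 * 4 ^ i * \<epsilon> * (\<delta> * ?c) * r ^ (2 * i - ?j)"
  proof -
    have "(64 :: real) ^ k * 2 ^ (3 * k) * 2 ^ (2 * k) = 2 ^ (11 * k)"
      by (simp add: power_mult power_mult_distrib[symmetric])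
    then show ?thesis using assms by (intro error_le_K[where s = 2]) auto
  qed
  finally show ?thesis by (simp add: K_def algebra_simps)
qed

text \<open>A position covered once leaves only an error term. Otherwise the pair products depend on
  T1 \<union> T2 and T3 \<union> T4 and are almost independent given the common coordinates
  \<open>?Z\<close>. Cauchy-Schwarz then reduces to two pair bounds, whose exponents add up to at
  least twice the size of the union by \<open>doubly_covered_card_le\<close>.\<close>

lemma cond_quadruple_le_K:
  assumes i: "1 \<le> i" and eps: "1 \<le> 8 ^ k * \<epsilon>"
    and T: "T1 \<in> index_sets" "T2 \<in> index_sets" "T3 \<in> index_sets" "T4 \<in> index_sets" and x: "x \<in> \<Omega>"
  shows "cond {} (\<lambda>y. (g T1 y * g T2 y) * (g T3 y * g T4 y)) x \<le> 2 * K x * r ^ card (T1 \<union> T2 \<union> T3 \<union> T4)"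
proof -
  let ?u = "card (T1 \<union> T2 \<union> T3 \<union> T4)" and ?c = "cond {} \<phi> x"
  have fin: "finite T1" "finite T2" "finite T3" "finite T4" using T index_setsD by auto
  have u: "?u \<le> 4 * i"
  proof -
    have "?u \<le> card T1 + card T2 + card T3 + card T4"
      using card_Un_le[of T1 T2] card_Un_le[of "T1 \<union> T2" T3] card_Un_le[of "T1 \<union> T2 \<union> T3" T4] by linarith
    then show ?thesis using T by (simp add: index_setsD)
  qed
  have err: "16 ^ k * \<kappa> * ?c \<le> K x * r ^ ?u" using i eps x u by (rule error16_le_K)
  have K: "0 \<le> K x * r ^ ?u" using K_nonneg[OF x] r_nonneg by simp
  have bad: ?thesis if "cond {} (\<lambda>y. (g T1 y * g T2 y) * (g T3 y * g T4 y)) x \<le> 16 ^ k * \<kappa> * ?c"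
    using that err K by simp
  consider v where "v \<in> T1" "v \<notin> T2 \<union> T3 \<union> T4" | v where "v \<in> T2" "v \<notin> T1 \<union> T3 \<union> T4"
    | v where "v \<in> T3" "v \<notin> T4 \<union> T1 \<union> T2" | v where "v \<in> T4" "v \<notin> T3 \<union> T1 \<union> T2"
    | (covered) "T1 \<subseteq> T2 \<union> T3 \<union> T4" "T2 \<subseteq> T1 \<union> T3 \<union> T4" "T3 \<subseteq> T1 \<union> T2 \<union> T4" "T4 \<subseteq> T1 \<union> T2 \<union> T3"
    by blast
  then show ?thesis
  proof cases
    case 1
    then show ?thesis using cond_uncovered_le[of T1 T2 T3 T4] T x by (intro bad) (simp add: mult_ac)
  next
    case 2
    then show ?thesis using cond_uncovered_le[of T2 T1 T3 T4] T x by (intro bad) (simp add: mult_ac)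
  next
    case 3
    then show ?thesis using cond_uncovered_le[of T3 T4 T1 T2] T x by (intro bad) (simp add: mult_ac)
  next
    case 4
    then show ?thesis using cond_uncovered_le[of T4 T3 T1 T2] T x by (intro bad) (simp add: mult_ac)
  next
    case covered
    let ?A = "T1 \<union> T2" and ?B = "T3 \<union> T4"
    let ?Z = "?B \<inter> ?A"
    let ?a = "\<lambda>y. g T1 y * g T2 y" and ?b = "\<lambda>y. g T3 y * g T4 y"
    have sub: "?A \<subseteq> {..<k}" "?B \<subseteq> {..<k}" "?Z \<subseteq> {..<k}"
      using T[THEN index_setsD(1)] by auto
    have dep: "depends_on ?A ?a" "depends_on ?B ?b"
      by (intro depends_on_mult depends_on_mono[OF depends_on_g]; blast)+
    let ?j1 = "card (T1 \<inter> T2 \<inter> ?Z)" and ?j2 = "card (T3 \<inter> T4 \<inter> ?Z)"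
    have J: "T1 \<inter> T2 \<inter> ?Z = T1 \<inter> T2 \<inter> (T3 \<union> T4)" "T3 \<inter> T4 \<inter> ?Z = T3 \<inter> T4 \<inter> (T1 \<union> T2)" by auto
    have count: "2 * ?u + ?j1 + ?j2 \<le> 4 * i"
      using doubly_covered_card_le[OF fin covered] T unfolding J by (simp add: index_setsD)
    have dec: "cond {} (\<lambda>y. ?a y * ?b y) x
        = cond {} (\<lambda>y. ?a y * (cond ?A ?b y - cond ?Z ?b y)) x + cond {} (\<lambda>y. ?a y * cond ?Z ?b y) x"
    proof -
      have "cond {} (\<lambda>y. ?a y * ?b y) x = cond {} (\<lambda>y. ?a y * cond ?A ?b y) x"
        using dep x by (intro cond_mult_cond) auto
      then show ?thesis unfolding cond_add[symmetric] by (simp add: algebra_simps)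
    qed
    have indep: "cond {} (\<lambda>y. ?a y * (cond ?A ?b y - cond ?Z ?b y)) x \<le> K x * r ^ ?u"
    proof -
      have na: "cnorm {} x ?a \<le> 4 ^ k * cnorm {} x \<phi>"
        using T x by (intro cnorm_mult_g_le)
      have "cnorm {} x (\<lambda>y. cond ?A ?b y - cond ?Z ?b y) \<le> \<kappa> * cnorm {} x ?b"
        using sub dep x by (intro cond_inter_close) auto
      also have "\<dots> \<le> \<kappa> * (4 ^ k * cnorm {} x \<phi>)"
        using T x kappa_nonneg by (intro mult_left_mono cnorm_mult_g_le)
      finally have nb: "cnorm {} x (\<lambda>y. cond ?A ?b y - cond ?Z ?b y) \<le> \<kappa> * (4 ^ k * cnorm {} x \<phi>)" .
      have "cond {} (\<lambda>y. ?a y * (cond ?A ?b y - cond ?Z ?b y)) x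
          \<le> cnorm {} x ?a * cnorm {} x (\<lambda>y. cond ?A ?b y - cond ?Z ?b y)"
        using x by (rule cond_mult_le)
      also have "\<dots> \<le> (4 ^ k * cnorm {} x \<phi>) * (\<kappa> * (4 ^ k * cnorm {} x \<phi>))"
        using na nb x by (intro mult_mono) auto
      also have "\<dots> = (4 ^ k * 4 ^ k) * \<kappa> * (cnorm {} x \<phi>)\<^sup>2" by (simp add: power2_eq_square)
      also have "\<dots> = 16 ^ k * \<kappa> * ?c" by (simp add: cnorm_phi_sq[OF x] power_mult_distrib[symmetric])
      finally show ?thesis using err by simp
    qed
    have main: "cond {} (\<lambda>y. ?a y * cond ?Z ?b y) x \<le> K x * r ^ ?u"
    proof -
      let ?na = "cnorm {} x (cond ?Z ?a)" and ?nb = "cnorm {} x (cond ?Z ?b)"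
      have sq: "(?nb * ?na)\<^sup>2 \<le> (K x * r ^ ?u)\<^sup>2"
      proof -
        have "(?nb * ?na)\<^sup>2 \<le> (K x * r ^ (2 * i - ?j2)) * (K x * r ^ (2 * i - ?j1))"
          unfolding power_mult_distrib using i eps T sub x K_nonneg[OF x] r_nonneg
          by (intro mult_mono cnorm_cond_pair_sq_le_K mult_nonneg_nonneg) auto
        also have "\<dots> = (K x)\<^sup>2 * r ^ ((2 * i - ?j2) + (2 * i - ?j1))"
          by (simp add: power2_eq_square power_add mult_ac)
        also have "\<dots> \<le> (K x)\<^sup>2 * r ^ (2 * ?u)"
          using count r_nonneg r_le_1 by (intro mult_left_mono power_decreasing) auto
        also have "\<dots> = (K x * r ^ ?u)\<^sup>2" by (simp add: power_mult_distrib power_mult[symmetric] mult.commute)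
        finally show ?thesis .
      qed
      have "cond {} (\<lambda>y. ?a y * cond ?Z ?b y) x = cond {} (\<lambda>y. cond ?Z ?b y * ?a y) x"
        by (simp add: mult.commute)
      also have "\<dots> = cond {} (\<lambda>y. cond ?Z ?b y * cond ?Z ?a y) x"
        using x by (intro cond_mult_cond depends_on_cond) auto
      also have "\<dots> \<le> ?nb * ?na"
        using x by (rule cond_mult_le)
      also have "\<dots> \<le> K x * r ^ ?u"
        using sq K by (rule power2_le_imp_le)
      finally show ?thesis .
    qed
    show ?thesis using dec indep main by linarith
  qed
qed

section \<open>Assembling the level inequality\<close>

lemma fourth_moment_le:
  assumes "1 \<le> i" "1 \<le> 8 ^ k * \<epsilon>" "x \<in> \<Omega>"
  shows "cond {} (\<lambda>y. F y ^ 4) x \<le> 2 * K x * exp (16 * real i)"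
proof -
  let ?N = "index_sets \<times> index_sets \<times> index_sets \<times> index_sets"
  have F4: "F y ^ 4 = (\<Sum>(T1, T2, T3, T4)\<in>?N. (g T1 y * g T2 y) * (g T3 y * g T4 y))" for y
  proof -
    have "F y ^ 4 = F y * (F y * (F y * F y))" by (simp add: power4_eq_xxxx mult.assoc)
    also have "\<dots> = (\<Sum>T1\<in>index_sets. \<Sum>T2\<in>index_sets. \<Sum>T3\<in>index_sets. \<Sum>T4\<in>index_sets.
        g T4 y * (g T3 y * (g T2 y * g T1 y)))"
      unfolding F_def sum_product sum_distrib_left sum_distrib_right
      by (intro sum.cong refl)
    finally show ?thesis by (simp add: sum.cartesian_product mult_ac)
  qed
  have "cond {} (\<lambda>y. F y ^ 4) x
      = (\<Sum>(T1, T2, T3, T4)\<in>?N. cond {} (\<lambda>y. (g T1 y * g T2 y) * (g T3 y * g T4 y)) x)"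
    unfolding F4 cond_sum by (intro sum.cong refl) (auto simp: case_prod_unfold)
  also have "\<dots> \<le> (\<Sum>(T1, T2, T3, T4)\<in>?N. 2 * K x * r ^ card (T1 \<union> T2 \<union> T3 \<union> T4))"
    using assms by (intro sum_mono) (auto intro!: cond_quadruple_le_K)
  also have "\<dots> = 2 * K x * (\<Sum>(T1, T2, T3, T4)\<in>?N. r ^ card (T1 \<union> T2 \<union> T3 \<union> T4))"
    by (simp add: sum_distrib_left case_prod_unfold)
  also have "\<dots> \<le> 2 * K x * exp (16 * r * card {..<k})"
    using r_nonneg K_nonneg assms
    by (intro mult_left_mono sum_quadruples_power_card_Union_le) (auto simp: index_sets_def)
  also have "16 * r * card {..<k} = 16 * real i" using assms(1) i_le by (simp add: r_def)
  finally show ?thesis .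
qed

text \<open>The diagonal approximation is summed over at most 2^k index sets. The error 2^(4 k)
  \<kappa> is generously covered by \<delta>.\<close>

lemma cond_phi_F_mass_close:
  assumes "x \<in> \<Omega>"
  shows "\<bar>cond {} (\<lambda>y. \<phi> y * F y) x - level_mass x\<bar> \<le> \<delta> * cond {} \<phi> x"
proof -
  let ?c = "cond {} \<phi> x"
  have "cond {} (\<lambda>y. \<phi> y * F y) x - level_mass x
      = (\<Sum>T\<in>index_sets. cond {} (\<lambda>y. \<phi> y * g T y) x - cond {} (\<lambda>y. (g T y)\<^sup>2) x)"
    unfolding F_def level_mass_def sum_distrib_left cond_sum sum_subtractf ..
  also have "\<bar>\<dots>\<bar> \<le> (\<Sum>T\<in>index_sets. 8 ^ k * \<kappa> * ?c)"
    using assms index_setsD by (intro order_trans[OF sum_abs] sum_mono cond_phi_level_close) auto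
  also have "\<dots> = (k choose i) * (8 ^ k * \<kappa> * ?c)" by (simp add: card_index_sets)
  also have "\<dots> \<le> 2 ^ k * (8 ^ k * \<kappa> * ?c)"
  proof (rule mult_right_mono)
    show "real (k choose i) \<le> 2 ^ k"
      using binomial_le_pow2[of k i] by (metis of_nat_le_iff of_nat_numeral of_nat_power)
  qed (use kappa_nonneg cond_phi_nonneg assms in auto)
  also have "\<dots> = 2 ^ (4 * k) * (\<kappa> * ?c)" by (simp add: power_mult power_mult_distrib[symmetric])
  also have "\<dots> \<le> 2 ^ (11 * k) * (\<kappa> * ?c)"
    using kappa_nonneg cond_phi_nonneg assms by (intro mult_right_mono power_increasing) auto
  also have "\<dots> \<le> \<delta> * ?c"
    using kappa_nonneg cond_phi_nonneg assms by (simp add: \<delta>_def mult.assoc)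
  finally show ?thesis .
qed

text \<open>Hoelder with exponents 4/3 and 4, realised as two applications of Cauchy-Schwarz; each
  spends a spare factor \<phi>, available because \<phi> is its own square.\<close>

lemma cond_phi_F_pow4_le:
  assumes "x \<in> \<Omega>"
  shows "cond {} (\<lambda>y. \<phi> y * F y) x ^ 4 \<le> cond {} \<phi> x ^ 3 * cond {} (\<lambda>y. F y ^ 4) x"
proof -
  let ?c = "cond {} \<phi> x" and ?a = "cond {} (\<lambda>y. \<phi> y * F y) x" and ?b = "cond {} (\<lambda>y. \<phi> y * (F y)\<^sup>2) x"
  have phi: "\<phi> y * \<phi> y = \<phi> y" if "y \<in> \<Omega>" for y using phi_boolean[OF that] by auto
  have CS: "(cond {} (\<lambda>y. \<phi> y * h y) x)\<^sup>2 \<le> ?c * cond {} (\<lambda>y. (h y)\<^sup>2) x" for h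
  proof -
    have "\<bar>cond {} (\<lambda>y. \<phi> y * h y) x\<bar>\<^sup>2 \<le> (cnorm {} x \<phi> * cnorm {} x h)\<^sup>2"
      using cond_Cauchy_Schwarz[OF assms] by (intro power_mono) auto
    then show ?thesis by (simp add: power_mult_distrib cnorm_sq[OF assms] cond_phi_sq)
  qed
  have "?a = cond {} (\<lambda>y. \<phi> y * (\<phi> y * F y)) x"
    using phi by (intro cond_cong) (simp add: mult.assoc[symmetric] fiber_in)
  moreover have "cond {} (\<lambda>y. (\<phi> y * F y)\<^sup>2) x = ?b"
    by (rule cond_cong) (metis phi fiber_in power_mult_distrib power2_eq_square)
  ultimately have a: "?a\<^sup>2 \<le> ?c * ?b" using CS[of "\<lambda>y. \<phi> y * F y"] by simp
  have b: "?b\<^sup>2 \<le> ?c * cond {} (\<lambda>y. F y ^ 4) x"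
    using CS[of "\<lambda>y. (F y)\<^sup>2"] by (simp add: power_mult[symmetric])
  have "?a ^ 4 = (?a\<^sup>2)\<^sup>2" by (simp add: power_mult[symmetric])
  also have "\<dots> \<le> (?c * ?b)\<^sup>2" using a by (intro power_mono) auto
  also have "\<dots> = ?c\<^sup>2 * ?b\<^sup>2" by (rule power_mult_distrib)
  also have "\<dots> \<le> ?c\<^sup>2 * (?c * cond {} (\<lambda>y. F y ^ 4) x)" using b by (intro mult_left_mono) auto
  finally show ?thesis by (simp add: power2_eq_square power3_eq_cube)
qed

theorem level_inequality:
  assumes small: "4 * 2 ^ (12 * k) * \<kappa> \<le> 1" and x: "x \<in> \<Omega>"
  shows "cond {} (\<lambda>y. \<phi> y * F y) x \<le> 2 powr (13 * real i) * \<epsilon> powr (1 / 3) * cond {} \<phi> x"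
proof -
  let ?c = "cond {} \<phi> x" and ?a = "cond {} (\<lambda>y. \<phi> y * F y) x"
  define e where "e = \<epsilon> powr (1 / 3)"
  have c: "0 \<le> ?c" using cond_phi_nonneg x by blast
  have e: "0 \<le> e" "e ^ 3 = \<epsilon>" using eps_nonneg by (simp_all add: e_def powr_powr flip: powr_numeral)
  have two: "2 powr (13 * real i) = 2 ^ (13 * i)" by (simp add: powr_realpow[symmetric])
  have goal: ?thesis if "?a \<le> 2 ^ (13 * i) * e * ?c" using that by (simp add: two e_def)
  show ?thesis
  \<comment> \<open>If this holds, the pointwise bound is enough. If it fails, \<epsilon> cannot be
    small compared with 8^(-k), so the spectral errors can be absorbed.\<close>
  proof (cases "(k choose i) * 2 ^ i * \<epsilon> \<le> e")
    case True
    have "?a \<le> (k choose i) * 2 ^ i * \<epsilon> * ?c" using x by (rule cond_phi_F_small)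
    also have "\<dots> \<le> 1 * e * ?c" using True c by (intro mult_right_mono) auto
    also have "\<dots> \<le> 2 ^ (13 * i) * e * ?c" using e c by (intro mult_right_mono) auto
    finally show ?thesis by (rule goal)
  next
    case False
    \<comment> \<open>For i = 0 the failed inequality would say that \<epsilon> exceeds its own cube
      root, impossible for \<epsilon> \<le> 1.\<close>
    have i: "1 \<le> i"
    proof (rule ccontr)
      assume "\<not> 1 \<le> i"
      then have "i = 0" by simp
      then have "e < e ^ 3" using False e by simp
      moreover have "e \<le> 1" using eps_nonneg eps_le_1 by (simp add: e_def powr_le1)
      then have "e ^ 3 \<le> e ^ 1" using e by (intro power_decreasing) auto
      ultimately show False by simp
    qed
    have "e < 4 ^ k * e ^ 3"
    proof -
      have "real (k choose i) \<le> 2 ^ k"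
        using binomial_le_pow2[of k i] by (metis of_nat_le_iff of_nat_numeral of_nat_power)
      then have "real (k choose i) * 2 ^ i * \<epsilon> \<le> 2 ^ k * 2 ^ k * \<epsilon>"
        using i_le eps_nonneg by (intro mult_right_mono mult_mono power_increasing) auto
      then show ?thesis using False e by (simp add: power_mult_distrib[symmetric])
    qed
    then have "0 < e" using e by (cases "e = 0") auto
    then have "1 < 4 ^ k * e ^ 2" using \<open>e < 4 ^ k * e ^ 3\<close>
      by (simp add: power2_eq_square power3_eq_cube)
    also have "\<dots> = (2 ^ k * e)\<^sup>2" by (simp add: power_mult_distrib power_mult[symmetric] mult.commute[of k]) (simp add: power_mult)
    finally have e2: "1 \<le> 2 ^ k * e"
      using \<open>0 < e\<close> by (smt (verit) power2_le_imp_le one_power2 zero_le_mult_iff zero_le_power)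
    then have "1 \<le> (2 ^ k * e) ^ 3" by (rule one_le_power)
    also have "\<dots> = 8 ^ k * \<epsilon>"
      by (simp add: power_mult_distrib e(2) power_mult[symmetric] mult.commute[of k]) (simp add: power_mult)
    finally have eps: "1 \<le> 8 ^ k * \<epsilon>" .
    \<comment> \<open>The exponent 12 in \<open>small\<close> is the 11 of \<delta> plus one more k,
      spent on 2^k e \<ge> 1.\<close>
    have d: "2 * \<delta> \<le> e"
    proof -
      have "2 ^ k * (2 * \<delta>) = 4 * 2 ^ (12 * k) * \<kappa>"
      proof -
        have "12 * k = k + 11 * k" by simp
        then have "(2 :: real) ^ (12 * k) = 2 ^ k * 2 ^ (11 * k)" by (simp only: power_add)
        then show ?thesis by (simp add: \<delta>_def)
      qed
      also have "\<dots> \<le> 2 ^ k * e" using small e2 by simp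
      finally show ?thesis by simp
    qed
    have close: "\<bar>?a - level_mass x\<bar> \<le> \<delta> * ?c" by (rule cond_phi_F_mass_close[OF x])
    show ?thesis
    \<comment> \<open>Either the pairing is itself of the size of the error, or it dominates the
      error and is comparable with the mass.\<close>
    proof (cases "?a \<le> 2 * \<delta> * ?c")
      case True
      then have "?a \<le> 2 * \<delta> * ?c" .
      also have "\<dots> \<le> 1 * e * ?c" using d c by (intro mult_right_mono) auto
      also have "\<dots> \<le> 2 ^ (13 * i) * e * ?c" using e c by (intro mult_right_mono) auto
      finally show ?thesis by (rule goal)
    next
      case False
      have dc: "0 \<le> \<delta> * ?c" using delta_nonneg c by simp
      then have apos: "0 < ?a" using False by linarith
      have mass: "level_mass x + \<delta> * ?c \<le> 2 * ?a" using close False by (auto simp: abs_le_iff)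
      have "?a ^ 4 \<le> ?c ^ 3 * (2 * K x * exp (16 * real i))"
        using cond_phi_F_pow4_le[OF x] fourth_moment_le[OF i eps x] c
        by (meson mult_left_mono order_trans zero_le_power)
      also have "\<dots> \<le> ?c ^ 3 * (2 * (2 * 4 ^ i * \<epsilon> * (2 * ?a)) * exp (16 * real i))"
        unfolding K_def using mass c eps_nonneg by (intro mult_left_mono mult_right_mono) auto
      also have "\<dots> = (8 * 4 ^ i * exp (16 * real i) * \<epsilon> * ?c ^ 3) * ?a" by simp
      \<comment> \<open>The mass in the fourth-moment bound was replaced by a multiple of
        \<open>?a\<close>. Cancelling one factor leaves a cube, which is where the exponent 1/3
        comes from.\<close>
      finally have "?a ^ 3 * ?a \<le> (8 * 4 ^ i * exp (16 * real i) * \<epsilon> * ?c ^ 3) * ?a"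
        by (simp add: power4_eq_xxxx power3_eq_cube)
      then have "?a ^ 3 \<le> 8 * 4 ^ i * exp (16 * real i) * \<epsilon> * ?c ^ 3"
        using apos by (simp only: mult_le_cancel_right_pos)
      \<comment> \<open>Using e \<le> 4 and 8 \<le> 8^i, the constant is at most 2^(37 i); rounding
        up to 39 = 3 * 13 makes it a cube.\<close>
      also have "\<dots> \<le> 2 ^ (39 * i) * \<epsilon> * ?c ^ 3"
      proof (intro mult_right_mono)
        have "exp (16 * real i) = exp 1 ^ (16 * i)" by (simp add: exp_of_nat_mult[symmetric])
        also have "\<dots> \<le> 4 ^ (16 * i)" using exp_le by (intro power_mono) auto
        finally have "8 * 4 ^ i * exp (16 * real i) \<le> 8 ^ i * 4 ^ i * 4 ^ (16 * i)"
          using i by (intro mult_mono) (auto simp: self_le_power)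
        also have "\<dots> = (8 * 4 * 4 ^ 16) ^ i" by (simp only: power_mult power_mult_distrib)
        also have "\<dots> \<le> (2 ^ 39) ^ i" by (intro power_mono) auto
        finally show "8 * 4 ^ i * exp (16 * real i) \<le> 2 ^ (39 * i)" by (simp only: power_mult)
      qed (use eps_nonneg c in auto)
      also have "\<dots> = (2 ^ (13 * i) * e * ?c) ^ 3"
      proof -
        have "(2 ^ (13 * i)) ^ 3 = (2 :: real) ^ (39 * i)" by (simp add: power_mult[symmetric])
        then show ?thesis by (simp only: power_mult_distrib e(2))
      qed
      finally have "?a \<le> 2 ^ (13 * i) * e * ?c"
        using e c by (rule_tac power_le_imp_le_base[of _ 2]) (auto simp: numeral_3_eq_3)
      then show ?thesis by (rule goal)
    qed
  qed
qed

end

section \<open>Weighted complexes and random orderings\<close>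

text \<open>For total weight 1 this is the probability that a random top face contains s. It
  vanishes off the faces, so sums over cofaces can run over all further vertices.\<close>

definition star_weight :: "'a weighted_complex \<Rightarrow> 'a set \<Rightarrow> real" where
  "star_weight X s = (\<Sum>t\<in>{t \<in> top_faces X. s \<subseteq> t}. top_weight X t)"

text \<open>Only what passes to links is kept: the link of a face of weight 0 has total weight 0
  instead of 1. The vertex set \<open>W\<close> stays the same for all links.\<close>

definition pure_on :: "'a set \<Rightarrow> 'a weighted_complex \<Rightarrow> bool" where
  "pure_on W X \<longleftrightarrow> finite W \<and> (\<forall>t\<in>top_faces X. t \<subseteq> W \<and> card t = cdim X \<and> 0 \<le> top_weight X t)"

lemma pure_onD:
  assumes "pure_on W X"
  shows "finite W" "finite (top_faces X)" "t \<in> top_faces X \<Longrightarrow> t \<subseteq> W"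
    "t \<in> top_faces X \<Longrightarrow> finite t" "t \<in> top_faces X \<Longrightarrow> card t = cdim X"
    "t \<in> top_faces X \<Longrightarrow> 0 \<le> top_weight X t"
proof -
  show W: "finite W" using assms by (simp add: pure_on_def)
  have "top_faces X \<subseteq> Pow W" using assms by (auto simp: pure_on_def)
  then show "finite (top_faces X)" using W by (simp add: finite_subset)
  show "t \<in> top_faces X \<Longrightarrow> finite t" using assms W finite_subset[of t W] by (auto simp: pure_on_def)
qed (use assms in \<open>auto simp: pure_on_def\<close>)

lemma star_weight_nonneg: "pure_on W X \<Longrightarrow> 0 \<le> star_weight X s"
  unfolding star_weight_def by (intro sum_nonneg) (auto dest: pure_onD)

lemma star_weight_mono:
  assumes "pure_on W X" "s \<subseteq> s'"
  shows "star_weight X s' \<le> star_weight X s"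
  unfolding star_weight_def using assms by (intro sum_mono2) (auto dest: pure_onD)

lemma star_weight_eq_0:
  assumes "finite s" "s \<notin> faces X (card s)"
  shows "star_weight X s = 0"
proof -
  have "{t \<in> top_faces X. s \<subseteq> t} = {}" using assms by (auto simp: faces_def)
  then show ?thesis by (simp only: star_weight_def sum.empty)
qed

lemma facesD:
  assumes "pure_on W X" "s \<in> faces X i"
  shows "finite s" "card s = i" "s \<subseteq> W" "i \<le> cdim X"
proof -
  obtain t where t: "t \<in> top_faces X" "s \<subseteq> t" using assms by (auto simp: faces_def)
  show "finite s" "card s = i" using assms by (auto simp: faces_def)
  show "s \<subseteq> W" using t assms pure_onD(3) by blast
  show "i \<le> cdim X"
    using card_mono[OF _ t(2)] t assms pure_onD(4,5) \<open>card s = i\<close> by metis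
qed

lemma faces_finite: "pure_on W X \<Longrightarrow> finite (faces X i)"
  by (rule finite_subset[of _ "Pow W"]) (auto dest: facesD pure_onD(1))

lemma faces_subset: "s \<in> faces X i \<Longrightarrow> s' \<subseteq> s \<Longrightarrow> s' \<in> faces X (card s')"
  unfolding faces_def by (auto intro: finite_subset)

text \<open>Double counting: every top face containing s is reached through each of its
  \<open>cdim X - card s\<close> further vertices.\<close>

lemma sum_star_weight_insert:
  assumes "pure_on W X" "finite s"
  shows "(\<Sum>v\<in>W - s. star_weight X (insert v s)) = real (cdim X - card s) * star_weight X s"
proof -
  note X = pure_onD[OF assms(1)]
  have "(\<Sum>v\<in>W - s. star_weight X (insert v s))
      = (\<Sum>t\<in>top_faces X. \<Sum>v\<in>{v \<in> W - s. insert v s \<subseteq> t}. top_weight X t)"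
    unfolding star_weight_def using X by (intro sum.swap_restrict) auto
  also have "\<dots> = (\<Sum>t\<in>top_faces X. if s \<subseteq> t then real (cdim X - card s) * top_weight X t else 0)"
  proof (rule sum.cong[OF refl])
    fix t assume t: "t \<in> top_faces X"
    show "(\<Sum>v\<in>{v \<in> W - s. insert v s \<subseteq> t}. top_weight X t)
        = (if s \<subseteq> t then real (cdim X - card s) * top_weight X t else 0)"
    proof (cases "s \<subseteq> t")
      case True
      then have "{v \<in> W - s. insert v s \<subseteq> t} = t - s" using X(3)[OF t] by auto
      moreover have "card (t - s) = cdim X - card s"
        using True X(5)[OF t] assms(2) by (simp add: card_Diff_subset)
      ultimately show ?thesis using True by simp
    qed auto
  qed
  also have "\<dots> = real (cdim X - card s) * star_weight X s"
    unfolding star_weight_def sum_distrib_left using X(2) by (simp add: sum.inter_filter)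
  finally show ?thesis .
qed

lemma sum_cofaces:
  fixes H :: "'a set \<Rightarrow> real"
  assumes "pure_on W X" "finite s" "card s = i"
  shows "(\<Sum>y\<in>{y \<in> faces X (Suc i). s \<subset> y}. star_weight X y * H y)
    = (\<Sum>v\<in>W - s. star_weight X (insert v s) * H (insert v s))"
proof -
  let ?V = "{v \<in> W - s. insert v s \<in> faces X (Suc i)}"
  have fin: "finite W" using assms pure_onD by blast
  have img: "{y \<in> faces X (Suc i). s \<subset> y} = (\<lambda>v. insert v s) ` ?V"
  proof (intro equalityI subsetI)
    fix y assume y: "y \<in> {y \<in> faces X (Suc i). s \<subset> y}"
    then have y': "finite y" "card y = Suc i" "y \<subseteq> W" using facesD[OF assms(1), of y "Suc i"] by auto
    then have "card (y - s) = 1" using y assms by (simp add: card_Diff_subset psubset_imp_subset)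
    then obtain v where "y - s = {v}" using card_1_singletonE by blast
    then have "y = insert v s" "v \<notin> s" "v \<in> W" using y y' by auto
    then show "y \<in> (\<lambda>v. insert v s) ` ?V" using y by auto
  qed auto
  have inj: "inj_on (\<lambda>v. insert v s) ?V" by (auto simp: inj_on_def)
  have "(\<Sum>y\<in>{y \<in> faces X (Suc i). s \<subset> y}. star_weight X y * H y)
      = (\<Sum>v\<in>?V. star_weight X (insert v s) * H (insert v s))"
    unfolding img using inj by (simp add: sum.reindex)
  also have "\<dots> = (\<Sum>v\<in>W - s. star_weight X (insert v s) * H (insert v s))"
  proof (rule sum.mono_neutral_left)
    show "\<forall>v\<in>W - s - ?V. star_weight X (insert v s) * H (insert v s) = 0"
    proof
      fix v assume v: "v \<in> W - s - ?V"
      then have "star_weight X (insert v s) = 0" using assms by (intro star_weight_eq_0) auto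
      then show "star_weight X (insert v s) * H (insert v s) = 0" by simp
    qed
  qed (use fin in auto)
  finally show ?thesis .
qed

text \<open>Induction downwards from the top level by double counting and (i+1) (d choose i+1) =
  (d-i) (d choose i), with d the dimension.\<close>

lemma level_weight_eq:
  assumes "pure_on W X" "i \<le> cdim X" "s \<in> faces X i"
  shows "level_weight X i s = star_weight X s / real (cdim X choose i)"
  using assms(2,3)
proof (induction i arbitrary: s rule: inc_induct)
  case base
  note s = facesD[OF assms(1) base]
  obtain t where t: "t \<in> top_faces X" "s \<subseteq> t" using base by (auto simp: faces_def)
  have "{t \<in> top_faces X. s \<subseteq> t} = {s}"
  proof -
    have "t' = s" if "t' \<in> top_faces X" "s \<subseteq> t'" for t'
      using that s pure_onD(4,5)[OF assms(1) that(1)] by (metis card_subset_eq)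
    then show ?thesis using t by auto
  qed
  then show ?case by (simp add: level_weight.simps star_weight_def)
next
  case (step i)
  note s = facesD[OF assms(1) step.prems]
  have i: "i < cdim X" using step.hyps by simp
  have "level_weight X i s = 1 / real (i + 1) * (\<Sum>y\<in>{y \<in> faces X (i + 1). s \<subset> y}. level_weight X (i + 1) y)"
    using i by (subst level_weight.simps) simp
  also have "(\<Sum>y\<in>{y \<in> faces X (i + 1). s \<subset> y}. level_weight X (i + 1) y)
      = (\<Sum>y\<in>{y \<in> faces X (Suc i). s \<subset> y}. star_weight X y * (1 / real (cdim X choose Suc i)))"
    using step.IH by (intro sum.cong) auto
  also have "\<dots> = (\<Sum>v\<in>W - s. star_weight X (insert v s) * (1 / real (cdim X choose Suc i)))"
    using s by (intro sum_cofaces[OF assms(1)])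
  also have "\<dots> = real (cdim X - i) * star_weight X s / real (cdim X choose Suc i)"
    using sum_star_weight_insert[OF assms(1) s(1)] s(2) by (simp add: sum_divide_distrib[symmetric])
  finally have "level_weight X i s = real (cdim X - i) * star_weight X s / (real (Suc i) * real (cdim X choose Suc i))"
    by simp
  also have "real (Suc i) * real (cdim X choose Suc i) = real (cdim X - i) * real (cdim X choose i)"
    using binomial_absorption[of i "cdim X"] binomial_absorb_comp[of "cdim X" i] by (metis of_nat_mult)
  finally show ?case using i by simp
qed

section \<open>Averages and the operators D and U through star weights\<close>

lemma sum_level_cofaces:
  assumes "pure_on W X" "finite s" "card s = i" "Suc i \<le> cdim X"
  shows "(\<Sum>y\<in>{y \<in> faces X (Suc i). s \<subset> y}. level_weight X (Suc i) y * H y)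
    = (\<Sum>v\<in>W - s. star_weight X (insert v s) * H (insert v s)) / real (cdim X choose Suc i)"
proof -
  have "(\<Sum>y\<in>{y \<in> faces X (Suc i). s \<subset> y}. level_weight X (Suc i) y * H y)
      = (\<Sum>y\<in>{y \<in> faces X (Suc i). s \<subset> y}. star_weight X y * (H y / real (cdim X choose Suc i)))"
    using assms by (intro sum.cong refl) (simp add: level_weight_eq)
  also have "\<dots> = (\<Sum>v\<in>W - s. star_weight X (insert v s) * (H (insert v s) / real (cdim X choose Suc i)))"
    using assms by (intro sum_cofaces)
  finally show ?thesis by (simp add: sum_divide_distrib)
qed

lemma level_average_eq:
  assumes "pure_on W X" "finite s" "card s = i" "Suc i \<le> cdim X"
  shows "(\<Sum>y\<in>{y \<in> faces X (Suc i). s \<subset> y}. level_weight X (Suc i) y * H y)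
      / (\<Sum>y\<in>{y \<in> faces X (Suc i). s \<subset> y}. level_weight X (Suc i) y)
    = (\<Sum>v\<in>W - s. star_weight X (insert v s) * H (insert v s)) / (\<Sum>v\<in>W - s. star_weight X (insert v s))"
  using sum_level_cofaces[OF assms, of H] sum_level_cofaces[OF assms, of "\<lambda>_. 1"] assms(4)
  by simp

lemma down_op_eq:
  assumes "pure_on W X" "finite s" "card s = i" "Suc i \<le> cdim X"
  shows "down_op X (Suc i) f s
    = (\<Sum>v\<in>W - s. star_weight X (insert v s) * f (insert v s)) / (\<Sum>v\<in>W - s. star_weight X (insert v s))"
  unfolding down_op_def by (rule level_average_eq[OF assms])

lemma walk_op_eq:
  assumes "pure_on W X" "2 \<le> cdim X"
  shows "walk_op X h {u}
    = (\<Sum>v\<in>W - {u}. star_weight X {v, u} * h {v}) / (\<Sum>v\<in>W - {u}. star_weight X {v, u})"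
proof -
  have "walk_op X h {u} = (\<Sum>v\<in>W - {u}. star_weight X {v, u} * h ({v, u} - {u})) / (\<Sum>v\<in>W - {u}. star_weight X {v, u})"
    unfolding walk_op_def
    using level_average_eq[OF assms(1), of "{u}" 1 "\<lambda>e. h (e - {u})"] assms(2) by (simp add: numeral_2_eq_2)
  moreover have "(\<Sum>v\<in>W - {u}. star_weight X {v, u} * h ({v, u} - {u})) = (\<Sum>v\<in>W - {u}. star_weight X {v, u} * h {v})"
  proof (rule sum.cong[OF refl])
    fix v assume "v \<in> W - {u}"
    then have "{v, u} - {u} = {v}" by auto
    then show "star_weight X {v, u} * h ({v, u} - {u}) = star_weight X {v, u} * h {v}" by simp
  qed
  ultimately show ?thesis by simp
qed

lemma expect_at_0:
  assumes "weighted_pure_complex n d X"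
  shows "expect_at X 0 f = f {}"
proof -
  have X: "pure_on {1..n} X" "sum (top_weight X) (top_faces X) = 1" "top_faces X \<noteq> {}"
    using assms by (auto simp: weighted_pure_complex_def pure_on_def)
  have "{} \<in> faces X 0" using X(3) by (auto simp: faces_def)
  then have 0: "level_weight X 0 {} = 1"
    using level_weight_eq[OF X(1), of 0 "{}"] X(2) by (simp add: star_weight_def)
  have "faces X 0 = {{}}" using X(3) by (auto simp: faces_def)
  then show ?thesis using 0 by (simp add: expect_at_def)
qed

lemma level_weight_nonneg:
  "pure_on W X \<Longrightarrow> s \<in> faces X i \<Longrightarrow> 0 \<le> level_weight X i s"
  using facesD(4)[of W X s i] by (simp add: level_weight_eq star_weight_nonneg)

text \<open>The denominator of \<open>down_op\<close> is i + 1 times the weight of the lower face,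
  and each (i+1)-face has i + 1 facets, so the factors cancel.\<close>

lemma expect_at_down_op:
  assumes "pure_on W X" "Suc i \<le> cdim X"
  shows "expect_at X i (down_op X (Suc i) f) = expect_at X (Suc i) f"
proof -
  let ?C = "\<lambda>s. {y \<in> faces X (Suc i). s \<subset> y}"
  have fin: "finite (faces X i)" "finite (faces X (Suc i))" using assms faces_finite by blast+
  have "level_weight X i s * down_op X (Suc i) f s
      = 1 / real (i + 1) * (\<Sum>y\<in>?C s. level_weight X (Suc i) y * f y)" if s: "s \<in> faces X i" for s
  proof -
    let ?D = "\<Sum>y\<in>?C s. level_weight X (Suc i) y"
    have lw: "level_weight X i s = 1 / real (i + 1) * ?D"
      using assms(2) by (subst level_weight.simps) simp
    show ?thesis
    proof (cases "?D = 0")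
      \<comment> \<open>If all cofaces have weight 0, the weight of s is 0 too, and both sides
        vanish.\<close>
      case True
      then have "level_weight X (Suc i) y = 0" if "y \<in> ?C s" for y
        using that sum_nonneg_eq_0_iff[of "?C s" "level_weight X (Suc i)"] fin
          level_weight_nonneg[OF assms(1)] by auto
      then have "(\<Sum>y\<in>?C s. level_weight X (Suc i) y * f y) = 0" by (intro sum.neutral) auto
      then show ?thesis using True by (simp add: lw)
    next
      case False
      then show ?thesis unfolding lw down_op_def by simp
    qed
  qed
  then have "expect_at X i (down_op X (Suc i) f)
      = 1 / real (i + 1) * (\<Sum>s\<in>faces X i. \<Sum>y\<in>?C s. level_weight X (Suc i) y * f y)"
    unfolding expect_at_def sum_distrib_left by (intro sum.cong) auto
  also have "(\<Sum>s\<in>faces X i. \<Sum>y\<in>?C s. level_weight X (Suc i) y * f y)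
      = (\<Sum>y\<in>faces X (Suc i). \<Sum>s\<in>{s \<in> faces X i. s \<subset> y}. level_weight X (Suc i) y * f y)"
    using fin by (intro sum.swap_restrict)
  also have "\<dots> = (\<Sum>y\<in>faces X (Suc i). real (i + 1) * (level_weight X (Suc i) y * f y))"
  proof (rule sum.cong[OF refl])
    fix y assume y: "y \<in> faces X (Suc i)"
    have "s \<in> faces X i \<and> s \<subset> y \<longleftrightarrow> s \<subseteq> y \<and> card s = i" for s
    proof
      assume "s \<subseteq> y \<and> card s = i"
      moreover from this have "s \<noteq> y" using facesD(2)[OF assms(1) y] by auto
      ultimately show "s \<in> faces X i \<and> s \<subset> y" using faces_subset[OF y, of s] by blast
    qed (auto simp: faces_def)
    then have "{s \<in> faces X i. s \<subset> y} = {s. s \<subseteq> y \<and> card s = i}" by simp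
    then have "card {s \<in> faces X i. s \<subset> y} = Suc i"
      using facesD[OF assms(1) y] by (simp add: n_subsets)
    then show "(\<Sum>s\<in>{s \<in> faces X i. s \<subset> y}. level_weight X (Suc i) y * f y)
        = real (i + 1) * (level_weight X (Suc i) y * f y)" by simp
  qed
  finally show ?thesis by (simp add: expect_at_def sum_distrib_left[symmetric])
qed

lemma up_op_eq:
  assumes "\<tau> \<in> faces X (Suc i)"
  shows "up_op X i f \<tau> = (\<Sum>v\<in>\<tau>. f (\<tau> - {v})) / real (Suc i)"
proof -
  have fin: "finite \<tau>" "card \<tau> = Suc i" using assms by (auto simp: faces_def)
  have img: "{\<sigma> \<in> faces X i. \<sigma> \<subset> \<tau>} = (\<lambda>v. \<tau> - {v}) ` \<tau>"
  proof (intro equalityI subsetI)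
    fix \<sigma> assume s: "\<sigma> \<in> {\<sigma> \<in> faces X i. \<sigma> \<subset> \<tau>}"
    then have "card (\<tau> - \<sigma>) = 1" using fin by (simp add: faces_def card_Diff_subset psubset_imp_subset)
    then obtain v where "\<tau> - \<sigma> = {v}" using card_1_singletonE by blast
    then have "\<sigma> = \<tau> - {v}" "v \<in> \<tau>" using s by auto
    then show "\<sigma> \<in> (\<lambda>v. \<tau> - {v}) ` \<tau>" by auto
  next
    fix \<sigma> assume "\<sigma> \<in> (\<lambda>v. \<tau> - {v}) ` \<tau>"
    then obtain v where v: "v \<in> \<tau>" "\<sigma> = \<tau> - {v}" by auto
    then show "\<sigma> \<in> {\<sigma> \<in> faces X i. \<sigma> \<subset> \<tau>}"
      using faces_subset[OF assms, of \<sigma>] fin by auto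
  qed
  have "inj_on (\<lambda>v. \<tau> - {v}) \<tau>" by (auto simp: inj_on_def)
  then show ?thesis unfolding up_op_def img by (simp add: sum.reindex)
qed

text \<open>Iterated U averages over all j-subsets, so the binomial factor turns it into a plain
  sum. In the induction each j-subset S of an (i+1)-face survives the removal of i + 1 - j
  vertices.\<close>

lemma up_iter_eq:
  assumes "\<tau> \<in> faces X i" "j \<le> i"
  shows "real (i choose j) * up_iter X i j f \<tau> = (\<Sum>S\<in>{S. S \<subseteq> \<tau> \<and> card S = j}. f S)"
  using assms
proof (induction i arbitrary: \<tau>)
  case 0
  then have "{S. S \<subseteq> \<tau> \<and> card S = j} = {\<tau>}" by (auto simp: faces_def)
  then show ?case using 0 by simp
next
  case (Suc i)
  have fin: "finite \<tau>" "card \<tau> = Suc i" using Suc.prems by (auto simp: faces_def)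
  show ?case
  proof (cases "j = Suc i")
    case True
    have "{S. S \<subseteq> \<tau> \<and> card S = j} = {\<tau>}"
      using True fin card_subset_eq[OF fin(1)] by auto
    then show ?thesis using True by simp
  next
    case False
    then have j: "j \<le> i" using Suc.prems by simp
    let ?P = "\<lambda>\<tau>. {S. S \<subseteq> \<tau> \<and> card S = j}"
    have "real (i choose j) * (\<Sum>v\<in>\<tau>. up_iter X i j f (\<tau> - {v})) = (\<Sum>v\<in>\<tau>. \<Sum>S\<in>{S \<in> ?P \<tau>. v \<notin> S}. f S)"
      unfolding sum_distrib_left
    proof (intro sum.cong refl)
      fix v assume v: "v \<in> \<tau>"
      then have "\<tau> - {v} \<in> faces X i" using faces_subset[OF Suc.prems(1), of "\<tau> - {v}"] fin by simp
      moreover have "?P (\<tau> - {v}) = {S \<in> ?P \<tau>. v \<notin> S}" by auto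
      ultimately show "real (i choose j) * up_iter X i j f (\<tau> - {v}) = (\<Sum>S\<in>{S \<in> ?P \<tau>. v \<notin> S}. f S)"
        using Suc.IH j by simp
    qed
    also have "\<dots> = (\<Sum>S\<in>?P \<tau>. \<Sum>v\<in>{v \<in> \<tau>. v \<notin> S}. f S)"
      using fin by (intro sum.swap_restrict) auto
    also have "\<dots> = (\<Sum>S\<in>?P \<tau>. real (Suc i - j) * f S)"
    proof (intro sum.cong refl)
      fix S assume S: "S \<in> ?P \<tau>"
      have "{v \<in> \<tau>. v \<notin> S} = \<tau> - S" by auto
      then have "card {v \<in> \<tau>. v \<notin> S} = Suc i - j"
        using S fin finite_subset[of S \<tau>] by (simp add: card_Diff_subset)
      then show "(\<Sum>v\<in>{v \<in> \<tau>. v \<notin> S}. f S) = real (Suc i - j) * f S" by simp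
    qed
    finally have sum: "real (i choose j) * (\<Sum>v\<in>\<tau>. up_iter X i j f (\<tau> - {v})) = real (Suc i - j) * (\<Sum>S\<in>?P \<tau>. f S)"
      by (simp add: sum_distrib_left)
    have up: "up_iter X (Suc i) j f \<tau> = (\<Sum>v\<in>\<tau>. up_iter X i j f (\<tau> - {v})) / real (Suc i)"
      using j Suc.prems by (simp add: up_op_eq)
    have choose: "real (Suc i - j) * real (Suc i choose j) = real (Suc i) * real (i choose j)"
      using binomial_absorb_comp[of "Suc i" j] by (metis diff_Suc_1 of_nat_mult)
    have "real (Suc i - j) * (real (Suc i choose j) * up_iter X (Suc i) j f \<tau>)
        = (real (Suc i) * real (i choose j)) * ((\<Sum>v\<in>\<tau>. up_iter X i j f (\<tau> - {v})) / real (Suc i))"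
      by (simp only: mult.assoc[symmetric] choose up)
    also have "\<dots> = real (i choose j) * (\<Sum>v\<in>\<tau>. up_iter X i j f (\<tau> - {v}))"
      by (simp del: of_nat_Suc)
    also note sum
    finally have "real (Suc i - j) * (real (Suc i choose j) * up_iter X (Suc i) j f \<tau>)
        = real (Suc i - j) * (\<Sum>S\<in>?P \<tau>. f S)" .
    moreover have "real (Suc i - j) \<noteq> 0" using j by simp
    ultimately show ?thesis by (metis mult_left_cancel)
  qed
qed

section \<open>Links\<close>

lemma pure_on_link:
  assumes "pure_on W X" "finite s" "s \<subseteq> W"
  shows "pure_on W (link X s)"
proof -
  have "card (t - s) = cdim X - card s" if "t \<in> top_faces X" "s \<subseteq> t" for t
    using that pure_onD(5)[OF assms(1)] assms(2) by (simp add: card_Diff_subset)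
  then show ?thesis
    using assms pure_onD[OF assms(1)] star_weight_nonneg[OF assms(1), of s]
    by (auto simp: pure_on_def link_def star_weight_def[symmetric] Un_absorb2 intro!: divide_nonneg_nonneg)
qed

lemma star_weight_link:
  assumes "u \<inter> s = {}"
  shows "star_weight (link X s) u = star_weight X (u \<union> s) / star_weight X s"
proof -
  let ?T = "{t \<in> top_faces X. u \<union> s \<subseteq> t}"
  have img: "{t \<in> top_faces (link X s). u \<subseteq> t} = (\<lambda>t. t - s) ` ?T"
    using assms by (auto simp: link_def)
  have inj: "inj_on (\<lambda>t. t - s) ?T" by (auto simp: inj_on_def)
  have "star_weight (link X s) u = (\<Sum>t\<in>?T. top_weight (link X s) (t - s))"
    unfolding star_weight_def[of "link X s"] img using inj by (simp add: sum.reindex)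
  also have "\<dots> = (\<Sum>t\<in>?T. top_weight X t / star_weight X s)"
  proof (rule sum.cong[OF refl])
    fix t assume "t \<in> ?T"
    then have "t - s \<union> s = t" by auto
    then show "top_weight (link X s) (t - s) = top_weight X t / star_weight X s"
      by (simp add: link_def star_weight_def)
  qed
  finally show ?thesis by (simp add: star_weight_def sum_divide_distrib)
qed

lemma star_weight_link_eq_0:
  assumes "u \<inter> s \<noteq> {}"
  shows "star_weight (link X s) u = 0"
proof -
  have "{t \<in> top_faces (link X s). u \<subseteq> t} = {}" using assms by (auto simp: link_def)
  then show ?thesis by (simp only: star_weight_def sum.empty)
qed

text \<open>Only top faces of positive weight are kept, so that no conditional expectation divides by 0.\<close>

definition orderings :: "nat \<Rightarrow> nat weighted_complex \<Rightarrow> (nat \<Rightarrow> nat) set" where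
  "orderings n X = {y \<in> {..<cdim X} \<rightarrow>\<^sub>E {1..n}.
     inj_on y {..<cdim X} \<and> y ` {..<cdim X} \<in> top_faces X \<and> 0 < top_weight X (y ` {..<cdim X})}"

definition ordering_weight :: "nat weighted_complex \<Rightarrow> (nat \<Rightarrow> nat) \<Rightarrow> real" where
  "ordering_weight X y = top_weight X (y ` {..<cdim X}) / fact (cdim X)"

section \<open>The law of a random ordering\<close>

lemma finite_orderings: "finite (orderings n X)"
  unfolding orderings_def by (rule finite_subset[of _ "{..<cdim X} \<rightarrow>\<^sub>E {1..n}"]) (auto intro: finite_PiE)

lemma orderingsD:
  assumes "y \<in> orderings n X" "A \<subseteq> {..<cdim X}"
  shows "inj_on y A" "y ` A \<subseteq> {1..n}" "y ` A \<in> faces X (card A)" "finite (y ` A)" "card (y ` A) = card A"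
proof -
  have fin: "finite A" using assms finite_subset by blast
  show inj: "inj_on y A" using assms by (auto simp: orderings_def intro: inj_on_subset)
  show "y ` A \<subseteq> {1..n}" using assms by (auto simp: orderings_def PiE_def Pi_def)
  show "finite (y ` A)" using fin by simp
  show "card (y ` A) = card A" using inj by (rule card_image)
  have "y ` {..<cdim X} \<in> top_faces X" using assms(1) by (simp add: orderings_def)
  then show "y ` A \<in> faces X (card A)"
    using assms(2) fin card_image[OF inj] unfolding faces_def by blast
qed

text \<open>Induction on the number of free positions: assigning one more position sums over the
  possible vertices, and \<open>sum_star_weight_insert\<close> supplies the next factor of the
  factorial.\<close>

lemma sum_ordering_weight:
  assumes X: "pure_on {1..n} X" and "A \<subseteq> {..<cdim X}" "inj_on x A" "x ` A \<subseteq> {1..n}"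
  shows "(\<Sum>y\<in>{y \<in> orderings n X. \<forall>a\<in>A. y a = x a}. ordering_weight X y)
    = star_weight X (x ` A) * fact (cdim X - card A) / fact (cdim X)"
  using assms(2-4)
proof (induction "cdim X - card A" arbitrary: A x)
  case 0
  have "card A \<le> card {..<cdim X}" using 0 by (intro card_mono) auto
  then have A: "A = {..<cdim X}" using 0 by (intro card_subset_eq) auto
  let ?s = "x ` A" and ?x = "restrict x {..<cdim X}"
  let ?Y = "{y \<in> orderings n X. \<forall>a\<in>A. y a = x a}"
  have img: "?x ` {..<cdim X} = ?s" by (simp add: A)
  have card: "card ?s = cdim X" using card_image[OF 0(3)] by (simp add: A)
  have star: "star_weight X ?s = (if ?s \<in> top_faces X then top_weight X ?s else 0)"
  proof -
    have "t = ?s" if "t \<in> top_faces X" "?s \<subseteq> t" for t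
      using card_subset_eq[OF pure_onD(4)[OF X that(1)] that(2)] pure_onD(5)[OF X that(1)] card by simp
    then have "{t \<in> top_faces X. ?s \<subseteq> t} = (if ?s \<in> top_faces X then {?s} else {})" by auto
    then show ?thesis unfolding star_weight_def by (simp split: if_splits)
  qed
  have sub: "?Y \<subseteq> {?x}"
  proof
    fix y assume y: "y \<in> ?Y"
    have "y b = ?x b" for b
      using y by (cases "b < cdim X") (auto simp: A orderings_def PiE_def extensional_def)
    then show "y \<in> {?x}" by auto
  qed
  \<comment> \<open>Orderings of top faces of weight 0 are absent, but the star weight of such a
    face is 0 as well.\<close>
  have mem: "?x \<in> ?Y \<longleftrightarrow> ?s \<in> top_faces X \<and> 0 < top_weight X ?s"
    using 0 A unfolding orderings_def mem_Collect_eq img by (auto simp: inj_on_restrict_eq)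
  have nonneg: "0 \<le> top_weight X ?s" if "?s \<in> top_faces X" using X that by (rule pure_onD)
  have "(\<Sum>y\<in>?Y. ordering_weight X y) = star_weight X ?s / fact (cdim X)"
  proof (cases "?x \<in> ?Y")
    case True
    then have "?Y = {?x}" using sub by blast
    then have "(\<Sum>y\<in>?Y. ordering_weight X y) = ordering_weight X ?x" by simp
    also have "\<dots> = top_weight X ?s / fact (cdim X)" unfolding ordering_weight_def img ..
    also have "top_weight X ?s = star_weight X ?s" using True mem star by presburger
    finally show ?thesis .
  next
    case False
    then have "?Y = {}" using sub by blast
    then have "(\<Sum>y\<in>?Y. ordering_weight X y) = 0" by (simp only: sum.empty)
    moreover have "star_weight X ?s = 0"
    proof (cases "?s \<in> top_faces X")
      case True
      then have "\<not> 0 < top_weight X ?s" using False mem by blast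
      then show ?thesis using True nonneg star by simp
    qed (simp add: star)
    ultimately show ?thesis by simp
  qed
  moreover have "fact (cdim X - card A) = (1::real)" by (simp add: A)
  ultimately show ?case by simp
next
  case (Suc m)
  have finA: "finite A" using Suc.prems finite_subset by blast
  have "card A < cdim X" using Suc.hyps(2) by simp
  then obtain a where a: "a < cdim X" "a \<notin> A"
    using card_mono[OF finA, of "{..<cdim X}"] by fastforce
  let ?Y = "{y \<in> orderings n X. \<forall>a\<in>A. y a = x a}"
  let ?V = "{1..n} - x ` A"
  have "y a \<in> ?V" if y: "y \<in> ?Y" for y
  proof -
    have "y a \<in> {1..n}" "inj_on y {..<cdim X}" using y a orderingsD[of y n X "{..<cdim X}"] by auto
    moreover have "y a \<noteq> x b" if "b \<in> A" for b
    proof -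
      have "y b = x b" "b < cdim X" "a \<noteq> b" using that y Suc.prems a by auto
      then show ?thesis using a inj_onD[OF \<open>inj_on y {..<cdim X}\<close>, of a b] by auto
    qed
    ultimately show ?thesis by auto
  qed
  then have "(\<Sum>y\<in>?Y. ordering_weight X y) = (\<Sum>v\<in>?V. \<Sum>y\<in>{y \<in> ?Y. y a = v}. ordering_weight X y)"
    using finite_orderings[of n X] by (intro sum.group[symmetric]) auto
  also have "\<dots> = (\<Sum>v\<in>?V. star_weight X (insert v (x ` A)) * fact m / fact (cdim X))"
  proof (rule sum.cong[OF refl])
    fix v assume v: "v \<in> ?V"
    let ?x = "x(a := v)"
    have img: "?x ` insert a A = insert v (x ` A)" using a by auto
    have "m = cdim X - card (insert a A)" using Suc.hyps(2) a finA by simp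
    moreover have "insert a A \<subseteq> {..<cdim X}" using Suc.prems a by auto
    moreover have "inj_on ?x (insert a A)"
    proof -
      have "inj_on ?x A" using Suc.prems(2) a(2) by (auto simp: inj_on_def)
      moreover have "?x a \<notin> ?x ` (A - {a})" using v a by auto
      ultimately show ?thesis by simp
    qed
    moreover have "?x ` insert a A \<subseteq> {1..n}" unfolding img using v Suc.prems by auto
    ultimately have "(\<Sum>y\<in>{y \<in> orderings n X. \<forall>b\<in>insert a A. y b = ?x b}. ordering_weight X y)
        = star_weight X (insert v (x ` A)) * fact m / fact (cdim X)"
      using Suc.hyps(1)[of "insert a A" ?x] img by simp
    moreover have "{y \<in> orderings n X. \<forall>b\<in>insert a A. y b = ?x b} = {y \<in> ?Y. y a = v}"
      using a by auto
    ultimately show "(\<Sum>y\<in>{y \<in> ?Y. y a = v}. ordering_weight X y)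
        = star_weight X (insert v (x ` A)) * fact m / fact (cdim X)" by simp
  qed
  also have "\<dots> = (\<Sum>v\<in>?V. star_weight X (insert v (x ` A))) * fact m / fact (cdim X)"
    by (simp only: sum_distrib_right sum_divide_distrib)
  also have "(\<Sum>v\<in>?V. star_weight X (insert v (x ` A))) = real (Suc m) * star_weight X (x ` A)"
    using sum_star_weight_insert[OF X, of "x ` A"] finA card_image[OF Suc.prems(2)] Suc.hyps(2) by simp
  finally show ?case unfolding Suc.hyps(2)[symmetric] by (simp add: mult_ac)
qed

section \<open>Averaging operators as conditional expectations\<close>

locale expander =
  fixes n d :: nat and X :: "nat weighted_complex" and k :: nat and \<gamma> :: real
  assumes complex: "weighted_pure_complex n d X"
    and gamma_ge_0: "0 \<le> \<gamma>"
    and expansion: "two_sided_local_spectral_expander X \<gamma>"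
    and k_le: "k \<le> d"
begin

lemma cdim_eq: "cdim X = d" and pure: "pure_on {1..n} X"
  using complex by (auto simp: weighted_pure_complex_def pure_on_def)

sublocale finite_prob "orderings n X" "ordering_weight X"
proof
  show "finite (orderings n X)" by (rule finite_orderings)
  show "0 < ordering_weight X y" if "y \<in> orderings n X" for y
    using that by (simp add: orderings_def ordering_weight_def)
  have "star_weight X {} = 1" using complex by (simp add: star_weight_def weighted_pure_complex_def)
  then show "sum (ordering_weight X) (orderings n X) = 1"
    using sum_ordering_weight[OF pure, of "{}" "\<lambda>_. 0"] by simp
qed

abbreviation "W \<equiv> {1..n}"

text \<open>Given the vertices at \<open>A\<close>, the vertex at a further position a is
  distributed proportionally to the star weight of the enlarged face, independently of which a is
  chosen.\<close>

lemma sum_fiber: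
  assumes "x \<in> orderings n X" "A \<subseteq> {..<d}" "a < d" "a \<notin> A"
  shows "(\<Sum>y\<in>fiber A x. ordering_weight X y * H (y a))
    = (\<Sum>v\<in>W - x ` A. star_weight X (insert v (x ` A)) * H v) * (fact (d - Suc (card A)) / fact d)"
proof -
  note x = orderingsD[OF assms(1), unfolded cdim_eq, OF assms(2)]
  have finA: "finite A" using assms finite_subset by blast
  have "y a \<in> W - x ` A" if y: "y \<in> fiber A x" for y
  proof -
    have y': "inj_on y (insert a A)" "y ` insert a A \<subseteq> W"
      using orderingsD(1,2)[OF fiber_in[OF y], unfolded cdim_eq, of "insert a A"] assms by auto
    have "x ` A = y ` A" using y by (force simp: fiber_def)
    then show ?thesis using y' assms(4) by auto
  qed
  then have "(\<Sum>y\<in>fiber A x. ordering_weight X y * H (y a))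
      = (\<Sum>v\<in>W - x ` A. \<Sum>y\<in>{y \<in> fiber A x. y a = v}. ordering_weight X y * H (y a))"
    by (intro sum.group[symmetric]) auto
  also have "\<dots> = (\<Sum>v\<in>W - x ` A. star_weight X (insert v (x ` A)) * H v * (fact (d - Suc (card A)) / fact d))"
  proof (rule sum.cong[OF refl])
    fix v assume v: "v \<in> W - x ` A"
    let ?x = "x(a := v)"
    have img: "?x ` insert a A = insert v (x ` A)" using assms(4) by auto
    have "(\<Sum>y\<in>{y \<in> fiber A x. y a = v}. ordering_weight X y * H (y a))
        = (\<Sum>y\<in>{y \<in> fiber A x. y a = v}. ordering_weight X y) * H v"
      unfolding sum_distrib_right by (intro sum.cong) auto
    also have "(\<Sum>y\<in>{y \<in> fiber A x. y a = v}. ordering_weight X y)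
        = (\<Sum>y\<in>{y \<in> orderings n X. \<forall>b\<in>insert a A. y b = ?x b}. ordering_weight X y)"
      using assms(4) by (intro sum.cong) (auto simp: fiber_def)
    also have "\<dots> = star_weight X (?x ` insert a A) * fact (cdim X - card (insert a A)) / fact (cdim X)"
    proof (rule sum_ordering_weight[OF pure])
      show "insert a A \<subseteq> {..<cdim X}" using assms by (auto simp: cdim_eq)
      have "inj_on ?x A" using x(1) assms(4) by (auto simp: inj_on_def)
      moreover have "?x a \<notin> ?x ` (A - {a})" using v assms(4) by auto
      ultimately show "inj_on ?x (insert a A)" by simp
      show "?x ` insert a A \<subseteq> {1..n}" unfolding img using v x(2) by auto
    qed
    finally show "(\<Sum>y\<in>{y \<in> fiber A x. y a = v}. ordering_weight X y * H (y a))
        = star_weight X (insert v (x ` A)) * H v * (fact (d - Suc (card A)) / fact d)"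
      unfolding img using finA assms(4) by (simp add: cdim_eq)
  qed
  finally show ?thesis by (simp only: sum_distrib_right)
qed

lemma cond_coordinate:
  assumes "x \<in> orderings n X" "A \<subseteq> {..<d}" "a < d" "a \<notin> A"
  shows "cond A (\<lambda>y. H (y a)) x = (\<Sum>v\<in>W - x ` A. star_weight X (insert v (x ` A)) * H v)
    / (\<Sum>v\<in>W - x ` A. star_weight X (insert v (x ` A)))"
  using sum_fiber[OF assms, of H] sum_fiber[OF assms, of "\<lambda>_. 1"] by (simp add: cond_def)

lemma star_weight_pos:
  assumes "x \<in> orderings n X" "A \<subseteq> {..<d}"
  shows "0 < star_weight X (x ` A)"
proof -
  note x = orderingsD[OF assms(1), unfolded cdim_eq, OF assms(2)]
  have "0 < (\<Sum>y\<in>fiber A x. ordering_weight X y)" using assms(1) by (rule fiber_weight_pos)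
  also have "\<dots> = star_weight X (x ` A) * fact (d - card A) / fact d"
    using sum_ordering_weight[OF pure, of A x] assms x by (simp add: fiber_def cdim_eq)
  finally show ?thesis by (simp add: zero_less_mult_iff zero_less_divide_iff)
qed

lemma cond_down_op:
  assumes "x \<in> orderings n X" "A \<subseteq> {..<d}" "a < d" "a \<notin> A"
  shows "cond A (\<lambda>y. f (y ` insert a A)) x = down_op X (Suc (card A)) f (x ` A)"
proof -
  note x = orderingsD[OF assms(1), unfolded cdim_eq, OF assms(2)]
  have "Suc (card A) \<le> d"
    using card_mono[of "{..<d}" "insert a A"] assms finite_subset[OF assms(2)] by simp
  moreover have "cond A (\<lambda>y. f (y ` insert a A)) x = cond A (\<lambda>y. f (insert (y a) (x ` A))) x"
  proof (rule cond_cong)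
    fix y assume "y \<in> fiber A x"
    then have "y ` A = x ` A" by (force simp: fiber_def)
    then show "f (y ` insert a A) = f (insert (y a) (x ` A))" by simp
  qed
  ultimately show ?thesis
    using cond_coordinate[OF assms, of "\<lambda>v. f (insert v (x ` A))"] down_op_eq[OF pure x(4,5), of f]
    by (simp add: cdim_eq)
qed

text \<open>Each D forgets one position of \<open>B\<close> outside \<open>A\<close>; the tower
  property composes these steps.\<close>

lemma cond_down_iter:
  assumes "x \<in> orderings n X" "B \<subseteq> {..<d}" "A \<subseteq> B"
  shows "down_iter X (card B) (card A) f (x ` A) = cond A (\<lambda>y. f (y ` B)) x"
  using assms
proof (induction "card B" arbitrary: B f)
  case 0
  then have "B = {}" "A = {}" using finite_subset[OF 0(3)] by auto
  then show ?case using 0 by (simp add: cond_const)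
next
  case (Suc i)
  have fin: "finite B" "finite A" using Suc.prems finite_subset[of _ "{..<d}"] by auto
  show ?case
  proof (cases "A = B")
    case True
    have "cond B (\<lambda>y. f (y ` B)) x = f (x ` B)"
    proof (rule cond_id)
      show "depends_on B (\<lambda>y. f (y ` B))"
        unfolding depends_on_def by (metis image_cong)
    qed fact
    then show ?thesis using True Suc.hyps(2)[symmetric] by simp
  next
    case False
    then obtain a where a: "a \<in> B" "a \<notin> A" using Suc.prems by blast
    let ?B = "B - {a}"
    have i: "i = card ?B" using Suc.hyps(2) a fin by simp
    have B: "insert a ?B = B" using a by auto
    have "card A \<le> i" unfolding i using a Suc.prems fin by (intro card_mono) auto
    then have "down_iter X (card B) (card A) f (x ` A) = down_iter X i (card A) (down_op X (Suc i) f) (x ` A)"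
      using Suc.hyps(2)[symmetric] by simp
    also have "\<dots> = cond A (\<lambda>y. down_op X (Suc i) f (y ` ?B)) x"
      unfolding i using Suc.prems a by (intro Suc.hyps(1)[OF i]) auto
    also have "\<dots> = cond A (cond ?B (\<lambda>y. f (y ` B))) x"
    proof (rule cond_cong)
      fix y assume "y \<in> fiber A x"
      then have "y \<in> orderings n X" by (rule fiber_in)
      moreover have "?B \<subseteq> {..<d}" "a < d" using Suc.prems a by auto
      ultimately show "down_op X (Suc i) f (y ` ?B) = cond ?B (\<lambda>y. f (y ` B)) y"
        using cond_down_op[of y ?B a f] unfolding B i by simp
    qed
    also have "\<dots> = cond A (\<lambda>y. f (y ` B)) x"
      using Suc.prems a by (intro cond_tower) auto
    finally show ?thesis .
  qed
qed

lemma expect_at_eq: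
  assumes "x \<in> orderings n X" "i \<le> d"
  shows "expect_at X i f = cond {} (\<lambda>y. f (y ` {..<i})) x"
proof -
  have "expect_at X i f = down_iter X i 0 f {}" using assms(2)
  proof (induction i arbitrary: f)
    case 0
    then show ?case using expect_at_0[OF complex] by simp
  next
    case (Suc i)
    then show ?case using expect_at_down_op[OF pure, of i f] by (simp add: cdim_eq)
  qed
  then show ?thesis using cond_down_iter[of x "{..<i}" "{}" f] assms by simp
qed

end

section \<open>From link eigenvalues to contraction\<close>

context expander
begin

text \<open>Star weights give the walk on the link a symmetric matrix \<open>M\<close> with row sums
  equal to the stationary weights. Restricting to the set \<open>V\<close> of vertices of positive
  weight meets the positivity demanded by \<open>symmetric_walk_contraction\<close>.\<close>

lemma link_walk:
  assumes A: "A \<subseteq> {..<d}" "card A + 2 \<le> d" and x: "x \<in> orderings n X"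
  defines "s \<equiv> x ` A"
  defines "V \<equiv> {v \<in> W - s. 0 < star_weight X (insert v s)}"
  defines "M \<equiv> \<lambda>u v. (if u = v then 0 else star_weight X (insert v (insert u s))) / real (d - Suc (card A))"
  defines "T \<equiv> \<lambda>h u. (\<Sum>v\<in>V. M u v * h v) / star_weight X (insert u s)"
  shows "u \<in> V \<Longrightarrow> T h u = (\<Sum>v\<in>W - insert u s. star_weight X (insert v (insert u s)) * h v)
      / (\<Sum>v\<in>W - insert u s. star_weight X (insert v (insert u s)))" (is "_ \<Longrightarrow> ?walk")
    and "(\<Sum>u\<in>V. star_weight X (insert u s) * h u) = 0
      \<Longrightarrow> (\<Sum>u\<in>V. star_weight X (insert u s) * (T h u)\<^sup>2) \<le> \<gamma>\<^sup>2 * (\<Sum>u\<in>V. star_weight X (insert u s) * (h u)\<^sup>2)"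
      (is "?mean \<Longrightarrow> ?contr")
proof -
  note s = orderingsD[OF x, unfolded cdim_eq, OF A(1), folded s_def]
  define c where "c = real (d - Suc (card A))"
  have c: "0 < c" using A(2) by (simp add: c_def)
  have nonneg: "0 \<le> star_weight X t" for t by (rule star_weight_nonneg[OF pure])
  have zero: "star_weight X (insert v (insert u s)) = 0" if "v \<in> W - s" "v \<notin> V" for u v
  proof -
    have "star_weight X (insert v (insert u s)) \<le> star_weight X (insert v s)"
      by (intro star_weight_mono[OF pure]) auto
    also have "\<dots> \<le> 0" using that by (auto simp: V_def)
    finally show ?thesis using nonneg by (meson antisym)
  qed
  have sumM: "(\<Sum>v\<in>V. M u v * h v) = (\<Sum>v\<in>W - insert u s. star_weight X (insert v (insert u s)) * h v) / c"
    if u: "u \<in> V" for u h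
  proof -
    have "(\<Sum>v\<in>V. M u v * h v) = (\<Sum>v\<in>V - {u}. M u v * h v)"
      by (rule sum.mono_neutral_right) (auto simp: V_def M_def)
    also have "\<dots> = (\<Sum>v\<in>V - {u}. star_weight X (insert v (insert u s)) * h v / c)"
      by (intro sum.cong refl) (auto simp: M_def c_def)
    also have "\<dots> = (\<Sum>v\<in>W - insert u s. star_weight X (insert v (insert u s)) * h v / c)"
    proof (rule sum.mono_neutral_left)
      show "\<forall>v\<in>W - insert u s - (V - {u}). star_weight X (insert v (insert u s)) * h v / c = 0"
      proof
        fix v assume "v \<in> W - insert u s - (V - {u})"
        then have "star_weight X (insert v (insert u s)) = 0" by (intro zero) blast+
        then show "star_weight X (insert v (insert u s)) * h v / c = 0" by simp
      qed
    qed (auto simp: V_def)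
    finally show ?thesis by (simp add: sum_divide_distrib)
  qed
  have total: "(\<Sum>v\<in>W - insert u s. star_weight X (insert v (insert u s))) = c * star_weight X (insert u s)"
    if "u \<in> V" for u
    using that s by (subst sum_star_weight_insert[OF pure]) (auto simp: V_def c_def cdim_eq)
  have walk: "T h u = (\<Sum>v\<in>W - insert u s. star_weight X (insert v (insert u s)) * h v)
      / (\<Sum>v\<in>W - insert u s. star_weight X (insert v (insert u s)))" if u: "u \<in> V" for u h
    unfolding T_def sumM[OF u] total[OF u] by simp
  then show "u \<in> V \<Longrightarrow> ?walk" .
  have spos: "0 < star_weight X s" unfolding s_def using x A(1) by (rule star_weight_pos)
  define Y where "Y = link X s"
  have Y: "pure_on W Y" unfolding Y_def using pure s by (intro pure_on_link)
  have dimY: "cdim Y = d - card A" using s by (simp add: Y_def link_def cdim_eq)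
  have starY: "star_weight Y u = star_weight X (u \<union> s) / star_weight X s" if "u \<inter> s = {}" for u
    unfolding Y_def using that by (rule star_weight_link)
  have starY0: "star_weight Y u = 0" if "u \<inter> s \<noteq> {}" for u
    unfolding Y_def using that by (rule star_weight_link_eq_0)
  have eig: "\<bar>\<mu>\<bar> \<le> \<gamma>"
    if ex: "\<exists>u\<in>V. h u \<noteq> 0" and mean: "(\<Sum>u\<in>V. star_weight X (insert u s) * h u) = 0"
      and ev: "\<And>u. u \<in> V \<Longrightarrow> T h u = \<mu> * h u" for \<mu> h
  proof -
    \<comment> \<open>An eigenvector on \<open>V\<close> is extended by 0 to all vertices of the
      link, as the eigenvalue definition there requires.\<close>
    define h' where "h' e = (if the_elem e \<in> V then h (the_elem e) else 0)" for e
    have h': "h' {v} = (if v \<in> V then h v else 0)" for v by (simp add: h'_def)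
    have "nontrivial_walk_eigenvalue Y \<mu>"
      unfolding nontrivial_walk_eigenvalue_def
    proof (intro exI[of _ h'] conjI ballI)
      obtain u where u: "u \<in> V" "h u \<noteq> 0" using ex by blast
      have "star_weight Y {u} \<noteq> 0" using u spos by (subst starY) (auto simp: V_def)
      then have "{u} \<in> faces Y 1" using star_weight_eq_0[of "{u}" Y] by auto
      then show "\<exists>u\<in>faces Y 1. h' u \<noteq> 0" using u h' by (intro bexI[of _ "{u}"]) auto
      have "inner_at Y 1 h' (\<lambda>_. 1) = (\<Sum>y\<in>{y \<in> faces Y (Suc 0). {} \<subset> y}. level_weight Y (Suc 0) y * h' y)"
        unfolding inner_at_def by (intro sum.cong) (auto simp: faces_def)
      also have "\<dots> = (\<Sum>v\<in>W. star_weight Y {v} * h' {v}) / real (cdim Y choose Suc 0)"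
        using sum_level_cofaces[OF Y, of "{}" 0 h'] A dimY by simp
      also have "(\<Sum>v\<in>W. star_weight Y {v} * h' {v}) = (\<Sum>v\<in>V. star_weight X (insert v s) * h v / star_weight X s)"
        by (rule sum.mono_neutral_cong_right) (auto simp: h' V_def starY)
      also have "\<dots> = 0" using mean by (simp add: sum_divide_distrib[symmetric])
      finally show "inner_at Y 1 h' (\<lambda>_. 1) = 0" by simp
    next
      fix e assume e: "e \<in> faces Y 1"
      then obtain u where u: "e = {u}" using facesD(2)[OF Y e] card_1_singletonE by blast
      have uW: "u \<in> W" using facesD(3)[OF Y e] u by simp
      have us: "u \<notin> s" using e u by (auto simp: faces_def Y_def link_def)
      have w: "walk_op Y h' {u}
          = (\<Sum>v\<in>W - {u}. star_weight Y {v, u} * h' {v}) / (\<Sum>v\<in>W - {u}. star_weight Y {v, u})"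
        using Y A dimY by (intro walk_op_eq) auto
      show "walk_op Y h' e = \<mu> * h' e"
      proof (cases "u \<in> V")
        case True
        have sumY: "(\<Sum>v\<in>W - {u}. star_weight Y {v, u} * G v)
            = (\<Sum>v\<in>W - insert u s. star_weight X (insert v (insert u s)) * G v) / star_weight X s" for G
        proof -
          have "(\<Sum>v\<in>W - {u}. star_weight Y {v, u} * G v)
              = (\<Sum>v\<in>W - insert u s. star_weight X (insert v (insert u s)) * G v / star_weight X s)"
            by (rule sum.mono_neutral_cong_right) (use us in \<open>auto simp: starY starY0\<close>)
          then show ?thesis by (simp add: sum_divide_distrib)
        qed
        have "walk_op Y h' {u} = T (\<lambda>v. h' {v}) u"
          unfolding w walk[OF True] using sumY[of "\<lambda>v. h' {v}"] sumY[of "\<lambda>_. 1"] spos by simp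
        also have "\<dots> = T h u" unfolding T_def by (simp add: h')
        finally show ?thesis using ev[OF True] True by (simp add: u h')
      next
        \<comment> \<open>At a vertex of weight 0 all edges have weight 0, so the walk operator is 0
          by division by 0, in agreement with the extension by 0.\<close>
        case False
        have "star_weight Y {v, u} = 0" for v
        proof -
          have "star_weight Y {v, u} \<le> star_weight Y {u}" by (intro star_weight_mono[OF Y]) auto
          also have "star_weight Y {u} \<le> 0"
            using False us uW spos by (auto simp: starY V_def divide_le_0_iff not_less)
          finally show ?thesis using star_weight_nonneg[OF Y] by (meson antisym)
        qed
        then show ?thesis using False by (simp add: u w h')
      qed
    qed
    moreover have "card A + 2 \<le> cdim X" "s \<in> faces X (card A)" using A s by (auto simp: cdim_eq)
    ultimately have "\<mu> \<in> {- \<gamma>..\<gamma>}"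
      using expansion unfolding two_sided_local_spectral_expander_def Y_def by blast
    then show ?thesis by (simp add: abs_le_iff)
  qed
  show "?mean \<Longrightarrow> ?contr"
    unfolding T_def
  proof (rule symmetric_walk_contraction)
    show "finite V" by (simp add: V_def)
    show "0 < star_weight X (insert u s)" if "u \<in> V" for u using that by (simp add: V_def)
    show "M u v = M v u" for u v by (simp add: M_def insert_commute)
    show "(\<Sum>v\<in>V. M u v) = star_weight X (insert u s)" if "u \<in> V" for u
      using sumM[OF that, of "\<lambda>_. 1"] total[OF that] c by simp
  next
    fix \<mu> :: real and h
    assume "\<exists>u\<in>V. h u \<noteq> 0" "(\<Sum>u\<in>V. star_weight X (insert u s) * h u) = 0"
      and "\<And>u. u \<in> V \<Longrightarrow> (\<Sum>v\<in>V. M u v * h v) / star_weight X (insert u s) = \<mu> * h u"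
    then show "\<bar>\<mu>\<bar> \<le> \<gamma>" by (intro eig[of h]) (simp_all add: T_def)
  qed
qed

text \<open>Given the vertices at \<open>A\<close>, h is a function \<open>H\<close> of coordinate
  a, and averaging it given coordinate b is a step of the link walk evaluated at that coordinate.
  Both coordinates have the same conditional law, so contraction of the centred \<open>H\<close> is
  the claim.\<close>

lemma cond_insert_contraction:
  assumes A: "A \<subseteq> {..<k}" and ab: "a < k" "b < k" "a \<notin> A" "b \<notin> A" "a \<noteq> b"
    and dep: "depends_on (insert a A) h" and x: "x \<in> orderings n X"
  shows "cond A (\<lambda>y. (cond (insert b A) h y - cond A h y)\<^sup>2) x \<le> \<gamma>\<^sup>2 * cond A (\<lambda>y. (h y)\<^sup>2) x"
proof -
  define s where "s = x ` A"
  define p where "p v = star_weight X (insert v s)" for v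
  define V where "V = {v \<in> W - s. 0 < p v}"
  have Ad: "A \<subseteq> {..<d}" "a < d" "b < d" using A ab k_le by auto
  have finA: "finite A" using A finite_subset by blast
  have card: "card A + 2 \<le> d"
    using card_mono[of "{..<d}" "insert a (insert b A)"] Ad ab finA by simp
  define M where "M u v = (if u = v then 0 else star_weight X (insert v (insert u s))) / real (d - Suc (card A))" for u v
  define T where "T h u = (\<Sum>v\<in>V. M u v * h v) / p u" for h u
  have T: "T h u = (\<Sum>v\<in>W - insert u s. star_weight X (insert v (insert u s)) * h v)
      / (\<Sum>v\<in>W - insert u s. star_weight X (insert v (insert u s)))" if "u \<in> V" for h u
    using link_walk(1)[OF Ad(1) card x, of u h] that
    unfolding T_def V_def M_def p_def s_def by blast
  have contr: "(\<Sum>u\<in>V. p u * (T h u)\<^sup>2) \<le> \<gamma>\<^sup>2 * (\<Sum>u\<in>V. p u * (h u)\<^sup>2)" if "(\<Sum>u\<in>V. p u * h u) = 0" for h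
    using link_walk(2)[OF Ad(1) card x, of h] that
    unfolding T_def V_def M_def p_def s_def by blast
  have ppos: "0 < p v" if "v \<in> V" for v using that by (simp add: V_def)
  have finV: "finite V" by (simp add: V_def)
  define P where "P = (\<Sum>v\<in>V. p v)"
  have sumV: "(\<Sum>v\<in>W - s. p v * G v) = (\<Sum>v\<in>V. p v * G v)" for G
  proof (rule sum.mono_neutral_right)
    show "\<forall>v\<in>W - s - V. p v * G v = 0"
      using star_weight_nonneg[OF pure] by (auto simp: V_def p_def) (metis less_le)
  qed (auto simp: V_def)
  have avg: "cond A (\<lambda>y. G (y e)) x = (\<Sum>v\<in>V. p v * G v) / P" if "e < d" "e \<notin> A" for G e
    using cond_coordinate[OF x Ad(1) that, of G] sumV[of G] sumV[of "\<lambda>_. 1"]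
    unfolding p_def s_def P_def by simp
  have inV: "y b \<in> V" if y: "y \<in> fiber A x" for y
  proof -
    have yO: "y \<in> orderings n X" and img: "y ` A = s" using y by (auto simp: fiber_def s_def image_def)
    have sub: "insert b A \<subseteq> {..<d}" using Ad by auto
    have "inj_on y (insert b A)" "y ` insert b A \<subseteq> W" using orderingsD(1,2)[OF yO, unfolded cdim_eq, OF sub] by auto
    moreover have "0 < star_weight X (y ` insert b A)" using star_weight_pos[OF yO sub] .
    ultimately show ?thesis using ab(4) img by (auto simp: V_def p_def)
  qed
  have Ppos: "0 < P"
    unfolding P_def using inV[OF fiber_self[OF x]] finV ppos by (intro sum_pos) auto
  \<comment> \<open>On the fiber h depends only on coordinate a, so any representative with the
    right value there will do.\<close>
  define H where "H v = h (SOME y. y \<in> fiber A x \<and> y a = v)" for v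
  have H: "h y = H (y a)" if y: "y \<in> fiber A x" for y
  proof -
    let ?z = "SOME z. z \<in> fiber A x \<and> z a = y a"
    have z: "?z \<in> fiber A x \<and> ?z a = y a" by (rule someI[of _ y]) (use y in simp)
    have "\<forall>e\<in>insert a A. y e = ?z e" using y z by (auto simp: fiber_def)
    then show ?thesis using dep y z fiber_in unfolding H_def depends_on_def by blast
  qed
  define m where "m = cond A h x"
  have m: "m = (\<Sum>v\<in>V. p v * H v) / P"
    unfolding m_def using avg[OF Ad(2) ab(3), of H] H by (simp cong: cond_cong)
  have step: "cond (insert b A) h y - cond A h y = T (\<lambda>v. H v - m) (y b)" if y: "y \<in> fiber A x" for y
  proof -
    have yO: "y \<in> orderings n X" using y by (rule fiber_in)
    have img: "y ` insert b A = insert (y b) s" using y by (force simp: fiber_def s_def)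
    have sub: "fiber (insert b A) y \<subseteq> fiber A x" using y by (auto simp: fiber_def)
    have "cond (insert b A) h y = cond (insert b A) (\<lambda>z. H (z a)) y"
      using H sub by (intro cond_cong) auto
    also have "\<dots> = T H (y b)"
      using cond_coordinate[OF yO, of "insert b A" a H] Ad ab unfolding img T[OF inV[OF y]] by auto
    finally have 1: "cond (insert b A) h y = T H (y b)" .
    have "T (\<lambda>_. 1) (y b) = 1"
      using cond_coordinate[OF yO, of "insert b A" a "\<lambda>_. 1"] Ad ab cond_const[OF yO]
      unfolding img T[OF inV[OF y]] by auto
    moreover have "T (\<lambda>v. H v - m) (y b) = T H (y b) - m * T (\<lambda>_. 1) (y b)"
      by (simp add: T_def algebra_simps sum_subtractf sum_distrib_left diff_divide_distrib)
    moreover have "cond A h y = m" unfolding m_def cond_def using y by (simp add: fiber_eq)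
    ultimately show ?thesis using 1 by simp
  qed
  have "cond A (\<lambda>y. (cond (insert b A) h y - cond A h y)\<^sup>2) x = cond A (\<lambda>y. (T (\<lambda>v. H v - m) (y b))\<^sup>2) x"
    using step by (intro cond_cong) simp
  also have "\<dots> = (\<Sum>v\<in>V. p v * (T (\<lambda>v. H v - m) v)\<^sup>2) / P"
    by (rule avg[OF Ad(3) ab(4)])
  also have "\<dots> \<le> (\<gamma>\<^sup>2 * (\<Sum>v\<in>V. p v * (H v - m)\<^sup>2)) / P"
  proof (intro divide_right_mono contr)
    have "(\<Sum>v\<in>V. p v * (H v - m)) = (\<Sum>v\<in>V. p v * H v) - m * P"
      by (simp add: P_def algebra_simps sum_subtractf sum_distrib_left)
    then show "(\<Sum>v\<in>V. p v * (H v - m)) = 0" using m Ppos by simp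
  qed (use Ppos in simp)
  \<comment> \<open>Variance is at most the second moment.\<close>
  also have "\<dots> \<le> (\<gamma>\<^sup>2 * (\<Sum>v\<in>V. p v * (H v)\<^sup>2)) / P"
  proof (intro divide_right_mono mult_left_mono)
    have "(\<Sum>v\<in>V. p v * (H v - m)\<^sup>2) = (\<Sum>v\<in>V. p v * (H v)\<^sup>2) - 2 * m * (\<Sum>v\<in>V. p v * H v) + m\<^sup>2 * P"
      by (simp add: P_def power2_diff algebra_simps sum_subtractf sum.distrib sum_distrib_left sum_distrib_right)
    also have "(\<Sum>v\<in>V. p v * H v) = m * P" using m Ppos by simp
    finally show "(\<Sum>v\<in>V. p v * (H v - m)\<^sup>2) \<le> (\<Sum>v\<in>V. p v * (H v)\<^sup>2)"
      using Ppos by (simp add: power2_eq_square)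
  qed (use Ppos in auto)
  also have "\<dots> = \<gamma>\<^sup>2 * cond A (\<lambda>y. (H (y a))\<^sup>2) x"
    using avg[OF Ad(2) ab(3), of "\<lambda>v. (H v)\<^sup>2"] by simp
  also have "cond A (\<lambda>y. (H (y a))\<^sup>2) x = cond A (\<lambda>y. (h y)\<^sup>2) x"
    using H by (intro cond_cong) simp
  finally show ?thesis .
qed

section \<open>Exchangeability and the translation back to the complex\<close>

lemma orderings_permute:
  assumes p: "p permutes {..<k}" and x: "x \<in> orderings n X"
  shows "x \<circ> p \<in> orderings n X \<and> ordering_weight X (x \<circ> p) = ordering_weight X x"
proof -
  have p': "p permutes {..<d}" using p k_le by (intro permutes_subset[OF p]) auto
  have img: "(x \<circ> p) ` {..<d} = x ` {..<d}" using permutes_image[OF p'] by (metis image_comp)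
  have "inj_on x {..<d}" using x by (simp add: orderings_def cdim_eq)
  then have inj: "inj_on (x \<circ> p) {..<d}"
    using permutes_inj_on[OF p'] permutes_image[OF p'] by (intro comp_inj_on) auto
  have "x \<circ> p \<in> {..<d} \<rightarrow>\<^sub>E W"
    using x permutes_in_image[OF p'] permutes_not_in[OF p']
    unfolding orderings_def cdim_eq PiE_def Pi_def extensional_def by auto
  then show ?thesis
    using x img inj by (simp add: orderings_def ordering_weight_def cdim_eq)
qed

sublocale quasi_product "orderings n X" "ordering_weight X" k \<gamma>
  by unfold_locales (rule gamma_ge_0, rule cond_insert_contraction, assumption+, rule orderings_permute)

lemma ordering_image_face:
  assumes "y \<in> orderings n X" "T \<subseteq> {..<k}"
  shows "inj_on y T" "y ` T \<in> faces X (card T)"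
proof -
  have "T \<subseteq> {..<cdim X}" using assms(2) k_le by (auto simp: cdim_eq)
  with assms(1) show "inj_on y T" "y ` T \<in> faces X (card T)" by (rule orderingsD)+
qed

theorem inner_bottom_up_level_le:
  assumes f: "\<And>s. s \<in> faces X k \<Longrightarrow> f s \<in> {0, 1}" and i: "i \<le> k"
    and eps: "0 \<le> \<epsilon>" and glob: "\<And>\<tau>. \<tau> \<in> faces X i \<Longrightarrow> down_iter X k i f \<tau> \<le> \<epsilon>"
    and small: "4 * 2 ^ (12 * k) * \<kappa> \<le> 1"
  shows "inner_at X k f (bottom_up_level X k f i) \<le> 2 powr (13 * real i) * \<epsilon> powr (1 / 3) * expect_at X k f"
proof -
  have k: "{..<k} \<subseteq> {..<d}" using k_le by auto
  have "orderings n X \<noteq> {}" using w_sum by auto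
  then obtain x where x: "x \<in> orderings n X" by blast
  define \<phi> where "\<phi> y = f (y ` {..<k})" for y :: "nat \<Rightarrow> nat"
  have down: "down_iter X k (card A) f (y ` A) = cond A \<phi> y" if "y \<in> orderings n X" "A \<subseteq> {..<k}" for y A
    using cond_down_iter[OF that(1) k that(2), of f] unfolding \<phi>_def by simp
  \<comment> \<open>Densities of a boolean function never exceed 1, so \<epsilon> may be capped at
    1; monotonicity of the cube root undoes this at the end.\<close>
  interpret G: global_function "orderings n X" "ordering_weight X" k \<gamma> \<phi> i "min \<epsilon> 1"
  proof
    show "depends_on {..<k} \<phi>" unfolding depends_on_def \<phi>_def by (metis image_cong)
    show bool: "\<phi> y \<in> {0, 1}" if "y \<in> orderings n X" for y
      using ordering_image_face(2)[OF that order_refl] f by (simp add: \<phi>_def)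
    show "\<phi> (y \<circ> p) = \<phi> y" if "p permutes {..<k}" for p y
      unfolding \<phi>_def using permutes_image[OF that] by (metis image_comp)
    have "(16 :: real) ^ k = 2 ^ (4 * k)" by (simp add: power_mult)
    also have "\<dots> \<le> 2 ^ (12 * k)" by (intro power_increasing) auto
    also have "\<dots> \<le> 4 * 2 ^ (12 * k)" by simp
    finally have "16 ^ k * \<kappa> \<le> 4 * 2 ^ (12 * k) * \<kappa>" using kappa_nonneg by (intro mult_right_mono)
    then show "16 ^ k * \<kappa> \<le> 1" using small by linarith
    show "cond A \<phi> y \<le> min \<epsilon> 1" if A: "A \<subseteq> {..<k}" "card A = i" and y: "y \<in> orderings n X" for A y
    proof (rule min.boundedI)
      from ordering_image_face(2)[OF y A(1)] have face: "y ` A \<in> faces X i" unfolding A(2) .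
      have "cond A \<phi> y = down_iter X k i f (y ` A)" using down[OF y A(1)] unfolding A(2) by (rule sym)
      also have "\<dots> \<le> \<epsilon>" using face by (rule glob)
      finally show "cond A \<phi> y \<le> \<epsilon>" .
      show "cond A \<phi> y \<le> 1"
      proof (rule cond_le[OF y])
        fix z assume "z \<in> orderings n X"
        then show "\<phi> z \<le> 1" using bool[of z] by auto
      qed
    qed
  qed (use i eps in auto)
  \<comment> \<open>An ordering is injective, so subsets of a face correspond to sets of
    positions.\<close>
  have image_sum: "(\<Sum>S\<in>{S. S \<subseteq> y ` T \<and> card S = l}. h S) = (\<Sum>R\<in>{R. R \<subseteq> T \<and> card R = l}. h (y ` R))"
    if y: "y \<in> orderings n X" and T: "T \<subseteq> {..<k}" for y T l and h :: "nat set \<Rightarrow> real"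
  proof -
    have inj: "inj_on y T" using y T by (rule ordering_image_face)
    have "bij_betw ((`) y) {R. R \<subseteq> T \<and> card R = l} {S. S \<subseteq> y ` T \<and> card S = l}"
    proof (rule bij_betw_subset[OF bij_betw_Pow[OF inj_on_imp_bij_betw[OF inj]]])
      show "(`) y ` {R. R \<subseteq> T \<and> card R = l} = {S. S \<subseteq> y ` T \<and> card S = l}"
        using inj by (auto simp: subset_image_iff card_image inj_on_subset)
    qed auto
    then show ?thesis using sum.reindex_bij_betw[of "(`) y" _ _ h] by metis
  qed
  \<comment> \<open>The bottom-up recursion subtracts from the conditional density the components of
    all proper subsets, grouped by size. That is the recursion which Moebius inversion
    solves.\<close>
  have g: "bottom_up_g X k f (card T) (y ` T) = G.g T y" if y: "y \<in> orderings n X" and "T \<subseteq> {..<k}" for y T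
    using that(2)
  proof (induction "card T" arbitrary: T rule: less_induct)
    case less
    have fin: "finite T" using less.prems finite_subset by blast
    have face: "y ` T \<in> faces X (card T)"
      using y less.prems by (rule ordering_image_face)
    have "(\<Sum>j<card T. real (card T choose j) * up_iter X (card T) j (bottom_up_g X k f j) (y ` T))
        = (\<Sum>j<card T. \<Sum>R\<in>{R. R \<subseteq> T \<and> card R = j}. G.g R y)"
    proof (rule sum.cong[OF refl])
      fix j assume j: "j \<in> {..<card T}"
      have "real (card T choose j) * up_iter X (card T) j (bottom_up_g X k f j) (y ` T)
          = (\<Sum>R\<in>{R. R \<subseteq> T \<and> card R = j}. bottom_up_g X k f j (y ` R))"
        using up_iter_eq[OF face, of j] j image_sum[OF y less.prems] by simp
      also have "\<dots> = (\<Sum>R\<in>{R. R \<subseteq> T \<and> card R = j}. G.g R y)"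
        using less.hyps less.prems j by (intro sum.cong refl) auto
      finally show "real (card T choose j) * up_iter X (card T) j (bottom_up_g X k f j) (y ` T)
          = (\<Sum>R\<in>{R. R \<subseteq> T \<and> card R = j}. G.g R y)" .
    qed
    also have "\<dots> = (\<Sum>j<card T. \<Sum>R\<in>{R \<in> Pow T - {T}. card R = j}. G.g R y)"
      by (intro sum.cong refl) auto
    also have "\<dots> = (\<Sum>R\<in>Pow T - {T}. G.g R y)"
      using fin by (intro sum.group) (auto intro!: psubset_card_mono)
    also have "\<dots> = (\<Sum>R\<in>Pow T. G.g R y) - G.g T y"
      using fin by (simp add: sum_diff1)
    also have "(\<Sum>R\<in>Pow T. G.g R y) = cond T \<phi> y"
      using G.cond_eq_sum_level[OF fin, of "{}" y] by simp
    finally show ?case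
      using down[OF y less.prems] by (subst bottom_up_g.simps) simp
  qed
  have level: "bottom_up_level X k f i (y ` {..<k}) = G.F y" if y: "y \<in> orderings n X" for y
  proof -
    have face: "y ` {..<k} \<in> faces X k" using ordering_image_face(2)[OF y order_refl] by simp
    have "bottom_up_level X k f i (y ` {..<k}) = (\<Sum>R\<in>{R. R \<subseteq> {..<k} \<and> card R = i}. bottom_up_g X k f i (y ` R))"
      unfolding bottom_up_level_def using up_iter_eq[OF face i] image_sum[OF y order_refl] by simp
    also have "\<dots> = G.F y"
      unfolding G.F_def G.index_sets_def using g[OF y] by (intro sum.cong) auto
    finally show ?thesis .
  qed
  have "inner_at X k f (bottom_up_level X k f i) = expect_at X k (\<lambda>s. f s * bottom_up_level X k f i s)"
    by (simp add: inner_at_def expect_at_def)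
  also have "\<dots> = cond {} (\<lambda>y. f (y ` {..<k}) * bottom_up_level X k f i (y ` {..<k})) x"
    by (rule expect_at_eq[OF x k_le])
  also have "\<dots> = cond {} (\<lambda>y. \<phi> y * G.F y) x"
    using level by (intro cond_cong) (auto simp: \<phi>_def)
  also have "\<dots> \<le> 2 powr (13 * real i) * min \<epsilon> 1 powr (1 / 3) * cond {} \<phi> x"
    using small x by (rule G.level_inequality)
  also have "\<dots> \<le> 2 powr (13 * real i) * \<epsilon> powr (1 / 3) * cond {} \<phi> x"
    using eps G.cond_phi_nonneg[OF x] by (intro mult_right_mono mult_left_mono powr_mono2) auto
  also have "cond {} \<phi> x = expect_at X k f"
    unfolding expect_at_eq[OF x k_le] \<phi>_def ..
  finally show ?thesis .
qed

end

text \<open>The constants are c = 16 and C = 13.\<close>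

theorem mainTheorem2:
  "\<exists>c>0::real. \<exists>C>0::real.
     \<forall>(n::nat) (d::nat) (k::nat) (i::nat) (\<gamma>::real) (\<epsilon>::real)
       (X :: nat weighted_complex) (f :: nat set \<Rightarrow> real).
       weighted_pure_complex n d X \<longrightarrow>
       two_sided_local_spectral_expander X \<gamma> \<longrightarrow>
       \<gamma> < 2 powr (- c * real k) \<longrightarrow>
       i \<le> k \<longrightarrow> k \<le> d \<longrightarrow>
       (\<forall>x\<in>faces X k. f x \<in> {0, 1}) \<longrightarrow>
       pseudorandom X k \<epsilon> i f \<longrightarrow>
       inner_at X k f (bottom_up_level X k f i)
         \<le> 2 powr (C * real i) * \<epsilon> powr (1 / 3) * expect_at X k f"
proof (rule exI[of _ 16], rule conjI, simp, rule exI[of _ 13], rule conjI, simp, intro allI impI)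
  fix n d k i :: nat and \<gamma> \<epsilon> :: real and X :: "nat weighted_complex" and f :: "nat set \<Rightarrow> real"
  assume X: "weighted_pure_complex n d X" and exp: "two_sided_local_spectral_expander X \<gamma>"
    and \<gamma>: "\<gamma> < 2 powr (- 16 * real k)" and i: "i \<le> k" and k: "k \<le> d"
    and f: "\<forall>x\<in>faces X k. f x \<in> {0, 1}" and pseudo: "pseudorandom X k \<epsilon> i f"
  \<comment> \<open>The given \<gamma> may be negative; enlarging it to its upper limit keeps the
    expansion hypothesis and makes it nonnegative.\<close>
  define \<gamma>' where "\<gamma>' = 2 powr (- 16 * real k)"
  interpret expander n d X k \<gamma>'
  proof
    show "two_sided_local_spectral_expander X \<gamma>'"
      using exp \<gamma> unfolding two_sided_local_spectral_expander_def \<gamma>'_def by fastforce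
  qed (use X k in \<open>auto simp: \<gamma>'_def\<close>)
  \<comment> \<open>For k \<ge> 1 both 4 and k^2 are at most 4^k, so the exponents 2 + 12 + 2
    explain c = 16; for k = 0 the quantity \<kappa> is 0.\<close>
  have small: "4 * 2 ^ (12 * k) * \<kappa> \<le> 1"
  proof (cases "k = 0")
    case False
    have "2 powr (16 * real k) = (2 :: real) ^ (16 * k)" by (simp add: powr_realpow[symmetric])
    then have g: "\<gamma>' = 1 / 2 ^ (16 * k)" by (simp add: \<gamma>'_def powr_minus_divide)
    have "real k \<le> 2 ^ k" by (simp add: less_imp_le)
    then have "(real k)\<^sup>2 \<le> (2 ^ k)\<^sup>2" by (intro power_mono) auto
    moreover have "(4 :: real) \<le> 4 ^ k" using False by (simp add: self_le_power)
    ultimately have "4 * 2 ^ (12 * k) * (real k)\<^sup>2 \<le> 4 ^ k * 2 ^ (12 * k) * (2 ^ k)\<^sup>2"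
      by (intro mult_mono) auto
    also have "\<dots> = 2 ^ (16 * k)"
      by (simp add: power_mult power2_eq_square power_mult_distrib[symmetric])
    finally have "4 * 2 ^ (12 * k) * (real k)\<^sup>2 \<le> 2 ^ (16 * k)" .
    moreover have "\<kappa> = (real k)\<^sup>2 / 2 ^ (16 * k)" using \<kappa>_def g by simp
    ultimately show ?thesis by simp
  qed (use \<kappa>_def in simp)
  show "inner_at X k f (bottom_up_level X k f i) \<le> 2 powr (13 * real i) * \<epsilon> powr (1 / 3) * expect_at X k f"
  \<comment> \<open>If f vanishes on the faces, its sup norm is 0 and pseudorandomness does not
    restrict \<epsilon>, but both sides of the claim are 0. Otherwise the sup norm is 1, and an
    i-face inside the support forces \<epsilon> \<ge> 0.\<close>
  proof (cases "\<forall>s\<in>faces X k. f s = 0")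
    case True
    then show ?thesis by (simp add: inner_at_def expect_at_def)
  next
    case False
    then obtain s where s: "s \<in> faces X k" "f s = 1" using f by auto
    have "sup_norm_at X k f = 1"
      unfolding sup_norm_at_def using f s faces_finite[OF pure, of k] by (intro Max_eqI) force+
    then have down: "\<bar>down_iter X k i f \<tau>\<bar> \<le> \<epsilon>" if "\<tau> \<in> faces X i" for \<tau>
      using pseudo that by (simp add: pseudorandom_def)
    obtain \<tau> where "\<tau> \<subseteq> s" "card \<tau> = i"
      using obtain_subset_with_card_n[of i s] i facesD(2)[OF pure s(1)] by auto
    then have "\<tau> \<in> faces X i" using faces_subset[OF s(1)] by blast
    then have "0 \<le> \<epsilon>" using down by force
    moreover have "down_iter X k i f \<tau> \<le> \<epsilon>" if "\<tau> \<in> faces X i" for \<tau> using down[OF that] by simp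
    ultimately show ?thesis using f i small by (intro inner_bottom_up_level_le) auto
  qed
qed

end
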